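(* Let $N\ge 2$ be an integer, $0\le b<2<p<q<2^*_b$, $\delta=\frac{2-b}{q-2}$ and $a=2-\delta(p-2)=b+\delta(q-p)$. Let $(\eta,r)$ be a subscaled pair. Then the problem $$-\Delta u+\frac{|u|^{q-2}u}{|x|^b}=\frac{|u|^{r-2}u}{|x|^\eta}\quad\text{in }\mathbb{R}^N$$ has a sequence of solutions $(u_k)$ at negative levels such that $\Phi(u_k)\nearrow0$.
   Context: For $0\le\eta<N$: $2^*_\eta=+\infty$ if $N=2$ and $2^*_\eta=\frac{2(N-\eta)}{N-2}$ if $N\ge3$. For $r\ge1$, $L^r_\eta(\mathbb{R}^N)=L^r(\mathbb{R}^N;|x|^{-\eta}dx)$. The space $E^q_b=\{u\in L^q_b(\mathbb{R}^N):\nabla u\in (L^2(\mathbb{R}^N))^N\}$ (weak gradient) carries the norm $\|u\|=\big[\int_{\mathbb{R}^N}|\nabla u|^2dx+\big(\int_{\mathbb{R}^N}\frac{|u|^q}{|x|^b}dx\big)^{2/q}\big]^{1/2}$. Solution: for a Carathéodory $f$, a (weak) solution of $-\Delta u+|x|^{-b}|u|^{q-2}u=f(x,u)$ is $u\in E^q_b$ with $f(\cdot,u)\in L^1_{loc}(\mathbb{R}^N)$ and $\int\nabla u\cdot\nabla v\,dx+\int\frac{|u|^{q-2}uv}{|x|^b}dx=\int f(x,u)v\,dx$ for all $v\in C_c^\infty(\mathbb{R}^N)$. The energy functional is $\Phi(u)=\frac12\int|\nabla u|^2dx+\frac1q\int\frac{|u|^q}{|x|^b}dx-\int F(x,u)dx$,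 with $F(x,s)=\int_0^sf(x,t)dt$. "At negative levels" means $\Phi(u_k)<0$; $\nearrow$ means nondecreasing with the indicated limit. Exponents: $2^*_{b,q,\eta}=\frac{q(N-\eta)}{N-b}$ if $N\ge2$ and $b\le\eta$; $2^*_{b,q,\eta}=\frac{\eta q(N-2)+2N(b-\eta)}{b(N-2)}$ if $N\ge3$ and $0\le\eta<b$. Set $\ell(\eta,r)=r\delta+\eta-N$ and $\ell=\ell(b,q)=\ell(a,p)$. Admissible pairs: $(\eta,r)$ is admissible if $0\le\eta<\frac{N+2}{2}$ (and $b\le\eta<2$ if $N=2$), $r>1$ and $r\in(2^*_{b,q,\eta},2^*_\eta)$; in addition, $r=2^*_{b,q,\eta}$ is allowed when $\eta\le b$, and $r=2^*_\eta$ is allowed when $\eta\le2$ and $N\ge3$. An admissible pair is subscaled if $\ell(\eta,r)<\ell$, scaled if $\ell(\eta,r)=\ell$, superscaled if $\ell(\eta,r)>\ell$. *)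

theory Defs
  imports "HOL-Analysis.Analysis"
begin

text \<open>
  Elements of Lebesgue and Sobolev spaces are represented by Borel measurable functions; every
  class modulo equality almost everywhere has such a representative. In Isabelle
  \<open>0 powr 0 = 0\<close> and \<open>x / 0 = 0\<close>, so the weight \<open>1 / norm x powr \<eta>\<close> has the value \<open>0\<close> at the
  origin; this affects a null set only. For \<open>r > 1\<close> the expression \<open>\<bar>s\<bar> powr (r - 2) * s\<close>
  vanishes at \<open>s = 0\<close>, as it should, also when \<open>r \<le> 2\<close>.
\<close>

primrec C_k :: "nat \<Rightarrow> ('a::euclidean_space \<Rightarrow> real) \<Rightarrow> bool" where
  "C_k 0 v \<longleftrightarrow> continuous_on UNIV v"
| "C_k (Suc k) v \<longleftrightarrow> v differentiable_on UNIV \<and>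
     (\<forall>i\<in>Basis. C_k k (\<lambda>x. frechet_derivative v (at x) i))"

definition test_function :: "('a::euclidean_space \<Rightarrow> real) \<Rightarrow> bool" where
  "test_function v \<longleftrightarrow> (\<forall>k. C_k k v) \<and> compact (closure {x. v x \<noteq> 0})"

definition gradient :: "('a::euclidean_space \<Rightarrow> real) \<Rightarrow> 'a \<Rightarrow> 'a" where
  "gradient v x = (\<Sum>i\<in>Basis. frechet_derivative v (at x) i *\<^sub>R i)"

definition locally_integrable :: "('a::euclidean_space \<Rightarrow> 'b::euclidean_space) \<Rightarrow> bool" where
  "locally_integrable g \<longleftrightarrow>
     g \<in> borel_measurable borel \<and> (\<forall>K. compact K \<longrightarrow> set_integrable lborel K g)"

definition has_weak_gradient ::
    "('a::euclidean_space \<Rightarrow> real) \<Rightarrow> ('a \<Rightarrow> 'a) \<Rightarrow> bool" where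
  "has_weak_gradient u G \<longleftrightarrow> locally_integrable u \<and> locally_integrable G \<and>
     (\<forall>v. test_function v \<longrightarrow> (\<forall>i\<in>Basis.
        (\<integral>x. u x * (gradient v x \<bullet> i) \<partial>lborel) = - (\<integral>x. (G x \<bullet> i) * v x \<partial>lborel)))"

text \<open>A weak gradient is unique up to a null set, so no integral below depends on the choice.\<close>

definition weak_gradient :: "('a::euclidean_space \<Rightarrow> real) \<Rightarrow> 'a \<Rightarrow> 'a" where
  "weak_gradient u = (SOME G. has_weak_gradient u G)"

definition weighted_Lp :: "real \<Rightarrow> real \<Rightarrow> ('a::euclidean_space \<Rightarrow> real) set" where
  "weighted_Lp \<eta> r = {u \<in> borel_measurable borel.
     integrable lborel (\<lambda>x. \<bar>u x\<bar> powr r / norm x powr \<eta>)}"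

definition E_space :: "real \<Rightarrow> real \<Rightarrow> ('a::euclidean_space \<Rightarrow> real) set" where
  "E_space b q = {u \<in> weighted_Lp b q. (\<exists>G. has_weak_gradient u G) \<and>
     integrable lborel (\<lambda>x. (norm (weak_gradient u x))\<^sup>2)}"

definition caratheodory :: "('a::euclidean_space \<Rightarrow> real \<Rightarrow> real) \<Rightarrow> bool" where
  "caratheodory f \<longleftrightarrow> (\<forall>s. (\<lambda>x. f x s) \<in> borel_measurable borel) \<and>
     (AE x in lborel. continuous_on UNIV (f x))"

definition weak_solution ::
    "real \<Rightarrow> real \<Rightarrow> ('a::euclidean_space \<Rightarrow> real \<Rightarrow> real) \<Rightarrow> ('a \<Rightarrow> real) \<Rightarrow> bool" where
  "weak_solution b q f u \<longleftrightarrow> caratheodory f \<and> u \<in> E_space b q \<and>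
     locally_integrable (\<lambda>x. f x (u x)) \<and>
     (\<forall>v. test_function v \<longrightarrow>
        (\<integral>x. weak_gradient u x \<bullet> gradient v x \<partial>lborel)
        + (\<integral>x. \<bar>u x\<bar> powr (q - 2) * u x * v x / norm x powr b \<partial>lborel)
        = (\<integral>x. f x (u x) * v x \<partial>lborel))"

text \<open>The interval integral is oriented, i.e. it changes sign when \<open>s < 0\<close>.\<close>

definition primitive :: "('a \<Rightarrow> real \<Rightarrow> real) \<Rightarrow> 'a \<Rightarrow> real \<Rightarrow> real" where
  "primitive f x s = (LBINT t=ereal 0..ereal s. f x t)"

text \<open>
  If \<open>primitive f x (u x)\<close> were not integrable, its Bochner integral would be \<open>0\<close> by convention and
  the energy would be nonnegative. Negative energy therefore entails that the last integral exists.
\<close>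

definition energy ::
    "real \<Rightarrow> real \<Rightarrow> ('a::euclidean_space \<Rightarrow> real \<Rightarrow> real) \<Rightarrow> ('a \<Rightarrow> real) \<Rightarrow> real" where
  "energy b q f u =
     1 / 2 * (\<integral>x. (norm (weak_gradient u x))\<^sup>2 \<partial>lborel)
     + 1 / q * (\<integral>x. \<bar>u x\<bar> powr q / norm x powr b \<partial>lborel)
     - (\<integral>x. primitive f x (u x) \<partial>lborel)"

definition power_nonlinearity :: "real \<Rightarrow> real \<Rightarrow> 'a::euclidean_space \<Rightarrow> real \<Rightarrow> real" where
  "power_nonlinearity \<eta> r x s = \<bar>s\<bar> powr (r - 2) * s / norm x powr \<eta>"

definition crit_exp :: "nat \<Rightarrow> real \<Rightarrow> ereal" where
  "crit_exp N \<eta> = (if N = 2 then \<infinity> else ereal (2 * (real N - \<eta>) / (real N - 2)))"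

text \<open>The second branch is meaningful for \<open>N \<ge> 3\<close> only; admissibility excludes \<open>N = 2\<close>, \<open>\<eta> < b\<close>.\<close>

definition lower_exp :: "nat \<Rightarrow> real \<Rightarrow> real \<Rightarrow> real \<Rightarrow> real" where
  "lower_exp N b q \<eta> =
     (if b \<le> \<eta> then q * (real N - \<eta>) / (real N - b)
      else (\<eta> * q * (real N - 2) + 2 * real N * (b - \<eta>)) / (b * (real N - 2)))"

definition admissible :: "nat \<Rightarrow> real \<Rightarrow> real \<Rightarrow> real \<Rightarrow> real \<Rightarrow> bool" where
  "admissible N b q \<eta> r \<longleftrightarrow>
     0 \<le> \<eta> \<and> \<eta> < (real N + 2) / 2 \<and> (N = 2 \<longrightarrow> b \<le> \<eta> \<and> \<eta> < 2) \<and> 1 < r \<and>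
     (lower_exp N b q \<eta> < r \<and> ereal r < crit_exp N \<eta>
      \<or> \<eta> \<le> b \<and> r = lower_exp N b q \<eta>
      \<or> \<eta> \<le> 2 \<and> 3 \<le> N \<and> ereal r = crit_exp N \<eta>)"

definition ell :: "nat \<Rightarrow> real \<Rightarrow> real \<Rightarrow> real \<Rightarrow> real" where
  "ell N \<delta> \<eta> r = r * \<delta> + \<eta> - real N"

definition subscaled :: "nat \<Rightarrow> real \<Rightarrow> real \<Rightarrow> real \<Rightarrow> real \<Rightarrow> real \<Rightarrow> bool" where
  "subscaled N b q \<delta> \<eta> r \<longleftrightarrow> admissible N b q \<eta> r \<and> ell N \<delta> \<eta> r < ell N \<delta> b q"

lemma ell_eq:
  assumes "q \<noteq> 2" "\<delta> = (2 - b) / (q - 2)" "a = 2 - \<delta> * (p - 2)"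
  shows "a = b + \<delta> * (q - p)" and "ell N \<delta> b q = ell N \<delta> a p"
proof -
  have "\<delta> * (q - 2) = 2 - b"
    using assms by simp
  then show "a = b + \<delta> * (q - p)" "ell N \<delta> b q = ell N \<delta> a p"
    using assms(3) by (simp_all add: ell_def algebra_simps)
qed

lemma caratheodory_power_nonlinearity:
  assumes "1 < r"
  shows "caratheodory (power_nonlinearity \<eta> r :: 'a::euclidean_space \<Rightarrow> real \<Rightarrow> real)"
proof -
  have eq: "\<bar>s\<bar> powr (r - 2) * s = sgn s * \<bar>s\<bar> powr (r - 1)" for s :: real
  proof (cases "s = 0")
    case False
    have "\<bar>s\<bar> powr (r - 1) = \<bar>s\<bar> powr (r - 2) * \<bar>s\<bar>"
      using False powr_add[of "\<bar>s\<bar>" "r - 2" 1] by simp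
    then show ?thesis
      by (simp add: sgn_if)
  qed simp
  have "isCont (\<lambda>s::real. \<bar>s\<bar> powr (r - 2) * s) s" for s
  proof (cases "s = 0")
    case False
    then show ?thesis
      by (intro continuous_intros) auto
  next
    case True
    have "((\<lambda>s::real. \<bar>s\<bar> powr (r - 1)) \<longlongrightarrow> 0) (at 0)"
      using assms by (auto intro!: tendsto_eq_intros)
    then have "((\<lambda>s::real. \<bar>s\<bar> powr (r - 2) * s) \<longlongrightarrow> 0) (at 0)"
      unfolding eq by (rule Lim_null_comparison[rotated]) (auto simp: sgn_if abs_mult)
    then show ?thesis
      by (simp add: True isCont_def)
  qed
  then have cont: "continuous_on UNIV (\<lambda>s::real. \<bar>s\<bar> powr (r - 2) * s)"
    by (simp add: continuous_on_eq_continuous_at)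
  have "continuous_on UNIV (power_nonlinearity \<eta> r x)" for x :: 'a
    unfolding power_nonlinearity_def divide_inverse
    by (rule continuous_on_mult[OF cont continuous_on_const])
  then show ?thesis
    unfolding caratheodory_def by (auto simp: power_nonlinearity_def)
qed

end

theory Submission
  imports Defs "HOL-Complex_Analysis.Great_Picard"
begin

text \<open>
  The action \<open>J u = 1/2 \<integral>\<bar>\<nabla>u\<bar>\<^sup>2 + 1/q \<integral>\<bar>u\<bar>\<^sup>q/\<bar>x\<bar>\<^sup>b - 1/r \<integral>\<bar>u\<bar>\<^sup>r/\<bar>x\<bar>\<^sup>\<eta>\<close> has infinitely
  many critical points that are minimisers over symmetry classes, on which it is bounded below.
  For all large \<open>k\<close> let \<open>X\<^sub>k\<close> be the space of test functions that change sign under the rotation by \<open>\<theta> = \<pi>/k\<close> in one fixed coordinate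
  plane, and let \<open>c\<^sub>k\<close> be the infimum of \<open>J\<close> on \<open>X\<^sub>k\<close>. Four facts give the theorem: \<open>c\<^sub>k < 0\<close>;
  \<open>c\<^sub>k \<rightarrow> 0\<close>; \<open>c\<^sub>k\<close> is attained at a limit of functions in \<open>X\<^sub>k\<close>; a minimiser solves the equation tested
  against all test functions, not only those in \<open>X\<^sub>k\<close>. A sequence of negative numbers with
  limit zero has a nondecreasing subsequence.

  \<^emph>\<open>Hardy inequality.\<close> If \<open>u\<close> changes sign under the rotation by \<open>\<theta>\<close>, then following the rotation from
  \<open>x\<close> to the image point changes \<open>u\<close> by \<open>2 \<bar>u x\<bar>\<close> along an arc of length at most \<open>\<theta> \<bar>x\<bar>\<close>. As rotations
  preserve Lebesgue measure, \<open>\<integral>\<bar>u\<bar>\<^sup>2/\<bar>x\<bar>\<^sup>2 \<le> \<theta>\<^sup>2/4 \<integral>\<bar>\<nabla>u\<bar>\<^sup>2\<close> (\<open>antisymmetric_hardy\<close>). This holds in dimension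
  two as well, and the constant tends to zero with \<open>\<theta>\<close>.

  \<^emph>\<open>Absorption.\<close> For a subscaled pair and every \<open>\<epsilon> > 0\<close>, the term \<open>\<bar>u\<bar>\<^sup>r/\<bar>x\<bar>\<^sup>\<eta>\<close> is bounded pointwise by
  \<open>\<epsilon> (\<bar>u\<bar>\<^sup>2/\<bar>x\<bar>\<^sup>2 + \<bar>u\<bar>\<^sup>q/\<bar>x\<bar>\<^sup>b)\<close>, a multiple of \<open>\<bar>u\<bar>\<^sup>2\<close> on a fixed ball, and a function of integral at most
  \<open>\<epsilon>\<close> (\<open>subscaled_absorption\<close>). The multiple of \<open>\<bar>u\<bar>\<^sup>2\<close> is controlled by the Hardy inequality when \<open>k\<close> is
  large, and this gives coercivity and \<open>c\<^sub>k \<rightarrow> 0\<close>. On a minimising sequence it is controlled by local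
  \<open>L\<^sup>2\<close> compactness (\<open>rellich\<close>), and this makes the \<open>r\<close>-term continuous along a subsequence.

  \<^emph>\<open>Existence.\<close> With the \<open>r\<close>-term under control, the uniform convexity of the two other terms shows
  that a minimising sequence is Cauchy (\<open>minimizing_sequence_cauchy\<close>). The limit has a weak gradient,
  and its action is \<open>c\<^sub>k\<close>. Working with strong limits of test functions, every property of the minimiser
  is inherited from smooth functions.

  \<^emph>\<open>The equation.\<close> The derivative of \<open>J\<close> at the minimiser vanishes on \<open>X\<^sub>k\<close>. The minimiser is itself
  antisymmetric, so this derivative has the same value, up to sign, at \<open>v\<close> and at every
  rotate of \<open>v\<close> by a multiple of \<open>\<theta>\<close>.
  It therefore agrees, up to the factor \<open>2k\<close>, with its value at the antisymmetrisation of \<open>v\<close>, which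
  lies in \<open>X\<^sub>k\<close> (\<open>rot_minimizer_pairing\<close>).

  \<^emph>\<open>Negative level.\<close> Under the dilations \<open>t\<^sup>\<delta> u(t x)\<close> the first two terms of \<open>J\<close> are multiplied by the same
  power of \<open>t\<close>. In the subscaled case the exponent belonging to the third term is smaller, so that this
  term wins as \<open>t \<rightarrow> 0\<close> (\<open>exists_negative_action\<close>).
\<close>

section \<open>Calculus of test functions\<close>

lemma frechet_eqI: "(f has_derivative f') (at x) \<Longrightarrow> frechet_derivative f (at x) i = f' i"
  by (metis frechet_derivative_at)

lemma C_k_mono_Suc: "C_k (Suc k) v \<Longrightarrow> C_k k v"
proof (induction k arbitrary: v)
  case 0
  then show ?case by (simp add: differentiable_imp_continuous_on)
next
  case (Suc k)
  then show ?case by (metis C_k.simps(2))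
qed

lemma C_k_const: "C_k k (\<lambda>x. c)"
  by (induction k arbitrary: c) (auto simp: frechet_eqI[OF has_derivative_const])

lemma C_k_add: "C_k k u \<Longrightarrow> C_k k v \<Longrightarrow> C_k k (\<lambda>x. u x + v x)"
proof (induction k arbitrary: u v)
  case 0
  then show ?case by (simp add: continuous_on_add)
next
  case (Suc k)
  have d: "(u has_derivative frechet_derivative u (at x)) (at x)"
    "(v has_derivative frechet_derivative v (at x)) (at x)" for x
    using Suc.prems by (auto simp: differentiable_on_def frechet_derivative_works[symmetric])
  show ?case
    using Suc by (simp add: frechet_eqI[OF has_derivative_add[OF d]] differentiable_on_def)
qed

lemma C_k_mult: "C_k k u \<Longrightarrow> C_k k v \<Longrightarrow> C_k k (\<lambda>x. u x * v x)"
proof (induction k arbitrary: u v)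
  case 0
  then show ?case by (simp add: continuous_on_mult)
next
  case (Suc k)
  have d: "(u has_derivative frechet_derivative u (at x)) (at x)"
    "(v has_derivative frechet_derivative v (at x)) (at x)" for x
    using Suc.prems by (auto simp: differentiable_on_def frechet_derivative_works[symmetric])
  show ?case
    using Suc C_k_mono_Suc[OF Suc.prems(1)] C_k_mono_Suc[OF Suc.prems(2)]
    by (simp add: frechet_eqI[OF has_derivative_mult[OF d]] differentiable_on_def C_k_add)
qed

lemma C_k_sum:
  assumes "\<And>i. i \<in> I \<Longrightarrow> C_k k (f i)"
  shows "C_k k (\<lambda>x. \<Sum>i\<in>I. f i x)"
  using assms
proof (induction I rule: infinite_finite_induct)
  case (insert i I)
  then show ?case using C_k_add[of k "f i" "\<lambda>x. \<Sum>j\<in>I. f j x"] by simp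
qed (auto simp: C_k_const)

lemma C_k_prod:
  assumes "\<And>i. i \<in> I \<Longrightarrow> C_k k (f i)"
  shows "C_k k (\<lambda>x. \<Prod>i\<in>I. f i x)"
  using assms
proof (induction I rule: infinite_finite_induct)
  case (insert i I)
  then show ?case using C_k_mult[of k "f i" "\<lambda>x. \<Prod>j\<in>I. f j x"] by simp
qed (auto simp: C_k_const)

text \<open>
  The sequence \<open>d\<close> lists a function of one variable with all its derivatives, so that ridge functions
  are smooth by induction on the order of differentiability. This is the source of the bumps below.
\<close>

lemma C_k_compose_affine:
  fixes d :: "nat \<Rightarrow> real \<Rightarrow> real" and a :: "'a::euclidean_space"
  assumes d: "\<And>j t. (d j has_real_derivative d (Suc j) t) (at t)"
  shows "C_k k (\<lambda>x. d j (x \<bullet> a + c))"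
proof (induction k arbitrary: j)
  case 0
  have "continuous_on UNIV (d j)" using d by (meson DERIV_continuous_on has_field_derivative_at_within)
  then show ?case
    by (auto intro!: continuous_on_compose2[of UNIV "d j"] continuous_intros)
next
  case (Suc k)
  have D: "((\<lambda>x. d j (x \<bullet> a + c)) has_derivative (\<lambda>h. d (Suc j) (x \<bullet> a + c) * (h \<bullet> a))) (at x)" for x
    by (rule has_derivative_compose[of "\<lambda>x. x \<bullet> a + c", OF _ d[THEN has_field_derivative_imp_has_derivative]])
      (auto intro!: derivative_eq_intros)
  then have "(\<lambda>x. d j (x \<bullet> a + c)) differentiable_on UNIV"
    by (auto simp: differentiable_on_def differentiable_def)
  then show ?case
    by (auto simp: frechet_eqI[OF D] intro!: C_k_mult Suc C_k_const)
qed

lemma C_k_compose_linear: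
  fixes R :: "'a::euclidean_space \<Rightarrow> 'a"
  assumes R: "linear R"
  shows "C_k k v \<Longrightarrow> C_k k (\<lambda>x. v (R x))"
proof (induction k arbitrary: v)
  case 0
  have "continuous_on UNIV R" using R by (simp add: linear_continuous_on linear_conv_bounded_linear)
  with 0 show ?case by (auto intro: continuous_on_compose2[of UNIV v])
next
  case (Suc k)
  have d: "(v has_derivative frechet_derivative v (at x)) (at x)" for x
    using Suc.prems by (auto simp: differentiable_on_def frechet_derivative_works[symmetric])
  have D: "((\<lambda>x. v (R x)) has_derivative (\<lambda>h. frechet_derivative v (at (R x)) (R h))) (at x)" for x
    using R by (intro has_derivative_compose[of R, OF _ d] bounded_linear_imp_has_derivative)
      (simp add: linear_conv_bounded_linear)
  have E: "frechet_derivative v (at (R x)) (R i) =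
      (\<Sum>j\<in>Basis. (R i \<bullet> j) * frechet_derivative v (at (R x)) j)" for x i
    using has_derivative_linear[OF d[of "R x"]]
    by (subst euclidean_representation[symmetric, of "R i"])
      (simp add: linear_sum linear_cmul)
  have "(\<lambda>x. v (R x)) differentiable_on UNIV"
    using D by (auto simp: differentiable_on_def differentiable_def)
  then show ?case
    using Suc by (auto simp: frechet_eqI[OF D] E intro!: C_k_sum C_k_mult C_k_const)
qed

lemma test_function_iff:
  "test_function v \<longleftrightarrow> (\<forall>k. C_k k v) \<and> (\<exists>M. \<forall>x. M < norm x \<longrightarrow> v x = 0)"
proof -
  have "compact (closure {x. v x \<noteq> 0}) \<longleftrightarrow> bounded {x. v x \<noteq> 0}"
    by (meson bounded_closure bounded_subset closed_closure closure_subset compact_eq_bounded_closed)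
  also have "\<dots> \<longleftrightarrow> (\<exists>M. \<forall>x. M < norm x \<longrightarrow> v x = 0)"
    unfolding bounded_iff Ball_def mem_Collect_eq by (meson not_le)
  finally show ?thesis by (simp add: test_function_def)
qed

lemma test_function_C_k: "test_function v \<Longrightarrow> C_k k v"
  by (simp add: test_function_def)

lemma test_function_add: "test_function u \<Longrightarrow> test_function v \<Longrightarrow> test_function (\<lambda>x. u x + v x)"
  unfolding test_function_iff by (auto intro: C_k_add) (metis add.left_neutral max_less_iff_conj)

lemma test_function_mult: "test_function u \<Longrightarrow> test_function v \<Longrightarrow> test_function (\<lambda>x. u x * v x)"
  unfolding test_function_iff by (auto intro: C_k_mult)

lemma test_function_cmult: "test_function v \<Longrightarrow> test_function (\<lambda>x. c * v x)"
  unfolding test_function_iff by (auto intro: C_k_mult C_k_const)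

lemma test_function_sum:
  assumes "\<And>i. i \<in> I \<Longrightarrow> test_function (f i)"
  shows "test_function (\<lambda>x. \<Sum>i\<in>I. f i x)"
  using assms
proof (induction I rule: infinite_finite_induct)
  case (insert i I)
  then show ?case using test_function_add[of "f i" "\<lambda>x. \<Sum>j\<in>I. f j x"] by simp
qed (auto simp: C_k_const test_function_iff)

text \<open>
  Expansion by at least the factor \<open>c\<close> keeps the support bounded.
\<close>

lemma test_function_compose_linear:
  fixes R :: "'a::euclidean_space \<Rightarrow> 'a"
  assumes R: "linear R" and c: "c > 0" "\<And>x. c * norm x \<le> norm (R x)" and v: "test_function v"
  shows "test_function (\<lambda>x. v (R x))"
proof -
  obtain M where M: "\<And>x. M < norm x \<Longrightarrow> v x = 0" using v by (auto simp: test_function_iff)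
  have "v (R x) = 0" if "M / c < norm x" for x
    using that c(1) c(2)[of x] by (intro M) (auto simp: field_simps)
  then show ?thesis
    using v C_k_compose_linear[OF R] unfolding test_function_iff by blast
qed

lemma gradient_eqI: "(v has_derivative (\<lambda>h. g \<bullet> h)) (at x) \<Longrightarrow> gradient v x = g"
  by (simp add: gradient_def frechet_eqI euclidean_representation)

lemma test_function_has_derivative:
  assumes "test_function v"
  shows "(v has_derivative (\<lambda>h. gradient v x \<bullet> h)) (at x)"
proof -
  have d: "(v has_derivative frechet_derivative v (at x)) (at x)"
    using test_function_C_k[OF assms, of "Suc 0"]
    by (auto simp: differentiable_on_def frechet_derivative_works[symmetric])
  have "frechet_derivative v (at x) h = gradient v x \<bullet> h" for h
    using has_derivative_linear[OF d]
    by (subst euclidean_representation[symmetric, of h])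
      (simp add: linear_sum linear_cmul gradient_def inner_sum_left inner_sum_right mult.commute inner_commute del: euclidean_representation)
  then have "frechet_derivative v (at x) = (\<bullet>) (gradient v x)" by (rule ext)
  then show ?thesis using d by simp
qed

lemma continuous_on_test_function: "test_function v \<Longrightarrow> continuous_on UNIV v"
  using test_function_C_k[of v 0] by simp

lemma continuous_on_gradient:
  assumes "test_function v" shows "continuous_on UNIV (gradient v)"
  using test_function_C_k[OF assms, of "Suc 0"]
  by (auto simp: gradient_def[abs_def] intro!: continuous_intros)

lemma borel_measurable_test_function:
  "test_function v \<Longrightarrow> v \<in> borel_measurable borel" "test_function v \<Longrightarrow> gradient v \<in> borel_measurable borel"
  by (auto intro!: borel_measurable_continuous_onI continuous_on_test_function continuous_on_gradient)

lemma test_function_support: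
  fixes v :: "'a::euclidean_space \<Rightarrow> real"
  assumes "test_function v"
  obtains M B where "M > 0" "B > 0" "\<And>x. M < norm x \<Longrightarrow> v x = 0" "\<And>x. M < norm x \<Longrightarrow> gradient v x = 0"
    "\<And>x. \<bar>v x\<bar> \<le> B" "\<And>x. norm (gradient v x) \<le> B"
proof -
  obtain M0 where M0: "\<And>x. M0 < norm x \<Longrightarrow> v x = 0" using assms by (auto simp: test_function_iff)
  define M where "M = max 1 M0"
  have M: "M > 0" "\<And>x. M < norm x \<Longrightarrow> v x = 0" using M0 by (auto simp: M_def)
  have g0: "gradient v x = 0" if "M < norm x" for x
  proof (rule gradient_eqI)
    have "open {x::'a. M < norm x}" by (intro open_Collect_less continuous_intros)
    moreover have "(\<bullet>) (0::'a) = (\<lambda>h. 0)" by auto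
    ultimately show "(v has_derivative (\<bullet>) 0) (at x)"
      using M(2) that has_derivative_transform_within_open[OF has_derivative_const[of 0] \<open>open {x::'a. M < norm x}\<close>, of x v]
      by simp
  qed
  have "compact ((\<lambda>x. \<bar>v x\<bar> + norm (gradient v x)) ` cball 0 M)"
    by (intro compact_continuous_image continuous_intros)
      (auto intro: continuous_on_subset continuous_on_test_function[OF assms] continuous_on_gradient[OF assms])
  then obtain B where "\<forall>y\<in>(\<lambda>x. \<bar>v x\<bar> + norm (gradient v x)) ` cball 0 M. norm y \<le> B"
    unfolding compact_eq_bounded_closed bounded_iff by blast
  then have B: "\<And>x. norm x \<le> M \<Longrightarrow> norm (\<bar>v x\<bar> + norm (gradient v x)) \<le> B"
    by simp
  have "\<bar>v x\<bar> \<le> max 1 B \<and> norm (gradient v x) \<le> max 1 B" for x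
    using B[of x] M(2)[of x] g0[of x] norm_ge_zero[of "gradient v x"]
    by (cases "norm x \<le> M"; simp add: le_max_iff_disj; linarith)
  then show ?thesis using M g0 by (intro that[of M "max 1 B"]) auto
qed

section \<open>Smooth bumps and uniqueness of the weak gradient\<close>

text \<open>
  Differentiating \<open>p (1/t) exp (-1/t)\<close> gives the same expression with \<open>p\<close> replaced by \<open>y\<^sup>2 (p - p')\<close>. So
  \<open>flat n\<close> is the \<open>n\<close>-th derivative of the function that is \<open>exp (-1/t)\<close> for \<open>t > 0\<close> and zero elsewhere.
\<close>

primrec flat_poly :: "nat \<Rightarrow> real poly" where
  "flat_poly 0 = 1"
| "flat_poly (Suc n) = [:0, 0, 1:] * (flat_poly n - pderiv (flat_poly n))"

definition flat :: "nat \<Rightarrow> real \<Rightarrow> real" where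
  "flat n t = (if 0 < t then poly (flat_poly n) (1 / t) * exp (- (1 / t)) else 0)"

lemma tendsto_poly_exp_neg: "((\<lambda>y. poly p y * exp (- y)) \<longlongrightarrow> (0::real)) at_top"
proof -
  have "((\<lambda>y. \<Sum>i\<le>degree p. coeff p i * (y ^ i / exp y)) \<longlongrightarrow> (\<Sum>i\<le>degree p. coeff p i * 0)) at_top"
    by (intro tendsto_intros tendsto_power_div_exp_0)
  moreover have "poly p y * exp (- y) = (\<Sum>i\<le>degree p. coeff p i * (y ^ i / exp y))" for y
    by (simp add: poly_altdef exp_minus sum_distrib_right divide_inverse mult.assoc)
  ultimately show ?thesis by simp
qed

lemma flat_has_derivative: "(flat n has_real_derivative flat (Suc n) t) (at t)"
proof -
  consider "t > 0" | "t < 0" | "t = 0" by linarith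
  then show ?thesis
  proof cases
    case 1
    have p: "((\<lambda>t. poly (flat_poly n) (1 / t)) has_real_derivative
        poly (pderiv (flat_poly n)) (1 / t) * (- (1 / t\<^sup>2))) (at t)"
      using 1 by (intro DERIV_chain2[OF poly_DERIV]) (auto intro!: derivative_eq_intros simp: power2_eq_square)
    have "((\<lambda>t. poly (flat_poly n) (1 / t) * exp (- (1 / t))) has_real_derivative flat (Suc n) t) (at t)"
      using 1 by (auto intro!: derivative_eq_intros p simp: flat_def power2_eq_square field_simps)
    then show ?thesis
      by (rule has_field_derivative_transform_within_open[of _ _ _ "{0<..}"]) (use 1 in \<open>auto simp: flat_def\<close>)
  next
    case 2
    have "((\<lambda>t. 0) has_real_derivative flat (Suc n) t) (at t)" using 2 by (simp add: flat_def)
    then show ?thesis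
      by (rule has_field_derivative_transform_within_open[of _ _ _ "{..<0}"]) (use 2 in \<open>auto simp: flat_def\<close>)
  next
    \<comment> \<open>At the origin exponential decay in 1/t beats every polynomial in 1/t.\<close>
    case 3
    have "((\<lambda>h. flat n h / h) \<longlongrightarrow> 0) (at_right 0)"
    proof -
      have "((\<lambda>h. poly ([:0,1:] * flat_poly n) (inverse h) * exp (- inverse h)) \<longlongrightarrow> (0::real)) (at_right 0)"
        by (rule filterlim_compose[OF tendsto_poly_exp_neg filterlim_inverse_at_top_right])
      then show ?thesis
        by (rule Lim_transform_eventually)
          (auto simp: eventually_at_filter flat_def divide_inverse algebra_simps)
    qed
    moreover have "((\<lambda>h. flat n h / h) \<longlongrightarrow> 0) (at_left 0)"
      by (rule Lim_transform_eventually[OF tendsto_const])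
          (auto simp: eventually_at_filter flat_def)
    ultimately have "((\<lambda>h. flat n h / h) \<longlongrightarrow> 0) (at 0)"
      by (simp add: filterlim_at_split)
    then show ?thesis using 3 by (simp add: has_field_derivative_iff flat_def)
  qed
qed

text \<open>
  The parameter \<open>n\<close> is a steepness: as \<open>n\<close> grows, the bumps increase to the indicator of the box.
\<close>

definition box_bump :: "'a::euclidean_space \<Rightarrow> 'a \<Rightarrow> real \<Rightarrow> 'a \<Rightarrow> real" where
  "box_bump a b n x = (\<Prod>i\<in>Basis. flat 0 (n * ((x - a) \<bullet> i)) * flat 0 (n * ((b - x) \<bullet> i)))"

lemma flat0_bounds: "0 \<le> flat 0 t" "flat 0 t \<le> 1" "t \<le> 0 \<Longrightarrow> flat 0 t = 0" "t > 0 \<Longrightarrow> flat 0 t > 0"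
  by (auto simp: flat_def)

lemma box_bump_bounds: "0 \<le> box_bump a b n x" "box_bump a b n x \<le> 1"
  unfolding box_bump_def
  by (auto intro!: prod_nonneg mult_nonneg_nonneg prod_le_1 mult_le_one flat0_bounds(1,2))

lemma box_bump_outside: "n \<ge> 0 \<Longrightarrow> x \<notin> box a b \<Longrightarrow> box_bump a b n x = 0"
  unfolding box_bump_def mem_box prod_zero_iff[OF finite_Basis] mult_eq_0_iff Ball_def not_all not_imp
  by (elim exE, rule_tac x=xa in bexI) (auto simp: not_less inner_diff_left mult_nonneg_nonpos flat0_bounds(3))

lemma box_bump_pos: "n > 0 \<Longrightarrow> x \<in> box a b \<Longrightarrow> box_bump a b n x > 0"
  unfolding box_bump_def mem_box
  by (auto intro!: prod_pos mult_pos_pos flat0_bounds(4) simp: inner_diff_left)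

lemma test_function_box_bump:
  assumes "n \<ge> 0" shows "test_function (box_bump a b n)"
proof -
  have "C_k k (\<lambda>x. flat 0 (x \<bullet> (n *\<^sub>R i) + (- n * (a \<bullet> i))))"
    "C_k k (\<lambda>x. flat 0 (x \<bullet> (- n *\<^sub>R i) + (n * (b \<bullet> i))))" for k i
    by (rule C_k_compose_affine, rule flat_has_derivative)+
  then have "C_k k (\<lambda>x. flat 0 (n * ((x - a) \<bullet> i)) * flat 0 (n * ((b - x) \<bullet> i)))" for k i
    by (intro C_k_mult) (simp_all add: algebra_simps)
  then have "C_k k (box_bump a b n)" for k
    unfolding box_bump_def[abs_def] by (intro C_k_prod)
  moreover obtain M where "\<And>x. x \<in> box a b \<Longrightarrow> norm x \<le> M"
    using bounded_box[of a b] by (auto simp: bounded_iff)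
  ultimately show ?thesis
    unfolding test_function_iff using box_bump_outside[OF assms, of _ a b]
    by (meson not_le)
qed

lemma box_bump_tendsto:
  "(\<lambda>n. box_bump a b (real n) x) \<longlonglongrightarrow> indicator (box a b) x"
proof (cases "x \<in> box a b")
  case False
  then show ?thesis by (simp add: box_bump_outside)
next
  case True
  have "(\<lambda>n. flat 0 (real n * c)) \<longlonglongrightarrow> 1" if "c > 0" for c
  proof -
    have "(\<lambda>n. exp (- (1 / (real n * c)))) \<longlonglongrightarrow> exp (- 0)"
    proof (intro tendsto_intros)
      have "(\<lambda>n. (1 / c) * (1 / real n)) \<longlonglongrightarrow> (1/c) * 0"
        by (intro tendsto_intros lim_1_over_n)
      then show "(\<lambda>n. 1 / (real n * c)) \<longlonglongrightarrow> 0" by (simp add: field_simps)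
    qed
    then have "(\<lambda>n. exp (- (1 / (real n * c)))) \<longlonglongrightarrow> 1" by simp
    then show ?thesis
      by (rule Lim_transform_eventually)
        (use that in \<open>auto simp: flat_def eventually_sequentially intro!: exI[of _ 1]\<close>)
  qed note * = this
  have "(\<lambda>n. box_bump a b (real n) x) \<longlonglongrightarrow> (\<Prod>i\<in>(Basis::'a set). 1 * 1)"
    unfolding box_bump_def using True
    by (intro tendsto_prod tendsto_mult *) (auto simp: mem_box inner_diff_left)
  then show ?thesis using True by simp
qed

lemma integrable_bounded_support:
  fixes f :: "'a::euclidean_space \<Rightarrow> 'b::{banach,second_countable_topology}"
  assumes "f \<in> borel_measurable borel" "\<And>x. M < norm x \<Longrightarrow> f x = 0" "\<And>x. norm (f x) \<le> B"
  shows "integrable lborel f"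
proof (rule integrableI_bounded_set[of "cball 0 M" _ _ B])
  show "emeasure lborel (cball (0::'a) M) < \<infinity>" by (rule emeasure_lborel_cball_finite)
  show "AE x in lborel. x \<in> cball 0 M \<longrightarrow> norm (f x) \<le> B" using assms by auto
qed (use assms in auto)

lemma locally_integrable_mult_bounded_support:
  fixes f :: "'a::euclidean_space \<Rightarrow> real"
  assumes f: "locally_integrable f" and v: "v \<in> borel_measurable borel" "\<And>x. M < norm x \<Longrightarrow> v x = 0"
    "\<And>x. \<bar>v x\<bar> \<le> B"
  shows "integrable lborel (\<lambda>x. f x * v x)"
proof (rule Bochner_Integration.integrable_bound)
  have "set_integrable lborel (cball 0 M) f" using f by (simp add: locally_integrable_def)
  then show "integrable lborel (\<lambda>x. B * (indicator (cball 0 M) x *\<^sub>R f x))"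
    by (simp add: set_integrable_def)
  have "B \<ge> 0" using v(3)[of 0] by simp
  show "AE x in lborel. norm (f x * v x) \<le> norm (B * (indicator (cball 0 M) x *\<^sub>R f x))"
  proof (intro AE_I2)
    fix x show "norm (f x * v x) \<le> norm (B * (indicator (cball 0 M) x *\<^sub>R f x))"
      using v(2)[of x] v(3)[of x] \<open>B \<ge> 0\<close>
      by (cases "M < norm x") (auto simp: abs_mult mult.commute[of "\<bar>f x\<bar>"] intro!: mult_right_mono)
  qed
qed (use f v in \<open>auto simp: locally_integrable_def\<close>)

lemma box_eq_borel_sigma: "sets (borel :: 'a::euclidean_space measure) = sigma_sets UNIV (range (\<lambda>(a,b). box a b))"
  by (simp add: borel_eq_box)

text \<open>
  Boxes generate the Borel sets and are closed under intersection. Dynkin's lemma extends the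
  vanishing of the integrals from boxes to all Borel sets inside a bounded box, in particular to the
  sets where \<open>f\<close> is nonnegative or nonpositive.
\<close>

lemma AE_zero_of_box_integrals:
  fixes f :: "'a::euclidean_space \<Rightarrow> real"
  assumes f: "locally_integrable f"
    and z: "\<And>a b. (\<integral>x. f x * indicator (box a b) x \<partial>lborel) = 0"
  shows "AE x in lborel. f x = 0"
proof -
  have [measurable]: "f \<in> borel_measurable borel" using f by (simp add: locally_integrable_def)
  have int: "integrable lborel (\<lambda>x. f x * indicator A x)" if "A \<in> sets borel" "A \<subseteq> cball 0 M" for A M
    by (rule locally_integrable_mult_bounded_support[OF f, of _ M 1]) (use that in \<open>auto simp: indicator_def\<close>)
  have *: "AE x in lborel. x \<in> box (- m *\<^sub>R One) (m *\<^sub>R One) \<longrightarrow> f x = 0" for m :: real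
  proof -
    define Q where "Q = box (- m *\<^sub>R One) (m *\<^sub>R One :: 'a)"
    obtain M where M: "Q \<subseteq> cball 0 M" using bounded_box[of "- m *\<^sub>R One" "m *\<^sub>R One :: 'a"]
      unfolding bounded_iff Q_def by (auto simp: subset_iff)
    have [measurable]: "Q \<in> sets borel" by (simp add: Q_def)
    have intQ: "integrable lborel (\<lambda>x. f x * indicator (Q \<inter> A) x)" if "A \<in> sets borel" for A
      using that M by (intro int[of _ M]) auto
    have stable: "Int_stable (range (\<lambda>(a, b :: 'a). box a b))"
      by (auto simp: Int_stable_def box_Int_box)
    have zero: "(\<integral>x. f x * indicator (Q \<inter> A) x \<partial>lborel) = 0" if "A \<in> sets borel" for A
      using stable subset_UNIV[of "range (\<lambda>(a, b :: 'a). box a b)", folded Pow_UNIV]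
        that[unfolded box_eq_borel_sigma]
    proof (induction A rule: sigma_sets_induct_disjoint)
      case (basic A)
      then show ?case using z by (auto simp: Q_def box_Int_box)
    next
      case empty
      then show ?case by simp
    next
      case (compl A)
      then have A: "A \<in> sets borel" by (simp add: box_eq_borel_sigma)
      have "(\<integral>x. f x * indicator (Q \<inter> (UNIV - A)) x \<partial>lborel) =
        (\<integral>x. f x * indicator (Q \<inter> UNIV) x - f x * indicator (Q \<inter> A) x \<partial>lborel)"
        by (intro Bochner_Integration.integral_cong) (auto simp: indicator_def)
      also have "\<dots> = (\<integral>x. f x * indicator (Q \<inter> UNIV) x \<partial>lborel) - (\<integral>x. f x * indicator (Q \<inter> A) x \<partial>lborel)"
        by (intro Bochner_Integration.integral_diff intQ A) simp
      also have "\<dots> = 0" using compl z by (simp add: Q_def)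
      finally show ?case .
    next
      case (union A)
      then have A: "A i \<in> sets borel" for i by (auto simp: box_eq_borel_sigma)
      have "(\<lambda>n. \<integral>x. f x * indicator (Q \<inter> (\<Union>i<n. A i)) x \<partial>lborel) \<longlonglongrightarrow>
        (\<integral>x. f x * indicator (Q \<inter> (\<Union>i. A i)) x \<partial>lborel)"
      proof (rule integral_dominated_convergence[where w="\<lambda>x. \<bar>f x * indicator (Q \<inter> UNIV) x\<bar>"])
        show "AE x in lborel. (\<lambda>n. f x * indicat_real (Q \<inter> (\<Union>i<n. A i)) x)
           \<longlonglongrightarrow> f x * indicat_real (Q \<inter> \<Union> (range A)) x"
        proof (intro AE_I2 tendsto_intros)
          fix x
          show "(\<lambda>n. indicat_real (Q \<inter> (\<Union>i<n. A i)) x) \<longlonglongrightarrow> indicat_real (Q \<inter> \<Union> (range A)) x"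
          proof (cases "x \<in> (\<Union>i. A i)")
            case True
            then obtain i where "x \<in> A i" by auto
            then show ?thesis
              by (intro tendsto_eventually)
                (auto simp: eventually_sequentially indicator_def intro!: exI[of _ "Suc i"] bexI[of _ i])
          qed (auto simp: indicator_def)
        qed
        show "AE x in lborel. norm (f x * indicat_real (Q \<inter> (\<Union>i<n. A i)) x) \<le> \<bar>f x * indicat_real (Q \<inter> UNIV) x\<bar>" for n
          by (auto simp: indicator_def)
        show "integrable lborel (\<lambda>x. \<bar>f x * indicat_real (Q \<inter> UNIV) x\<bar>)"
          by (intro integrable_abs intQ) simp
      qed (use A in measurable)
      moreover have "(\<integral>x. f x * indicator (Q \<inter> (\<Union>i<n. A i)) x \<partial>lborel) = 0" for n
      proof -
        have "(\<integral>x. f x * indicator (Q \<inter> (\<Union>i<n. A i)) x \<partial>lborel) =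
          (\<integral>x. (\<Sum>i<n. f x * indicator (Q \<inter> A i) x) \<partial>lborel)"
        proof (intro Bochner_Integration.integral_cong refl)
          fix x
          have "disjoint_family_on A {..<n}" using union by (auto simp: disjoint_family_on_def)
          have "indicat_real (\<Union>i<n. A i) x = (\<Sum>i<n. indicat_real (A i) x)"
            by (rule indicator_UN_disjoint[OF finite_lessThan \<open>disjoint_family_on A {..<n}\<close>])
          then show "f x * indicator (Q \<inter> (\<Union>i<n. A i)) x = (\<Sum>i<n. f x * indicator (Q \<inter> A i) x)"
            by (simp only: indicator_inter_arith sum_distrib_left[symmetric] mult.assoc)
        qed
        also have "\<dots> = (\<Sum>i<n. \<integral>x. f x * indicator (Q \<inter> A i) x \<partial>lborel)"
          by (intro Bochner_Integration.integral_sum intQ A)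
        also have "\<dots> = 0" using union by simp
        finally show ?thesis .
      qed
      ultimately show ?case by (simp add: LIMSEQ_const_iff)
    qed
    have "AE x in lborel. f x * indicator (Q \<inter> {x. f x \<ge> 0}) x = 0"
    proof (subst integral_nonneg_eq_0_iff_AE[symmetric])
      show "(\<integral>x. f x * indicat_real (Q \<inter> {x. 0 \<le> f x}) x \<partial>lborel) = 0"
        by (intro zero) measurable
      show "integrable lborel (\<lambda>x. f x * indicat_real (Q \<inter> {x. 0 \<le> f x}) x)" by (intro intQ) measurable
    qed (auto simp: indicator_def)
    moreover have "AE x in lborel. - (f x * indicator (Q \<inter> {x. f x \<le> 0}) x) = 0"
    proof (subst integral_nonneg_eq_0_iff_AE[symmetric])
      show "(\<integral>x. - (f x * indicat_real (Q \<inter> {x. f x \<le> 0}) x) \<partial>lborel) = 0"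
        unfolding Bochner_Integration.integral_minus by (subst zero) measurable
      show "integrable lborel (\<lambda>x. - (f x * indicat_real (Q \<inter> {x. f x \<le> 0}) x))"
        by (intro Bochner_Integration.integrable_minus intQ) measurable
    qed (auto simp: indicator_def)
    ultimately show ?thesis unfolding Q_def[symmetric]
      by eventually_elim (auto simp: indicator_def split: if_splits)
  qed
  have "AE x in lborel. \<forall>m::nat. x \<in> box (- real m *\<^sub>R One) (real m *\<^sub>R One) \<longrightarrow> f x = 0"
    unfolding AE_all_countable using * by blast
  then show ?thesis
  proof eventually_elim
    case (elim x)
    obtain m :: nat where "norm x < real m" using reals_Archimedean2 by blast
    then have "x \<in> box (- real m *\<^sub>R One) (real m *\<^sub>R One)"
      unfolding mem_box using Basis_le_norm[of _ x] by (force simp: abs_le_iff)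
    with elim show ?case by blast
  qed
qed

lemma AE_zero_of_test_integrals:
  fixes f :: "'a::euclidean_space \<Rightarrow> real"
  assumes f: "locally_integrable f"
    and z: "\<And>v. test_function v \<Longrightarrow> (\<integral>x. f x * v x \<partial>lborel) = 0"
  shows "AE x in lborel. f x = 0"
proof (rule AE_zero_of_box_integrals[OF f])
  fix a b :: 'a
  have [measurable]: "f \<in> borel_measurable borel" using f by (simp add: locally_integrable_def)
  have [measurable]: "box_bump a b (real n) \<in> borel_measurable borel" for n
    by (intro borel_measurable_test_function test_function_box_bump) simp
  obtain M where M: "box a b \<subseteq> cball 0 M" using bounded_box[of a b]
    unfolding bounded_iff by (auto simp: subset_iff)
  have "(\<lambda>n. \<integral>x. f x * box_bump a b (real n) x \<partial>lborel) \<longlonglongrightarrow> (\<integral>x. f x * indicator (box a b) x \<partial>lborel)"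
  proof (rule integral_dominated_convergence[where w="\<lambda>x. \<bar>f x * indicator (box a b) x\<bar>"])
    show "integrable lborel (\<lambda>x. \<bar>f x * indicat_real (box a b) x\<bar>)"
      by (intro integrable_abs locally_integrable_mult_bounded_support[OF f, of _ M 1])
        (use M in \<open>auto simp: indicator_def\<close>)
    show "AE x in lborel. norm (f x * box_bump a b (real n) x) \<le> \<bar>f x * indicat_real (box a b) x\<bar>" for n
    proof (intro AE_I2)
      fix x show "norm (f x * box_bump a b (real n) x) \<le> \<bar>f x * indicat_real (box a b) x\<bar>"
        using box_bump_bounds[of a b "real n" x] box_bump_outside[of "real n" x a b]
        by (cases "x \<in> box a b") (auto simp: abs_mult mult_left_le)
    qed
  qed (auto intro!: tendsto_intros box_bump_tendsto)
  then show "(\<integral>x. f x * indicator (box a b) x \<partial>lborel) = 0"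
    by (simp add: z test_function_box_bump LIMSEQ_const_iff)
qed

lemma locally_integrable_inner:
  assumes "locally_integrable G" shows "locally_integrable (\<lambda>x. G x \<bullet> i)"
proof -
  have "integrable lborel (\<lambda>x. (indicator K x *\<^sub>R G x) \<bullet> i)" if "compact K" for K
    using assms that unfolding locally_integrable_def set_integrable_def
    by (intro integrable_inner_left) auto
  then show ?thesis
    using assms by (auto simp: locally_integrable_def set_integrable_def)
qed

lemma weak_gradient_unique:
  assumes G: "has_weak_gradient u G" and H: "has_weak_gradient u H"
  shows "AE x in lborel. G x = H x"
proof -
  have "AE x in lborel. (G x - H x) \<bullet> i = 0" if i: "i \<in> Basis" for i
  proof (rule AE_zero_of_test_integrals)
    have li: "locally_integrable (\<lambda>x. G x \<bullet> i)" "locally_integrable (\<lambda>x. H x \<bullet> i)"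
      using G H by (auto simp: has_weak_gradient_def intro: locally_integrable_inner)
    then show "locally_integrable (\<lambda>x. (G x - H x) \<bullet> i)"
      by (auto simp: locally_integrable_def inner_diff_left set_integral_diff)
    fix v :: "'a \<Rightarrow> real" assume v: "test_function v"
    obtain M B where MB: "\<And>x. M < norm x \<Longrightarrow> v x = 0" "\<And>x. \<bar>v x\<bar> \<le> B"
      using test_function_support[OF v] by metis
    have "(\<integral>x. (G x - H x) \<bullet> i * v x \<partial>lborel) = (\<integral>x. G x \<bullet> i * v x - H x \<bullet> i * v x \<partial>lborel)"
      by (simp add: inner_diff_left algebra_simps)
    also have "\<dots> = (\<integral>x. G x \<bullet> i * v x \<partial>lborel) - (\<integral>x. H x \<bullet> i * v x \<partial>lborel)"
      by (intro Bochner_Integration.integral_diff locally_integrable_mult_bounded_support[where M=M and B=B] li)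
        (auto simp: MB borel_measurable_test_function v)
    also have "\<dots> = 0" using G H v i unfolding has_weak_gradient_def by fastforce
    finally show "(\<integral>x. (G x - H x) \<bullet> i * v x \<partial>lborel) = 0" .
  qed
  then have "AE x in lborel. \<forall>i\<in>Basis. (G x - H x) \<bullet> i = 0"
    by (simp add: AE_finite_all)
  then show ?thesis
    by eventually_elim (simp add: euclidean_eq_iff[of "G _" "H _"] inner_diff_left)
qed

lemma weak_gradient_AE:
  assumes "has_weak_gradient u G" shows "AE x in lborel. weak_gradient u x = G x"
    and "weak_gradient u \<in> borel_measurable borel"
proof -
  \<comment> \<open>The choice made in the definition picks some weak gradient; uniqueness identifies it.\<close>
  have "has_weak_gradient u (weak_gradient u)"
    unfolding weak_gradient_def by (rule someI[where P="has_weak_gradient u", OF assms])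
  then show "AE x in lborel. weak_gradient u x = G x" "weak_gradient u \<in> borel_measurable borel"
    using weak_gradient_unique[OF _ assms] by (auto simp: has_weak_gradient_def locally_integrable_def)
qed

text \<open>
  Each difference quotient of \<open>w\<close> has integral zero by translation invariance, and the mean value
  theorem dominates the difference quotients by a constant on a fixed ball.
\<close>

lemma integral_partial_derivative_eq_0:
  fixes w :: "'a::euclidean_space \<Rightarrow> real"
  assumes w: "test_function w"
  shows "(\<integral>x. gradient w x \<bullet> i \<partial>lborel) = 0"
proof -
  obtain M B where MB: "M > 0" "B > 0" "\<And>x. M < norm x \<Longrightarrow> w x = 0" "\<And>x. \<bar>w x\<bar> \<le> B"
      "\<And>x. norm (gradient w x) \<le> B"
    using test_function_support[OF w] by metis
  note [measurable] = borel_measurable_test_function[OF w]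
  define t where "t n = 1 / real (Suc n)" for n
  have t: "0 < t n" "t n \<le> 1" for n by (auto simp: t_def)
  have int: "integrable lborel w" by (rule integrable_bounded_support[of _ M B]) (use MB in auto)
  have "(\<lambda>n. \<integral>x. (w (x + t n *\<^sub>R i) - w x) / t n \<partial>lborel) \<longlonglongrightarrow> (\<integral>x. gradient w x \<bullet> i \<partial>lborel)"
  proof (rule integral_dominated_convergence[where w="\<lambda>x. (B * norm i) * indicator (cball 0 (M + norm i)) x"])
    show "integrable lborel (\<lambda>x::'a. (B * norm i) * indicator (cball 0 (M + norm i)) x)"
      using emeasure_lborel_cball_finite[of "0::'a" "M + norm i"]
      by (intro integrable_mult_right integrable_real_indicator) simp_all
    show "AE x in lborel. (\<lambda>n. (w (x + t n *\<^sub>R i) - w x) / t n) \<longlonglongrightarrow> gradient w x \<bullet> i"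
    proof (intro AE_I2)
      fix x
      have "((\<lambda>s. w (x + s *\<^sub>R i)) has_derivative (\<lambda>h. gradient w (x + 0 *\<^sub>R i) \<bullet> (h *\<^sub>R i))) (at 0)"
      proof (rule has_derivative_compose[where f="\<lambda>s. x + s *\<^sub>R i" and f'="\<lambda>h. h *\<^sub>R i"])
        show "((\<lambda>s. x + s *\<^sub>R i) has_derivative (\<lambda>h. h *\<^sub>R i)) (at 0)"
          by (auto intro!: derivative_eq_intros)
      qed (rule test_function_has_derivative[OF w])
      then have "((\<lambda>s. w (x + s *\<^sub>R i)) has_real_derivative gradient w x \<bullet> i) (at 0)"
        by (simp add: has_field_derivative_def mult_commute_abs)
      then have "((\<lambda>s. (w (x + s *\<^sub>R i) - w x) / s) \<longlongrightarrow> gradient w x \<bullet> i) (at 0)"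
        by (simp add: has_field_derivative_iff)
      moreover have "filterlim t (at 0) sequentially"
        unfolding filterlim_at using LIMSEQ_inverse_real_of_nat t
        by (auto simp: t_def[abs_def] inverse_eq_divide)
      ultimately show "(\<lambda>n. (w (x + t n *\<^sub>R i) - w x) / t n) \<longlonglongrightarrow> gradient w x \<bullet> i"
        by (rule filterlim_compose)
    qed
    show "AE x in lborel. norm ((w (x + t n *\<^sub>R i) - w x) / t n) \<le> B * norm i * indicat_real (cball 0 (M + norm i)) x" for n
    proof (intro AE_I2)
      fix x
      show "norm ((w (x + t n *\<^sub>R i) - w x) / t n) \<le> B * norm i * indicat_real (cball 0 (M + norm i)) x"
      proof (cases "norm x \<le> M + norm i")
        case True
        have "norm (w (x + t n *\<^sub>R i) - w x) \<le> B * norm (x + t n *\<^sub>R i - x)"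
        proof (rule differentiable_bound[of UNIV w "\<lambda>x h. gradient w x \<bullet> h"])
          show "onorm ((\<bullet>) (gradient w x)) \<le> B" for x
            unfolding real_norm_def
            by (rule onorm_le) (auto intro!: order_trans[OF Cauchy_Schwarz_ineq2] mult_right_mono MB(5))
        qed (auto intro: has_derivative_at_withinI test_function_has_derivative[OF w])
        then have "norm (w (x + t n *\<^sub>R i) - w x) \<le> B * norm i * t n" using t[of n] by (simp add: mult_ac)
        then show ?thesis using True t[of n] by (simp add: divide_le_eq)
      next
        case False
        have "norm x \<le> norm (x + t n *\<^sub>R i) + norm (t n *\<^sub>R i)"
          by (metis add_diff_cancel_right' norm_triangle_ineq4)
        moreover have "norm (t n *\<^sub>R i) \<le> norm i" using t[of n] by (simp add: mult_left_le_one_le)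
        ultimately have "M < norm (x + t n *\<^sub>R i)" "M < norm x" using False norm_ge_zero[of i] by linarith+
        then have "w (x + t n *\<^sub>R i) = 0" "w x = 0" by (simp_all add: MB(3))
        then show ?thesis using False by simp
      qed
    qed
  next
    show "(\<lambda>x. gradient w x \<bullet> i) \<in> borel_measurable lborel" by simp
    have "(\<lambda>x. w (x + t n *\<^sub>R i)) \<in> borel_measurable borel" for n
      by (intro borel_measurable_continuous_onI continuous_on_compose2[OF continuous_on_test_function[OF w]] continuous_intros) auto
    then show "(\<lambda>x. (w (x + t n *\<^sub>R i) - w x) / t n) \<in> borel_measurable lborel" for n by simp
  qed
  moreover have "(\<integral>x. (w (x + t n *\<^sub>R i) - w x) / t n \<partial>lborel) = 0" for n
  proof -
    have d: "lborel = distr lborel borel (\<lambda>x::'a. x + t n *\<^sub>R i)"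
    proof -
      have "(+) (t n *\<^sub>R i) = (\<lambda>x. x + t n *\<^sub>R i)" by (auto simp: add.commute)
      then show ?thesis using lborel_distr_plus[of "t n *\<^sub>R i"] by simp
    qed
    have i2: "integrable lborel (\<lambda>x. w (x + t n *\<^sub>R i))"
      using int by (subst (asm) d) (simp add: integrable_distr_eq)
    have "(\<integral>x. w x \<partial>lborel) = (\<integral>x. w (x + t n *\<^sub>R i) \<partial>lborel)"
      by (subst (1) d) (simp add: integral_distr)
    then show ?thesis using int i2 by simp
  qed
  ultimately have "(\<lambda>n::nat. 0) \<longlonglongrightarrow> (\<integral>x. gradient w x \<bullet> i \<partial>lborel)" by (simp only:)
  then show ?thesis by (simp add: LIMSEQ_const_iff)
qed

lemma gradient_mult:
  assumes "test_function u" "test_function v"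
  shows "gradient (\<lambda>x. u x * v x) x = u x *\<^sub>R gradient v x + v x *\<^sub>R gradient u x"
  by (rule gradient_eqI)
    (auto intro!: derivative_eq_intros assms[THEN test_function_has_derivative] simp: algebra_simps)

lemma test_function_integration_by_parts:
  assumes u: "test_function u" and v: "test_function v"
  shows "(\<integral>x. u x * (gradient v x \<bullet> i) \<partial>lborel) = - (\<integral>x. (gradient u x \<bullet> i) * v x \<partial>lborel)"
proof -
  have int: "integrable lborel (\<lambda>x. u x * (gradient v x \<bullet> i))"
    if u: "test_function u" and v: "test_function v" for u v
  proof -
    obtain M B where MB: "B > 0" "\<And>x. M < norm x \<Longrightarrow> u x = 0" "\<And>x. \<bar>u x\<bar> \<le> B"
      using test_function_support[OF u] by metis
    obtain C where C: "\<And>x. norm (gradient v x) \<le> C"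
      using test_function_support[OF v] by metis
    note [measurable] = borel_measurable_test_function[OF u] borel_measurable_test_function[OF v]
    show ?thesis
    proof (rule integrable_bounded_support[of _ M "B * (C * norm i)"])
      show "norm (u x * (gradient v x \<bullet> i)) \<le> B * (C * norm i)" for x
        unfolding real_norm_def abs_mult using MB(1) MB(3)[of x]
        by (intro mult_mono order_trans[OF Cauchy_Schwarz_ineq2] mult_right_mono C) auto
    qed (use MB in auto)
  qed
  have "0 = (\<integral>x. u x * (gradient v x \<bullet> i) + v x * (gradient u x \<bullet> i) \<partial>lborel)"
    using integral_partial_derivative_eq_0[OF test_function_mult[OF u v], of i]
    by (simp add: gradient_mult[OF u v] inner_add_left)
  also have "\<dots> = (\<integral>x. u x * (gradient v x \<bullet> i) \<partial>lborel) + (\<integral>x. v x * (gradient u x \<bullet> i) \<partial>lborel)"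
    by (intro Bochner_Integration.integral_add int u v)
  finally show ?thesis by (simp add: mult.commute)
qed

section \<open>Measure preserving flows\<close>

text \<open>
  Along the trajectory \<open>T s x\<close>, \<open>0 \<le> s \<le> 1\<close>, whose speed is at most \<open>w x\<close>, the increment of \<open>u\<close> is at most
  \<open>w x\<close> times the integral of \<open>\<bar>\<nabla>u (T s x)\<bar>\<close>. After squaring and integrating in \<open>x\<close>, each time slice
  contributes the full Dirichlet integral because \<open>T s\<close> preserves Lebesgue measure. Translations
  and rotations are both instances.
\<close>

lemma flow_estimate:
  fixes T :: "real \<Rightarrow> 'a::euclidean_space \<Rightarrow> 'a"
  assumes u: "test_function u"
    and T0: "\<And>x. T 0 x = x"
    and T': "\<And>s x. ((\<lambda>s. T s x) has_vector_derivative T' s x) (at s)"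
    and bound: "\<And>s x. norm (T' s x) \<le> w x"
    and cont: "continuous_on UNIV (\<lambda>(s, x). T s x)"
    and inv: "\<And>s. distr lborel borel (T s) = lborel"
  shows "(\<integral>\<^sup>+x. ennreal ((u (T 1 x) - u x)\<^sup>2 / (w x)\<^sup>2) \<partial>lborel)
    \<le> (\<integral>\<^sup>+x. ennreal ((norm (gradient u x))\<^sup>2) \<partial>lborel)"
proof -
  define c where "c s x = (norm (gradient u (T s x)))\<^sup>2" for s x
  have contT: "continuous_on A (\<lambda>s. T s x)" for x A
    by (rule continuous_on_compose2[OF cont, of _ "\<lambda>s. (s, x)", simplified]) (auto intro!: continuous_intros)
  have contc: "continuous_on A (\<lambda>s. c s x)" for x A
    unfolding c_def by (intro continuous_intros continuous_on_compose2[OF continuous_on_gradient[OF u] contT]) auto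
  have point: "ennreal ((u (T 1 x) - u x)\<^sup>2 / (w x)\<^sup>2) \<le> (\<integral>\<^sup>+s. ennreal (c s x) * indicator {0..1} s \<partial>lborel)" for x
  proof (cases "w x = 0")
    case False
    then have w: "w x > 0" using bound[of 0 x] norm_ge_zero[of "T' 0 x"] by linarith
    define D where "D = u (T 1 x) - u x"
    define I where "I s = integral {0..s} (\<lambda>s. c s x)" for s
    \<comment> \<open>With D the total increment, \<open>2 D d \<le> D\<^sup>2 + d\<^sup>2\<close> applied to the derivative of u (T s x) replaces the
      Cauchy-Schwarz inequality in s.\<close>
    have "norm (D * u (T 1 x) - D * u (T 0 x)) \<le> (D\<^sup>2 * 1 + (w x)\<^sup>2 * I 1) / 2 - (D\<^sup>2 * 0 + (w x)\<^sup>2 * I 0) / 2"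
    proof (rule differentiable_bound_general[where f'="\<lambda>s. D * (gradient u (T s x) \<bullet> T' s x)" and
          \<phi>'="\<lambda>s. (D\<^sup>2 + (w x)\<^sup>2 * c s x) / 2"])
      show "continuous_on {0..1} (\<lambda>s. D * u (T s x))"
        by (intro continuous_intros continuous_on_compose2[OF continuous_on_test_function[OF u] contT]) auto
      show "continuous_on {0..1} (\<lambda>s. (D\<^sup>2 * s + (w x)\<^sup>2 * I s) / 2)"
        unfolding I_def using contc
        by (intro continuous_intros indefinite_integral_continuous_1 integrable_continuous_real) auto
      fix s :: real assume s: "0 < s" "s < 1"
      have "((\<lambda>s. u (T s x)) has_derivative (\<lambda>h. gradient u (T s x) \<bullet> (h *\<^sub>R T' s x))) (at s)"
        by (rule has_derivative_compose[where f="\<lambda>s. T s x", OF T'[unfolded has_vector_derivative_def]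
              test_function_has_derivative[OF u]])
      then have "((\<lambda>s. u (T s x)) has_real_derivative gradient u (T s x) \<bullet> T' s x) (at s)"
        by (simp add: has_field_derivative_def mult_commute_abs)
      then show "((\<lambda>s. D * u (T s x)) has_vector_derivative D * (gradient u (T s x) \<bullet> T' s x)) (at s)"
        by (intro has_real_derivative_iff_has_vector_derivative[THEN iffD1] DERIV_cmult)
      have "(I has_vector_derivative c s x) (at s within {0..1})"
        unfolding I_def using integral_has_vector_derivative[OF contc, of s 0 1] s by auto
      then have "(I has_real_derivative c s x) (at s)"
        using s by (simp add: has_real_derivative_iff_has_vector_derivative at_within_Icc_at)
      then have "((\<lambda>s. (D\<^sup>2 * s + (w x)\<^sup>2 * I s) / 2) has_real_derivative (D\<^sup>2 + (w x)\<^sup>2 * c s x) / 2) (at s)"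
        by (auto intro!: derivative_eq_intros)
      then show "((\<lambda>s. (D\<^sup>2 * s + (w x)\<^sup>2 * I s) / 2) has_vector_derivative (D\<^sup>2 + (w x)\<^sup>2 * c s x) / 2) (at s)"
        by (simp add: has_real_derivative_iff_has_vector_derivative)
      have "\<bar>gradient u (T s x) \<bullet> T' s x\<bar> \<le> norm (gradient u (T s x)) * w x"
        using Cauchy_Schwarz_ineq2[of "gradient u (T s x)" "T' s x"] bound[of s x]
        by (meson mult_left_mono norm_ge_zero order_trans)
      then have "norm (D * (gradient u (T s x) \<bullet> T' s x)) \<le> \<bar>D\<bar> * (norm (gradient u (T s x)) * w x)"
        by (simp add: abs_mult mult_left_mono)
      also have "\<dots> \<le> (\<bar>D\<bar>\<^sup>2 + (norm (gradient u (T s x)) * w x)\<^sup>2) / 2"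
        using sum_squares_bound[of "\<bar>D\<bar>" "norm (gradient u (T s x)) * w x"] by simp
      finally show "norm (D * (gradient u (T s x) \<bullet> T' s x)) \<le> (D\<^sup>2 + (w x)\<^sup>2 * c s x) / 2"
        by (simp add: c_def power_mult_distrib mult.commute)
    qed simp
    moreover have "D * u (T 1 x) - D * u (T 0 x) = D\<^sup>2" by (simp add: D_def T0 power2_eq_square algebra_simps)
    moreover have "I 0 = 0" by (simp add: I_def)
    ultimately have "norm (D\<^sup>2) \<le> (D\<^sup>2 * 1 + (w x)\<^sup>2 * I 1) / 2 - (D\<^sup>2 * 0 + (w x)\<^sup>2 * 0) / 2"
      by (simp only:)
    then have "D\<^sup>2 \<le> (D\<^sup>2 + (w x)\<^sup>2 * I 1) / 2" by simp
    then have "D\<^sup>2 / (w x)\<^sup>2 \<le> I 1" using w by (simp add: divide_le_eq mult.commute)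
    moreover have "(\<integral>\<^sup>+s. ennreal (c s x) * indicator {0..1} s \<partial>lborel) = ennreal (I 1)"
    proof -
      have "((\<lambda>s. c s x) has_integral I 1) {0..1}"
        unfolding I_def using contc by (intro integrable_integral integrable_continuous_real)
      then show ?thesis
        using nn_integral_has_integral_lebesgue'[of "{0..1}" "\<lambda>s. c s x" "I 1"]
        by (simp add: c_def nn_integral_completion mult.commute)
    qed
    ultimately show ?thesis by (simp add: D_def ennreal_leI)
  qed simp
  have mT[measurable]: "(\<lambda>(s, x). T s x) \<in> borel \<Otimes>\<^sub>M borel \<rightarrow>\<^sub>M borel"
    unfolding borel_prod by (rule borel_measurable_continuous_onI[OF cont])
  have mT1[measurable]: "T s \<in> borel \<rightarrow>\<^sub>M borel" for s
    using measurable_Pair2[OF mT, of s] by simp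
  note [measurable] = borel_measurable_test_function[OF u]
  have "(\<integral>\<^sup>+x. ennreal ((u (T 1 x) - u x)\<^sup>2 / (w x)\<^sup>2) \<partial>lborel)
      \<le> (\<integral>\<^sup>+x. \<integral>\<^sup>+s. ennreal (c s x) * indicator {0..1} s \<partial>lborel \<partial>lborel)"
    by (intro nn_integral_mono point)
  also have "\<dots> = (\<integral>\<^sup>+s. \<integral>\<^sup>+x. ennreal (c s x) * indicator {0..1} s \<partial>lborel \<partial>lborel)"
    unfolding c_def by (rule lborel_pair.Fubini') measurable
  also have "\<dots> = (\<integral>\<^sup>+s. (\<integral>\<^sup>+x. ennreal ((norm (gradient u x))\<^sup>2) \<partial>lborel) * indicator {0..1} s \<partial>(lborel::real measure))"
  proof (intro nn_integral_cong)
    fix s :: real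
    have "(\<integral>\<^sup>+x. ennreal (c s x) \<partial>lborel) = (\<integral>\<^sup>+x. ennreal ((norm (gradient u x))\<^sup>2) \<partial>distr lborel borel (T s))"
      unfolding c_def by (subst nn_integral_distr) auto
    then show "(\<integral>\<^sup>+x. ennreal (c s x) * indicator {0..1} s \<partial>lborel) =
        (\<integral>\<^sup>+x. ennreal ((norm (gradient u x))\<^sup>2) \<partial>lborel) * indicator {0..1} s"
      by (simp add: inv indicator_def)
  qed
  also have "\<dots> = (\<integral>\<^sup>+x. ennreal ((norm (gradient u x))\<^sup>2) \<partial>lborel)"
    by (subst nn_integral_cmult_indicator) auto
  finally show ?thesis .
qed

lemma translation_estimate:
  fixes u :: "'a::euclidean_space \<Rightarrow> real"
  assumes u: "test_function u"
  shows "(\<integral>\<^sup>+x. ennreal ((u (x + z) - u x)\<^sup>2) \<partial>lborel)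
    \<le> ennreal ((norm z)\<^sup>2) * (\<integral>\<^sup>+x. ennreal ((norm (gradient u x))\<^sup>2) \<partial>lborel)"
proof (cases "z = 0")
  case False
  have [measurable]: "(\<lambda>x. u (x + z)) \<in> borel_measurable borel" "u \<in> borel_measurable borel"
    by (intro borel_measurable_continuous_onI continuous_on_compose2[OF continuous_on_test_function[OF u]] continuous_intros; simp)+
  have "(\<integral>\<^sup>+x. ennreal ((u (x + 1 *\<^sub>R z) - u x)\<^sup>2 / (norm z)\<^sup>2) \<partial>lborel)
    \<le> (\<integral>\<^sup>+x. ennreal ((norm (gradient u x))\<^sup>2) \<partial>lborel)"
  proof (rule flow_estimate[OF u, where T="\<lambda>s x. x + s *\<^sub>R z" and T'="\<lambda>s x. z" and w="\<lambda>x. norm z"])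
    show "((\<lambda>s. x + s *\<^sub>R z) has_vector_derivative z) (at s)" for s x
      by (auto intro!: derivative_eq_intros)
    show "distr lborel borel (\<lambda>x. x + s *\<^sub>R z) = lborel" for s
    proof -
      have "(+) (s *\<^sub>R z) = (\<lambda>x. x + s *\<^sub>R z)" by (auto simp: add.commute)
      then show ?thesis using lborel_distr_plus[of "s *\<^sub>R z"] by simp
    qed
  qed (auto intro!: continuous_intros simp: case_prod_unfold)
  then have "ennreal ((norm z)\<^sup>2) * (\<integral>\<^sup>+x. ennreal ((u (x + z) - u x)\<^sup>2 / (norm z)\<^sup>2) \<partial>lborel)
    \<le> ennreal ((norm z)\<^sup>2) * (\<integral>\<^sup>+x. ennreal ((norm (gradient u x))\<^sup>2) \<partial>lborel)"
    by (intro mult_left_mono) auto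
  also have "ennreal ((norm z)\<^sup>2) * (\<integral>\<^sup>+x. ennreal ((u (x + z) - u x)\<^sup>2 / (norm z)\<^sup>2) \<partial>lborel)
    = (\<integral>\<^sup>+x. ennreal ((u (x + z) - u x)\<^sup>2) \<partial>lborel)"
    using False by (subst nn_integral_cmult[symmetric]) (auto simp: ennreal_mult[symmetric])
  finally show ?thesis .
qed simp

section \<open>Rotations\<close>

text \<open>
  The rotation by \<open>t\<close> in the plane of \<open>i\<close> and \<open>j\<close>, written as a perturbation of the identity, which it
  is on the orthogonal complement of the plane.
\<close>

definition rot :: "'a::euclidean_space \<Rightarrow> 'a \<Rightarrow> real \<Rightarrow> 'a \<Rightarrow> 'a" where
  "rot i j t x = x + ((cos t - 1) * (x \<bullet> i) - sin t * (x \<bullet> j)) *\<^sub>R i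
     + (sin t * (x \<bullet> i) + (cos t - 1) * (x \<bullet> j)) *\<^sub>R j"

locale plane =
  fixes i j :: "'a::euclidean_space"
  assumes ij: "i \<in> Basis" "j \<in> Basis" "i \<noteq> j"
begin

lemma inner_ij: "i \<bullet> i = 1" "j \<bullet> j = 1" "i \<bullet> j = 0" "j \<bullet> i = 0"
  using ij by (auto simp: inner_Basis)

lemma rot_inner_ij:
  "rot i j t x \<bullet> i = cos t * (x \<bullet> i) - sin t * (x \<bullet> j)"
  "rot i j t x \<bullet> j = sin t * (x \<bullet> i) + cos t * (x \<bullet> j)"
  by (simp_all add: rot_def inner_add_left inner_ij algebra_simps)

lemma rot_0: "rot i j 0 x = x" and rot_2pi: "rot i j (2 * pi) x = x"
  by (simp_all add: rot_def)

lemma rot_rot: "rot i j s (rot i j t x) = rot i j (s + t) x"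
proof -
  have "rot i j s (rot i j t x) = rot i j t x
    + ((cos s - 1) * (cos t * (x \<bullet> i) - sin t * (x \<bullet> j)) - sin s * (sin t * (x \<bullet> i) + cos t * (x \<bullet> j))) *\<^sub>R i
    + (sin s * (cos t * (x \<bullet> i) - sin t * (x \<bullet> j)) + (cos s - 1) * (sin t * (x \<bullet> i) + cos t * (x \<bullet> j))) *\<^sub>R j"
    by (simp add: rot_def[of i j s] rot_inner_ij)
  then show ?thesis
    unfolding rot_def[of i j t] rot_def[of i j "s + t"] cos_add sin_add
    by (simp add: algebra_simps)
qed

lemma rot_inner_rot: "rot i j t x \<bullet> rot i j t y = x \<bullet> y"
proof -
  have "rot i j t x \<bullet> z = x \<bullet> z + ((cos t - 1) * (x \<bullet> i) - sin t * (x \<bullet> j)) * (z \<bullet> i)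
      + (sin t * (x \<bullet> i) + (cos t - 1) * (x \<bullet> j)) * (z \<bullet> j)" for z
    unfolding rot_def inner_add_left inner_scaleR_left inner_commute[of i z] inner_commute[of j z] ..
  then have "rot i j t x \<bullet> rot i j t y = x \<bullet> rot i j t y
      + ((cos t - 1) * (x \<bullet> i) - sin t * (x \<bullet> j)) * (rot i j t y \<bullet> i)
      + (sin t * (x \<bullet> i) + (cos t - 1) * (x \<bullet> j)) * (rot i j t y \<bullet> j)" .
  moreover have "x \<bullet> rot i j t y = x \<bullet> y + ((cos t - 1) * (y \<bullet> i) - sin t * (y \<bullet> j)) * (x \<bullet> i)
     + (sin t * (y \<bullet> i) + (cos t - 1) * (y \<bullet> j)) * (x \<bullet> j)"
    by (simp add: rot_def inner_add_right)
  moreover have "e + ((A - 1) * c - B * d) * a + (B * c + (A - 1) * d) * b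
      + ((A - 1) * a - B * b) * (A * c - B * d) + (B * a + (A - 1) * b) * (B * c + A * d)
    = e + (A\<^sup>2 + B\<^sup>2 - 1) * (a * c + b * d)" for A B a b c d e :: real
    by (simp add: power2_eq_square algebra_simps)
  ultimately have "rot i j t x \<bullet> rot i j t y
    = x \<bullet> y + ((cos t)\<^sup>2 + (sin t)\<^sup>2 - 1) * ((x \<bullet> i) * (y \<bullet> i) + (x \<bullet> j) * (y \<bullet> j))"
    unfolding rot_inner_ij by simp
  then show ?thesis by simp
qed

lemma linear_rot: "linear (rot i j t)"
  by (rule linearI) (simp_all add: rot_def inner_add_left algebra_simps)

lemma orthogonal_transformation_rot: "orthogonal_transformation (rot i j t)"
  by (simp add: orthogonal_transformation_def linear_rot rot_inner_rot)

lemma norm_rot: "norm (rot i j t x) = norm x"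
  by (simp add: norm_eq_sqrt_inner rot_inner_rot)

lemma rot_inner: "rot i j t x \<bullet> y = x \<bullet> rot i j (- t) y"
  using rot_inner_rot[of t x "rot i j (- t) y"] by (simp add: rot_rot rot_0)

lemma rot_has_vector_derivative:
  "((\<lambda>s. rot i j (s * \<theta>) x) has_vector_derivative
     \<theta> *\<^sub>R ((- sin (s * \<theta>) * (x \<bullet> i) - cos (s * \<theta>) * (x \<bullet> j)) *\<^sub>R i
       + (cos (s * \<theta>) * (x \<bullet> i) - sin (s * \<theta>) * (x \<bullet> j)) *\<^sub>R j)) (at s)"
  unfolding rot_def
  by (rule derivative_eq_intros has_real_derivative_iff_has_vector_derivative[THEN iffD1] refl | simp add: algebra_simps)+

lemma norm_rot_velocity:
  "norm ((- (sin t * (x \<bullet> i)) - cos t * (x \<bullet> j)) *\<^sub>R i + (cos t * (x \<bullet> i) - sin t * (x \<bullet> j)) *\<^sub>R j) \<le> norm x"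
proof (rule power2_le_imp_le)
  have "(norm ((- (B * c) - A * d) *\<^sub>R i + (A * c - B * d) *\<^sub>R j))\<^sup>2 = (A\<^sup>2 + B\<^sup>2) * (c\<^sup>2 + d\<^sup>2)" for A B c d
    unfolding power2_norm_eq_inner
    by (simp add: inner_add_left inner_add_right inner_ij power2_eq_square algebra_simps)
  then have "(norm ((- (sin t * (x \<bullet> i)) - cos t * (x \<bullet> j)) *\<^sub>R i + (cos t * (x \<bullet> i) - sin t * (x \<bullet> j)) *\<^sub>R j))\<^sup>2
    = ((cos t)\<^sup>2 + (sin t)\<^sup>2) * ((x \<bullet> i)\<^sup>2 + (x \<bullet> j)\<^sup>2)" .
  also have "\<dots> = (x \<bullet> i)\<^sup>2 + (x \<bullet> j)\<^sup>2" by simp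
  also have "\<dots> \<le> (norm x)\<^sup>2"
  proof -
    have "0 \<le> (x - (x \<bullet> i) *\<^sub>R i - (x \<bullet> j) *\<^sub>R j) \<bullet> (x - (x \<bullet> i) *\<^sub>R i - (x \<bullet> j) *\<^sub>R j)" by simp
    also have "\<dots> = (norm x)\<^sup>2 - (x \<bullet> i)\<^sup>2 - (x \<bullet> j)\<^sup>2"
      unfolding power2_norm_eq_inner
      by (simp add: inner_diff_left inner_diff_right inner_ij power2_eq_square algebra_simps inner_commute)
    finally show ?thesis by simp
  qed
  finally show "(norm ((- (sin t * (x \<bullet> i)) - cos t * (x \<bullet> j)) *\<^sub>R i + (cos t * (x \<bullet> i) - sin t * (x \<bullet> j)) *\<^sub>R j))\<^sup>2
    \<le> (norm x)\<^sup>2" .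
qed simp

end

lemma nn_integral_lborel_translate:
  fixes f :: "'a::euclidean_space \<Rightarrow> ennreal"
  assumes [measurable]: "f \<in> borel_measurable borel"
  shows "(\<integral>\<^sup>+x. f (z + x) \<partial>lborel) = (\<integral>\<^sup>+x. f x \<partial>lborel)"
  by (subst (2) lborel_distr_plus[of z, symmetric], subst nn_integral_distr) auto

text \<open>
  The invariance comes from the uniqueness of Haar measure. Let \<open>B\<close> be the unit ball, which \<open>R\<close>
  preserves. The double integral of \<open>1\<^sub>A (R x + y) 1\<^sub>B y\<close> equals the measure of the inverse image of \<open>A\<close> times that of \<open>B\<close> if
  \<open>x\<close> is integrated first, and the measure of \<open>A\<close> times that of \<open>B\<close> if, after the substitution
  \<open>y \<rightarrow> y - R x\<close>, the ball is integrated first.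
\<close>

lemma distr_lborel_orthogonal:
  fixes R :: "'a::euclidean_space \<Rightarrow> 'a"
  assumes R: "orthogonal_transformation R"
  shows "distr lborel borel R = lborel"
proof (rule measure_eqI)
  fix A assume "A \<in> sets (distr lborel borel R)"
  then have [measurable]: "A \<in> sets borel" by simp
  have lin: "linear R" by (rule orthogonal_transformation_linear[OF R])
  have cont: "continuous_on UNIV R"
    by (intro linear_continuous_on linear_conv_bounded_linear[THEN iffD1] lin)
  have [measurable]: "R \<in> borel \<rightarrow>\<^sub>M borel" by (rule borel_measurable_continuous_onI[OF cont])
  define B where "B = ball (0::'a) 1"
  have [measurable]: "B \<in> sets borel" by (simp add: B_def)
  define c where "c = emeasure lborel B"
  have c: "c \<noteq> 0" "c \<noteq> \<infinity>"
    using content_ball_pos[of 1 "0::'a"] emeasure_lborel_ball_finite[of "0::'a" 1]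
    by (auto simp: c_def B_def measure_def)
  let ?A = "indicator A :: 'a \<Rightarrow> ennreal" and ?B = "indicator B :: 'a \<Rightarrow> ennreal"
  have "emeasure (distr lborel borel R) A = (\<integral>\<^sup>+x. ?A (R x) \<partial>lborel)"
    using nn_integral_distr[of R lborel borel ?A] by simp
  then have "emeasure (distr lborel borel R) A * c = (\<integral>\<^sup>+x. ?A (R x) \<partial>lborel) * (\<integral>\<^sup>+y. ?B y \<partial>lborel)"
    by (simp add: c_def)
  also have "\<dots> = (\<integral>\<^sup>+y. (\<integral>\<^sup>+x. ?A (R x) \<partial>lborel) * ?B y \<partial>lborel)"
    by (rule nn_integral_cmult[symmetric]) measurable
  also have "\<dots> = (\<integral>\<^sup>+y. \<integral>\<^sup>+x. ?A (R x + y) * ?B y \<partial>lborel \<partial>lborel)"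
  proof (rule nn_integral_cong)
    fix y
    obtain y' where y': "y = R y'" using orthogonal_transformation_surj[OF R] by (metis surjD)
    have "(\<integral>\<^sup>+x. ?A (R x + y) \<partial>lborel) = (\<integral>\<^sup>+x. ?A (R (y' + x)) \<partial>lborel)"
      by (simp add: y' linear_add[OF lin] add.commute)
    also have "\<dots> = (\<integral>\<^sup>+x. ?A (R x) \<partial>lborel)"
      by (rule nn_integral_lborel_translate) measurable
    finally show "(\<integral>\<^sup>+x. ?A (R x) \<partial>lborel) * ?B y = (\<integral>\<^sup>+x. ?A (R x + y) * ?B y \<partial>lborel)"
      by (simp add: nn_integral_multc)
  qed
  also have "\<dots> = (\<integral>\<^sup>+x. \<integral>\<^sup>+y. ?A (R x + y) * ?B y \<partial>lborel \<partial>lborel)"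
    by (rule lborel_pair.Fubini') measurable
  also have "\<dots> = (\<integral>\<^sup>+x. \<integral>\<^sup>+y. ?A y * ?B (y - R x) \<partial>lborel \<partial>lborel)"
  proof (rule nn_integral_cong)
    fix x
    show "(\<integral>\<^sup>+y. ?A (R x + y) * ?B y \<partial>lborel) = (\<integral>\<^sup>+y. ?A y * ?B (y - R x) \<partial>lborel)"
      using nn_integral_lborel_translate[of "\<lambda>y. ?A y * ?B (y - R x)" "R x"] by simp
  qed
  also have "\<dots> = (\<integral>\<^sup>+y. \<integral>\<^sup>+x. ?A y * ?B (y - R x) \<partial>lborel \<partial>lborel)"
    by (rule lborel_pair.Fubini'[symmetric]) measurable
  also have "\<dots> = (\<integral>\<^sup>+y. c * ?A y \<partial>lborel)"
  proof (rule nn_integral_cong)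
    fix y
    obtain y' where y': "y = R y'" using orthogonal_transformation_surj[OF R] by (metis surjD)
    have "norm (y - R x) = norm (y' - x)" for x
      by (simp add: y' linear_diff[OF lin, symmetric] orthogonal_transformation_norm[OF R])
    then have "?B (y - R x) = ?B (- y' + x)" for x
      by (simp add: B_def indicator_def norm_minus_commute)
    then have "(\<integral>\<^sup>+x. ?B (y - R x) \<partial>lborel) = c"
      using nn_integral_lborel_translate[of ?B "- y'"] by (simp add: c_def)
    then show "(\<integral>\<^sup>+x. ?A y * ?B (y - R x) \<partial>lborel) = c * ?A y"
      by (simp add: nn_integral_cmult mult.commute)
  qed
  also have "\<dots> = emeasure lborel A * c" by (simp add: nn_integral_cmult mult.commute)
  finally show "emeasure (distr lborel borel R) A = emeasure lborel A"
    using c by (metis ennreal_mult_divide_eq infinity_ennreal_def)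
qed simp

text \<open>
  Rotation at constant speed moves \<open>x\<close> with speed at most \<open>\<theta> \<bar>x\<bar>\<close>, and after unit time the value of \<open>u\<close> has
  changed by \<open>2 \<bar>u x\<bar>\<close>. The smallness of the constant for small \<open>\<theta>\<close> is what drives the levels to zero.
\<close>

lemma antisymmetric_hardy:
  fixes u :: "'a::euclidean_space \<Rightarrow> real"
  assumes p: "plane i j" and u: "test_function u" and \<theta>: "\<theta> > 0"
    and anti: "\<And>x. u (rot i j \<theta> x) = - u x"
  shows "(\<integral>\<^sup>+x. ennreal ((u x)\<^sup>2 / (norm x)\<^sup>2) \<partial>lborel)
    \<le> ennreal (\<theta>\<^sup>2 / 4) * (\<integral>\<^sup>+x. ennreal ((norm (gradient u x))\<^sup>2) \<partial>lborel)"
proof -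
  interpret plane i j by (rule p)
  note [measurable] = borel_measurable_test_function[OF u]
  have "(\<integral>\<^sup>+x. ennreal ((u (rot i j (1 * \<theta>) x) - u x)\<^sup>2 / (\<theta> * norm x)\<^sup>2) \<partial>lborel)
    \<le> (\<integral>\<^sup>+x. ennreal ((norm (gradient u x))\<^sup>2) \<partial>lborel)"
  proof (rule flow_estimate[OF u _ rot_has_vector_derivative])
    show "continuous_on UNIV (\<lambda>(s, x). rot i j (s * \<theta>) x)"
      unfolding rot_def case_prod_unfold by (intro continuous_intros)
    show "distr lborel borel (rot i j (s * \<theta>)) = lborel" for s
      by (intro distr_lborel_orthogonal orthogonal_transformation_rot)
  qed (use \<theta> in \<open>auto simp: rot_0 intro!: mult_left_mono norm_rot_velocity\<close>)
  then have "ennreal (\<theta>\<^sup>2 / 4) * (\<integral>\<^sup>+x. ennreal ((- u x - u x)\<^sup>2 / (\<theta> * norm x)\<^sup>2) \<partial>lborel)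
    \<le> ennreal (\<theta>\<^sup>2 / 4) * (\<integral>\<^sup>+x. ennreal ((norm (gradient u x))\<^sup>2) \<partial>lborel)"
    by (intro mult_left_mono) (auto simp: anti)
  also have "ennreal (\<theta>\<^sup>2 / 4) * (\<integral>\<^sup>+x. ennreal ((- u x - u x)\<^sup>2 / (\<theta> * norm x)\<^sup>2) \<partial>lborel)
    = (\<integral>\<^sup>+x. ennreal ((u x)\<^sup>2 / (norm x)\<^sup>2) \<partial>lborel)"
    using \<theta> by (subst nn_integral_cmult[symmetric])
      (auto simp: ennreal_mult[symmetric] power2_eq_square field_simps intro!: nn_integral_cong)
  finally show ?thesis .
qed

lemma integral_dilation:
  fixes f :: "'a::euclidean_space \<Rightarrow> real"
  assumes t: "t > 0" and f: "f \<in> borel_measurable borel"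
  shows "(\<integral>x. f (t *\<^sub>R x) \<partial>lborel) = t powr (- real DIM('a)) * (\<integral>x. f x \<partial>lborel)"
proof -
  note [measurable] = f
  have d: "lborel = density (distr lborel borel (\<lambda>x::'a. t *\<^sub>R x)) (\<lambda>_. ennreal (t ^ DIM('a)))"
    using lborel_affine[of t "0::'a"] t by simp
  have "(\<integral>x. f x \<partial>lborel) = (\<integral>x. t ^ DIM('a) * f (t *\<^sub>R x) \<partial>lborel)"
    by (subst d) (use t in \<open>simp add: integral_density integral_distr\<close>)
  then show ?thesis
    using t by (simp add: powr_minus powr_realpow field_simps)
qed

section \<open>Power weights and the pointwise estimate\<close>

text \<open>
  Cut \<open>S\<close> into shells on which \<open>\<bar>x\<bar>\<close> is comparable to \<open>\<beta>\<^sup>k\<close>. The \<open>k\<close>-th shell contributes at most a constant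
  times \<open>\<beta>\<close> to the power \<open>(N - \<tau>) k\<close>, the general term of a convergent geometric series. The base is \<open>1/2\<close>
  for a ball around the origin and \<open>2\<close> for the complement of such a ball.
\<close>

lemma integrable_norm_powr_shells:
  fixes S :: "'a::euclidean_space set"
  assumes \<beta>: "0 < \<beta>" and S: "S \<in> sets borel"
    and cover: "\<And>x. x \<in> S \<Longrightarrow> x \<noteq> 0 \<Longrightarrow> \<exists>k::nat. \<exists>y. norm x = \<beta> ^ k * y \<and> y \<le> max 1 \<beta> \<and> min 1 \<beta> \<le> y"
    and conv: "\<beta> powr (real DIM('a) - \<tau>) < 1"
  shows "integrable lborel (\<lambda>x. indicator S x * norm x powr (- \<tau>))"
proof -
  note [measurable] = S
  \<comment> \<open>The shells are widened by the factor Y so that one formula covers both \<beta> < 1 and \<beta> > 1.\<close>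
  define Y where "Y = max 1 \<beta> / min 1 \<beta>"
  have Y: "Y \<ge> max 1 \<beta>" "1 / Y \<le> min 1 \<beta>" "Y \<ge> 1" using \<beta> by (auto simp: Y_def field_simps max_def min_def)
  define A where "A k = {x::'a. \<beta> ^ k / Y \<le> norm x \<and> norm x \<le> \<beta> ^ k * Y}" for k
  have [measurable]: "A k \<in> sets borel" for k
    unfolding A_def by (intro borel_closed closed_Collect_conj closed_Collect_le continuous_intros)
  have bound: "norm x powr (- \<tau>) \<le> (\<beta> ^ k) powr (- \<tau>) * Y powr \<bar>\<tau>\<bar>" if x: "x \<in> A k" for x k
  proof -
    define y where "y = norm x / \<beta> ^ k"
    have y: "1 / Y \<le> y" "y \<le> Y" using x \<beta> by (auto simp: A_def y_def field_simps)
    then have y0: "y > 0" using Y(3) by (smt (verit) divide_pos_pos)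
    have "y powr (- \<tau>) \<le> Y powr \<bar>\<tau>\<bar>"
    proof (cases "\<tau> \<ge> 0")
      case True
      have "y powr (- \<tau>) \<le> (1 / Y) powr (- \<tau>)" using True y Y(3) by (intro powr_mono2') auto
      also have "\<dots> = Y powr \<bar>\<tau>\<bar>" using True Y(3) by (simp add: powr_divide powr_minus field_simps)
      finally show ?thesis .
    next
      case False
      then show ?thesis using y y0 by (auto intro!: powr_mono2)
    qed
    moreover have "norm x powr (- \<tau>) = (\<beta> ^ k) powr (- \<tau>) * y powr (- \<tau>)"
      using \<beta> y0 by (subst powr_mult[symmetric]) (auto simp: y_def)
    ultimately show ?thesis by (simp add: mult_left_mono)
  qed
  define Q where "Q = \<beta> powr (real DIM('a) - \<tau>)"
  define K where "K = unit_ball_vol (real DIM('a)) * Y ^ DIM('a) * Y powr \<bar>\<tau>\<bar>"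
  have K: "K \<ge> 0" using Y(3) by (auto simp: K_def)
  have shell: "(\<integral>\<^sup>+x. ennreal (norm x powr (- \<tau>)) * indicator (A k) x \<partial>lborel) \<le> ennreal (K * Q ^ k)" for k
  proof -
    have "(\<integral>\<^sup>+x. ennreal (norm x powr (- \<tau>)) * indicator (A k) x \<partial>lborel)
      \<le> (\<integral>\<^sup>+x. ennreal ((\<beta> ^ k) powr (- \<tau>) * Y powr \<bar>\<tau>\<bar>) * indicator (cball 0 (\<beta> ^ k * Y)) (x::'a) \<partial>lborel)"
      using bound by (intro nn_integral_mono) (auto simp: indicator_def A_def intro!: ennreal_leI)
    also have "\<dots> = ennreal ((\<beta> ^ k) powr (- \<tau>) * Y powr \<bar>\<tau>\<bar>) *
        ennreal (unit_ball_vol (real DIM('a)) * (\<beta> ^ k * Y) ^ DIM('a))"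
      using \<beta> Y(3) by (subst nn_integral_cmult_indicator) (auto simp: emeasure_cball)
    also have "\<dots> = ennreal (K * Q ^ k)"
    proof (subst ennreal_mult[symmetric])
      have "Q ^ k = \<beta> powr ((real DIM('a) - \<tau>) * real k)" unfolding Q_def using \<beta>
        by (simp add: powr_powr[symmetric] powr_realpow)
      also have "\<dots> = \<beta> powr (real k * real DIM('a)) * \<beta> powr (real k * (- \<tau>))"
        by (simp add: powr_add[symmetric] algebra_simps)
      also have "\<dots> = (\<beta> ^ k) ^ DIM('a) * (\<beta> ^ k) powr (- \<tau>)"
      proof -
        have "(\<beta> ^ k) powr (- \<tau>) = \<beta> powr (real k * (- \<tau>))"
          by (simp add: powr_realpow[OF \<beta>, symmetric] powr_powr)
        moreover have "(\<beta> ^ k) ^ DIM('a) = \<beta> powr (real k * real DIM('a))"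
          using powr_realpow[OF \<beta>, of "k * DIM('a)"] by (simp add: power_mult)
        ultimately show ?thesis by simp
      qed
      finally show "ennreal ((\<beta> ^ k) powr - \<tau> * Y powr \<bar>\<tau>\<bar> *
         (unit_ball_vol (real DIM('a)) * (\<beta> ^ k * Y) ^ DIM('a))) = ennreal (K * Q ^ k)"
        by (simp add: K_def power_mult_distrib mult_ac)
    qed (use \<beta> Y(3) in auto)
    finally show ?thesis .
  qed
  have "(\<integral>\<^sup>+x. ennreal (indicator S x * norm x powr (- \<tau>)) \<partial>lborel)
    \<le> (\<integral>\<^sup>+x. (\<Sum>k. ennreal (norm x powr (- \<tau>)) * indicator (A k) (x::'a)) \<partial>lborel)"
  proof (intro nn_integral_mono)
    fix x :: 'a
    show "ennreal (indicator S x * norm x powr (- \<tau>)) \<le> (\<Sum>k. ennreal (norm x powr (- \<tau>)) * indicator (A k) x)"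
    proof (cases "x \<in> S \<and> x \<noteq> 0")
      case True
      then obtain k y where ky: "norm x = \<beta> ^ k * y" "y \<le> max 1 \<beta>" "min 1 \<beta> \<le> y" using cover by blast
      have "1 / Y \<le> y" "y \<le> Y" using ky Y by linarith+
      then have "x \<in> A k" using ky \<beta> Y(3) mult_left_mono[of "1 / Y" y "\<beta> ^ k"] by (auto simp: A_def)
      then have "ennreal (indicator S x * norm x powr (- \<tau>)) \<le>
          (\<Sum>k\<in>{k}. ennreal (norm x powr (- \<tau>)) * indicator (A k) x)"
        using True by simp
      also have "\<dots> \<le> (\<Sum>k. ennreal (norm x powr (- \<tau>)) * indicator (A k) x)"
        by (rule sum_le_suminf) auto
      finally show ?thesis .
    qed auto
  qed
  also have "\<dots> = (\<Sum>k. \<integral>\<^sup>+x. ennreal (norm x powr (- \<tau>)) * indicator (A k) (x::'a) \<partial>lborel)"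
    by (rule nn_integral_suminf) measurable
  also have "\<dots> \<le> (\<Sum>k. ennreal (K * Q ^ k))"
    by (intro suminf_le shell summableI)
  also have "\<dots> < \<infinity>"
  proof -
    have "summable (\<lambda>k. K * Q ^ k)" using conv by (intro summable_mult summable_geometric) (auto simp: Q_def)
    then have "(\<Sum>k. ennreal (K * Q ^ k)) = ennreal (\<Sum>k. K * Q ^ k)"
      using K by (intro suminf_ennreal2) (auto simp: Q_def)
    then show ?thesis by simp
  qed
  finally show ?thesis
    by (intro integrableI_bounded) (auto simp: abs_mult)
qed

lemma integrable_norm_powr_ball:
  assumes "\<tau> < real DIM('a::euclidean_space)"
  shows "integrable lborel (\<lambda>x::'a. indicator (cball 0 1) x * norm x powr (- \<tau>))"
proof (rule integrable_norm_powr_shells[of "1/2"])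
  fix x :: 'a assume x: "x \<in> cball 0 1" "x \<noteq> 0"
  define l where "l = - log 2 (norm x)"
  have l: "l \<ge> 0" using x by (simp add: l_def log_le_zero_cancel_iff)
  define k where "k = nat \<lfloor>l\<rfloor>"
  have k: "real k \<le> l" "l < real k + 1" using l by (auto simp: k_def)
  have nx: "norm x = 2 powr (- l)" using x by (simp add: l_def)
  have "norm x = (1/2) ^ k * 2 powr (real k - l)"
    by (simp add: nx powr_diff powr_realpow power_one_over powr_minus field_simps)
  moreover have "2 powr (real k - l) \<le> 2 powr 0" using k by (intro powr_mono) auto
  moreover have "2 powr (-1) \<le> 2 powr (real k - l)" using k by (intro powr_mono) auto
  ultimately show "\<exists>k y. norm x = (1/2) ^ k * y \<and> y \<le> max 1 (1/2) \<and> min 1 (1/2) \<le> y"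
    by (intro exI[of _ k] exI[of _ "2 powr (real k - l)"]) (auto simp: powr_minus)
next
  have "(1/2) powr (real DIM('a) - \<tau>) < (1/2) powr 0" using assms by (intro powr_less_mono') auto
  then show "(1/2) powr (real DIM('a) - \<tau>) < 1" by simp
qed auto

lemma integrable_norm_powr_outside:
  assumes "real DIM('a::euclidean_space) < \<tau>"
  shows "integrable lborel (\<lambda>x::'a. indicator (- ball 0 1) x * norm x powr (- \<tau>))"
proof (rule integrable_norm_powr_shells[of 2])
  fix x :: 'a assume x: "x \<in> - ball 0 1" "x \<noteq> 0"
  define l where "l = log 2 (norm x)"
  have l: "l \<ge> 0" using x by (simp add: l_def)
  define k where "k = nat \<lfloor>l\<rfloor>"
  have k: "real k \<le> l" "l < real k + 1" using l by (auto simp: k_def)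
  have nx: "norm x = 2 powr l" using x by (simp add: l_def)
  have "norm x = 2 ^ k * 2 powr (l - real k)"
    by (simp add: nx powr_diff powr_realpow)
  moreover have "2 powr 0 \<le> 2 powr (l - real k)" using k by (intro powr_mono) auto
  moreover have "2 powr (l - real k) \<le> 2 powr 1" using k by (intro powr_mono) auto
  ultimately show "\<exists>k y. norm x = 2 ^ k * y \<and> y \<le> max 1 2 \<and> min 1 2 \<le> y"
    by (intro exI[of _ k] exI[of _ "2 powr (l - real k)"]) auto
next
  have "2 powr (real DIM('a) - \<tau>) < 2 powr 0" using assms by (intro powr_less_mono) auto
  then show "2 powr (real DIM('a) - \<tau>) < 1" by simp
qed auto

text \<open>
  In the plane of pairs \<open>(\<eta>, r)\<close> the line \<open>r \<delta> + \<eta> = 2 \<delta> + 2\<close> passes through \<open>(b, q)\<close> and \<open>(2, 2)\<close>. The condition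
  \<open>q < 2\<^sup>*\<^sub>b\<close> says that \<open>N - 2 < 2 \<delta>\<close>, and it puts the lower boundary of the admissible region for \<open>\<eta> \<le> b\<close> and
  the upper boundary for \<open>\<eta> \<le> 2\<close> on or beyond this line. A subscaled pair thus satisfies
  \<open>b < \<eta>\<close> and lies strictly between the two critical exponents. The inequalities are stated without
  division, in the form in which they are used.
\<close>

lemma subscaled_exponents:
  assumes N: "2 \<le> N" and b: "0 \<le> b" "b < 2" and q: "2 < q" "ereal q < crit_exp N b"
    and \<delta>: "\<delta> = (2 - b) / (q - 2)" and sub: "subscaled N b q \<delta> \<eta> r"
  shows "0 < \<delta>" "q * \<delta> + b = 2 * \<delta> + 2" "b < \<eta>" "\<eta> < real N" "1 < r" "r < q"
    "q * (real N - \<eta>) < r * (real N - b)" "r * (real N - 2) < 2 * (real N - \<eta>)"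
    "r * \<delta> + \<eta> < 2 * \<delta> + 2"
proof -
  show d0: "0 < \<delta>" using b q by (simp add: \<delta>)
  have "\<delta> * (q - 2) = 2 - b" using q by (simp add: \<delta>)
  then show d1: "q * \<delta> + b = 2 * \<delta> + 2" by (simp add: algebra_simps)
  have adm: "admissible N b q \<eta> r" and l: "r * \<delta> + \<eta> < q * \<delta> + b"
    using sub by (auto simp: subscaled_def ell_def)
  show "r * \<delta> + \<eta> < 2 * \<delta> + 2" using l d1 by simp
  show r1: "1 < r" using adm by (simp add: admissible_def)
  have q': "q * (real N - 2) < 2 * (real N - b)"
    using q(2) N b by (cases "N = 2") (auto simp: crit_exp_def field_simps)
  have "b < \<eta>"
  proof (rule ccontr)
    assume nb: "\<not> b < \<eta>"
    have "\<eta> \<noteq> b"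
    proof
      assume eb: "\<eta> = b"
      have "q \<le> r" using adm q(2) N b unfolding admissible_def lower_exp_def crit_exp_def
        by (auto simp: eb split: if_splits)
      then have "q * \<delta> \<le> r * \<delta>" using d0 by simp
      then show False using l eb by simp
    qed
    with nb have eb: "\<eta> < b" by simp
    have \<eta>0: "0 \<le> \<eta>" and N3: "3 \<le> N" using adm N eb by (cases "N = 2"; auto simp: admissible_def)+
    define n where "n = real N - 2"
    have n: "n > 0" and Nn: "real N = n + 2" using N3 by (auto simp: n_def)
    have q'': "q * n < 2 * (n + 2 - b)" using q' by (simp add: n_def)
    \<comment> \<open>Both alternatives for an admissible r with \<eta> < b, the lower bound and the upper critical
      exponent, give the lower bound for r; cleared of denominators it contradicts the scaling inequality.\<close>
    have "r * (b * n) \<ge> \<eta> * q * n + 2 * (n + 2) * (b - \<eta>)"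
    proof -
      have "\<eta> * (q * n) \<le> \<eta> * (2 * (n + 2 - b))" using q'' \<eta>0 by (intro mult_left_mono) auto
      moreover have "lower_exp N b q \<eta> \<le> r \<or> r * n = 2 * (n + 2 - \<eta>)"
        using adm N3 n unfolding admissible_def crit_exp_def by (auto simp: Nn field_simps)
      ultimately show ?thesis
      proof (elim disjE)
        assume "lower_exp N b q \<eta> \<le> r"
        then show ?thesis using eb \<eta>0 n by (simp add: lower_exp_def Nn divide_le_eq algebra_simps)
      next
        assume "\<eta> * (q * n) \<le> \<eta> * (2 * (n + 2 - b))" "r * n = 2 * (n + 2 - \<eta>)"
        moreover have "r * (b * n) = b * (2 * (n + 2 - \<eta>))" using \<open>r * n = _\<close> by (metis mult.left_commute)
        ultimately show ?thesis by (simp add: algebra_simps)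
      qed
    qed
    then have "\<delta> * (\<eta> * q * n + 2 * (n + 2) * (b - \<eta>)) \<le> \<delta> * (r * (b * n))"
      using d0 by (intro mult_left_mono) auto
    moreover have "(r * \<delta> + \<eta>) * (b * n) < (q * \<delta> + b) * (b * n)"
      using l eb \<eta>0 n by (intro mult_strict_right_mono) auto
    moreover have "(b - \<eta>) * (b * n) \<le> (b - \<eta>) * (\<delta> * (2 * (n + 2) - q * n))"
    proof (intro mult_left_mono)
      have "n * (q - 2) < 2 * (2 - b)" using q'' by (simp add: algebra_simps)
      then have "n < 2 * \<delta>" using q by (simp add: \<delta> field_simps)
      then have "b * n \<le> b * (2 * \<delta>)" using b by (intro mult_left_mono) auto
      also have "\<dots> = \<delta> * (2 * b)" by simp
      also have "\<dots> \<le> \<delta> * (2 * (n + 2) - q * n)" using q'' d0 by (intro mult_left_mono) auto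
      finally show "b * n \<le> \<delta> * (2 * (n + 2) - q * n)" .
    qed (use eb in simp)
    ultimately show False by (simp add: algebra_simps)
  qed
  then show "b < \<eta>" .
  show "\<eta> < real N" using adm N by (cases "N = 2") (auto simp: admissible_def)
  have not_crit: "\<not> (\<eta> \<le> 2 \<and> 3 \<le> N \<and> ereal r = crit_exp N \<eta>)"
  proof
    assume *: "\<eta> \<le> 2 \<and> 3 \<le> N \<and> ereal r = crit_exp N \<eta>"
    define n where "n = real N - 2"
    have n: "n > 0" and Nn: "real N = n + 2" using * by (auto simp: n_def)
    have "n * (q - 2) < 2 * (2 - b)" using q' by (simp add: n_def algebra_simps)
    then have nd: "n < 2 * \<delta>" using q by (simp add: \<delta> field_simps)
    have rn: "r * n = 2 * (n + 2 - \<eta>)" using * n by (auto simp: crit_exp_def Nn field_simps)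
    have "(r * \<delta> + \<eta>) * n < (2 * \<delta> + 2) * n" using l d1 n by (intro mult_strict_right_mono) auto
    moreover have "(r * \<delta> + \<eta>) * n = \<delta> * (r * n) + \<eta> * n" by (simp add: algebra_simps)
    ultimately have "(2 - \<eta>) * (2 * \<delta> - n) < 0" unfolding rn by (simp add: algebra_simps)
    then show False using * nd by (simp add: mult_less_0_iff)
  qed
  with adm \<open>b < \<eta>\<close> have st: "lower_exp N b q \<eta> < r" "ereal r < crit_exp N \<eta>"
    by (auto simp: admissible_def)
  show "q * (real N - \<eta>) < r * (real N - b)"
    using st(1) \<open>b < \<eta>\<close> N b by (auto simp: lower_exp_def field_simps)
  show "r * (real N - 2) < 2 * (real N - \<eta>)"
    using st(2) \<open>\<eta> < real N\<close> N by (cases "N = 2") (auto simp: crit_exp_def field_simps)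
  have "r * \<delta> < q * \<delta>" using l \<open>b < \<eta>\<close> by linarith
  then show "r < q" using d0 by simp
qed

text \<open>
  If \<open>r \<ge> 2\<close>, put \<open>y = s R\<^sup>\<delta>\<close>. The terms with exponents \<open>2\<close> and \<open>q\<close> become \<open>y\<^sup>2\<close> and \<open>y\<^sup>q\<close> times the same
  power of \<open>R\<close>, the left-hand side becomes \<open>y\<^sup>r\<close> times a power that is larger by the scaling gap \<open>\<kappa>\<close>, and
  \<open>y\<^sup>r \<le> y\<^sup>2 + y\<^sup>q\<close>. If \<open>r < 2\<close>, compare with the Hardy term alone for \<open>s\<close> above a threshold \<open>R\<^sup>-\<^sup>\<sigma>\<close>; for
  smaller \<open>s\<close> the left-hand side is an integrable power of \<open>R\<close>.
\<close>

lemma near_zero_estimate: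
  fixes N :: real
  assumes b: "q * \<delta> + b = 2 * \<delta> + 2" and r: "1 < r" "r < q" "2 < q"
    and up: "r * (N - 2) < 2 * (N - \<eta>)" and sub: "r * \<delta> + \<eta> < 2 * \<delta> + 2"
  shows "\<exists>\<kappa>>0. \<exists>\<tau><N. \<forall>R s. 0 < R \<longrightarrow> R \<le> 1 \<longrightarrow> 0 \<le> s \<longrightarrow>
    s powr r / R powr \<eta> \<le> R powr \<kappa> * (s\<^sup>2 / R\<^sup>2 + s powr q / R powr b) + R powr (- \<tau>)"
proof (cases "2 \<le> r")
  case True
  define \<kappa> where "\<kappa> = 2 * \<delta> + 2 - r * \<delta> - \<eta>"
  show ?thesis
  proof (rule exI[of _ \<kappa>], rule conjI)
    show "0 < \<kappa>" using sub by (simp add: \<kappa>_def)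
    show "\<exists>\<tau><N. \<forall>R s. 0 < R \<longrightarrow> R \<le> 1 \<longrightarrow> 0 \<le> s \<longrightarrow>
      s powr r / R powr \<eta> \<le> R powr \<kappa> * (s\<^sup>2 / R\<^sup>2 + s powr q / R powr b) + R powr (- \<tau>)"
    proof (rule exI[of _ "N - 1"], rule conjI[rotated], intro allI impI)
      fix R s :: real assume R: "0 < R" "R \<le> 1" and s: "0 \<le> s"
      show "s powr r / R powr \<eta> \<le> R powr \<kappa> * (s\<^sup>2 / R\<^sup>2 + s powr q / R powr b) + R powr (- (N - 1))"
      proof (cases "s = 0")
        case False
        define y where "y = s * R powr \<delta>"
        define P where "P = R powr (- (2 * \<delta> + 2))"
        have y: "y > 0" using False s R by (simp add: y_def)
        have s_eq: "s = y * R powr (- \<delta>)" using R by (simp add: y_def powr_minus)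
        have sp: "s powr p / R powr e = y powr p * R powr (- \<delta> * p - e)" for p e
          using y R by (simp add: s_eq powr_mult powr_powr powr_diff)
        have "y powr r \<le> y powr 2 + y powr q"
        proof (cases "y \<le> 1")
          case True
          then show ?thesis using \<open>2 \<le> r\<close> y powr_mono'[of 2 r y] by (simp add: add_increasing2)
        next
          case False
          then show ?thesis using \<open>r < q\<close> powr_mono[of r q y] by (simp add: add_increasing)
        qed
        then have "(y powr r * P) * R powr \<kappa> \<le> ((y powr 2 + y powr q) * P) * R powr \<kappa>"
          by (intro mult_right_mono) (auto simp: P_def)
        moreover have "s powr r / R powr \<eta> = (y powr r * P) * R powr \<kappa>"
        proof -
          have "- \<delta> * r - \<eta> = - (2 * \<delta> + 2) + \<kappa>" by (simp add: \<kappa>_def algebra_simps)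
          then show ?thesis unfolding sp P_def by (simp only: powr_add mult.assoc)
        qed
        moreover have "s\<^sup>2 / R\<^sup>2 = y powr 2 * P"
        proof -
          have "- \<delta> * 2 - 2 = - (2 * \<delta> + 2)" by simp
          then have "s powr 2 / R powr 2 = y powr 2 * P" unfolding P_def sp by (rule arg_cong)
          then show ?thesis using s R by simp
        qed
        moreover have "s powr q / R powr b = y powr q * P"
        proof -
          have "- \<delta> * q - b = - (2 * \<delta> + 2)" using b by (simp add: algebra_simps)
          then show ?thesis unfolding sp P_def by simp
        qed
        ultimately have "s powr r / R powr \<eta> \<le> R powr \<kappa> * (s\<^sup>2 / R\<^sup>2 + s powr q / R powr b)"
          by (simp add: algebra_simps)
        then show ?thesis using powr_ge_zero[of R "- (N - 1)"] by linarith
      qed (use R in simp)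
    qed simp
  qed
next
  case False
  have "r * (\<eta> - 2) < (2 - r) * (N - \<eta>)" using up by (simp add: algebra_simps)
  then have "(\<eta> - 2) / (2 - r) < (N - \<eta>) / r" using False r by (simp add: field_simps)
  \<comment> \<open>The lower bound on \<sigma> makes \<kappa> positive, the upper bound makes R powr (-\<tau>) integrable at the origin.\<close>
  then obtain \<sigma> where \<sigma>: "(\<eta> - 2) / (2 - r) < \<sigma>" "\<sigma> < (N - \<eta>) / r" using dense by blast
  define \<kappa> where "\<kappa> = \<sigma> * (2 - r) + 2 - \<eta>"
  define \<tau> where "\<tau> = \<sigma> * r + \<eta>"
  have "\<kappa> > 0" "\<tau> < N" using \<sigma> False r by (auto simp: \<kappa>_def \<tau>_def field_simps)
  moreover have "s powr r / R powr \<eta> \<le> R powr \<kappa> * (s\<^sup>2 / R\<^sup>2 + s powr q / R powr b) + R powr (- \<tau>)"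
    if R: "0 < R" "R \<le> 1" and s: "0 \<le> s" for R s
  proof (cases "s \<le> R powr (- \<sigma>)")
    case True
    then have "s powr r \<le> (R powr (- \<sigma>)) powr r" using s r by (intro powr_mono2) auto
    then have "s powr r / R powr \<eta> \<le> (R powr (- \<sigma>)) powr r / R powr \<eta>" by (simp add: divide_right_mono)
    also have "\<dots> = R powr (- \<tau>)"
      by (simp only: powr_powr powr_diff[symmetric]) (simp add: \<tau>_def)
    finally show ?thesis by (simp add: add_increasing)
  next
    case False
    then have s0: "s > 0" using s by (smt (verit) powr_ge_zero)
    have "s powr (r - 2) \<le> (R powr (- \<sigma>)) powr (r - 2)"
      using False \<open>\<not> 2 \<le> r\<close> R by (intro powr_mono2') auto
    then have "s powr 2 * s powr (r - 2) \<le> s powr 2 * R powr (\<sigma> * (2 - r))"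
      by (simp add: powr_powr algebra_simps mult_left_mono)
    then have "s powr r / R powr \<eta> \<le> (s powr 2 * R powr (\<sigma> * (2 - r))) / R powr \<eta>"
      by (simp add: powr_add[symmetric] divide_right_mono)
    also have "\<dots> = R powr \<kappa> * (s powr 2 / R powr 2)"
      using R by (simp only: \<kappa>_def powr_diff powr_add) simp
    also have "\<dots> = R powr \<kappa> * (s\<^sup>2 / R\<^sup>2)" using s R by simp
    also have "\<dots> \<le> R powr \<kappa> * (s\<^sup>2 / R\<^sup>2 + s powr q / R powr b) + R powr (- \<tau>)"
      by (simp add: algebra_simps)
    finally show ?thesis .
  qed
  ultimately show ?thesis by blast
qed

text \<open>
  Again a threshold \<open>R\<^sup>-\<^sup>\<sigma>\<close> for \<open>s\<close>, now with the comparison term \<open>s\<^sup>q/R\<^sup>b\<close> above it. The strict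
  inequality between \<open>r\<close> and the lower exponent leaves room for \<open>\<sigma>\<close>.
\<close>

lemma near_infinity_estimate:
  fixes N :: real
  assumes r: "1 < r" "r < q" and low: "q * (N - \<eta>) < r * (N - b)"
  shows "\<exists>\<kappa>>0. \<exists>\<tau>>N. \<forall>R s. 1 \<le> R \<longrightarrow> 0 \<le> s \<longrightarrow>
    s powr r / R powr \<eta> \<le> R powr (- \<kappa>) * (s powr q / R powr b) + R powr (- \<tau>)"
proof -
  have "(N - \<eta>) * (q - r) < r * (\<eta> - b)" using low by (simp add: algebra_simps)
  then have "(N - \<eta>) / r < (\<eta> - b) / (q - r)" using r by (simp add: field_simps)
  \<comment> \<open>The lower bound on \<sigma> gives integrability at infinity, the upper bound gives a positive \<kappa>.\<close>
  then obtain \<sigma> where \<sigma>: "(N - \<eta>) / r < \<sigma>" "\<sigma> < (\<eta> - b) / (q - r)" using dense by blast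
  define \<kappa> where "\<kappa> = \<eta> - b - \<sigma> * (q - r)"
  define \<tau> where "\<tau> = \<sigma> * r + \<eta>"
  have "\<kappa> > 0" "\<tau> > N" using \<sigma> r by (auto simp: \<kappa>_def \<tau>_def field_simps)
  moreover have "s powr r / R powr \<eta> \<le> R powr (- \<kappa>) * (s powr q / R powr b) + R powr (- \<tau>)"
    if R: "1 \<le> R" and s: "0 \<le> s" for R s
  proof (cases "s \<le> R powr (- \<sigma>)")
    case True
    then have "s powr r \<le> (R powr (- \<sigma>)) powr r" using s r by (intro powr_mono2) auto
    then have "s powr r / R powr \<eta> \<le> (R powr (- \<sigma>)) powr r / R powr \<eta>" by (simp add: divide_right_mono)
    also have "\<dots> = R powr (- \<tau>)"
      by (simp only: powr_powr powr_diff[symmetric]) (simp add: \<tau>_def)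
    finally show ?thesis by (simp add: add_increasing)
  next
    case False
    then have s0: "s > 0" using s by (smt (verit) powr_ge_zero)
    have "s powr (r - q) \<le> (R powr (- \<sigma>)) powr (r - q)"
      using False r R by (intro powr_mono2') auto
    then have "s powr q * s powr (r - q) \<le> s powr q * R powr (\<sigma> * (q - r))"
      by (simp add: powr_powr algebra_simps mult_left_mono)
    then have "s powr r / R powr \<eta> \<le> (s powr q * R powr (\<sigma> * (q - r))) / R powr \<eta>"
      by (simp add: powr_add[symmetric] divide_right_mono)
    also have "\<dots> = R powr (- \<kappa>) * (s powr q / R powr b)"
      using R by (simp only: \<kappa>_def powr_diff powr_add powr_minus minus_diff_eq) (simp add: field_simps)
    also have "\<dots> \<le> R powr (- \<kappa>) * (s powr q / R powr b) + R powr (- \<tau>)" by simp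
    finally show ?thesis .
  qed
  ultimately show ?thesis by blast
qed

lemma integrable_norm_powr_cball:
  assumes "0 \<le> \<tau>" "\<tau> < real DIM('a::euclidean_space)"
  shows "integrable lborel (\<lambda>x::'a. indicator (cball 0 M) x * norm x powr (- \<tau>))"
proof (rule Bochner_Integration.integrable_bound)
  have "integrable lborel (\<lambda>x::'a. indicat_real (cball 0 M) x)"
    using emeasure_lborel_cball_finite[of "0::'a" M] by (intro integrable_real_indicator) simp_all
  then show "integrable lborel (\<lambda>x::'a. indicator (cball 0 1) x * norm x powr (- \<tau>) + indicator (cball 0 M) x)"
    by (intro Bochner_Integration.integrable_add integrable_norm_powr_ball assms)
  have "norm x powr (- \<tau>) \<le> 1" if "1 < norm x" for x :: 'a
  proof -
    have "norm x powr (- \<tau>) \<le> norm x powr 0" using that assms by (intro powr_mono) auto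
    moreover have "x \<noteq> 0" using that by auto
    ultimately show ?thesis by simp
  qed
  then show "AE x in lborel. norm (indicat_real (cball 0 M) x * norm x powr (- \<tau>))
      \<le> norm (indicator (cball 0 1) (x::'a) * norm x powr (- \<tau>) + indicat_real (cball 0 M) x)"
    by (intro AE_I2) (auto simp: indicator_def)
  have "(\<lambda>x::'a. norm x powr (- \<tau>)) \<in> borel_measurable borel" by measurable
  then show "(\<lambda>x::'a. indicat_real (cball 0 M) x * norm x powr (- \<tau>)) \<in> borel_measurable lborel"
    by (intro borel_measurable_times borel_measurable_indicator) auto
qed

lemma integral_small_ball:
  fixes f :: "'a::euclidean_space \<Rightarrow> real"
  assumes f: "integrable lborel (\<lambda>x. indicator (cball 0 1) x * f x)"
  shows "(\<lambda>n. \<integral>x. indicator (ball 0 (1 / real (Suc n))) x * f x \<partial>lborel) \<longlonglongrightarrow> 0"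
proof -
  have "(\<lambda>n. \<integral>x. indicator (ball 0 (1 / real (Suc n))) x * (indicator (cball 0 1) x * f x) \<partial>lborel)
      \<longlonglongrightarrow> (\<integral>x. 0 \<partial>(lborel :: 'a measure))"
  proof (rule integral_dominated_convergence[where w="\<lambda>x. norm (indicator (cball 0 1) x * f x)"])
    show "AE x in lborel. (\<lambda>n. indicator (ball 0 (1 / real (Suc n))) (x::'a) * (indicator (cball 0 1) x * f x)) \<longlonglongrightarrow> 0"
      using AE_lborel_singleton[of "0::'a"]
    proof eventually_elim
      case (elim x)
      have "eventually (\<lambda>n. 1 / real (Suc n) < norm x) sequentially"
        using order_tendstoD(2)[OF LIMSEQ_inverse_real_of_nat, of "norm x"] elim by (simp add: inverse_eq_divide)
      then have "eventually (\<lambda>n. indicator (ball 0 (1 / real (Suc n))) x * (indicator (cball 0 1) x * f x) = 0) sequentially"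
        by eventually_elim simp
      then show ?case by (rule tendsto_eventually)
    qed
  qed (use f in \<open>auto simp: indicator_def borel_measurable_integrable\<close>)
  moreover have "indicator (ball 0 (1 / real (Suc n))) x * (indicator (cball 0 1) x * f x) =
      indicator (ball 0 (1 / real (Suc n))) x * f x" for n and x :: 'a
  proof -
    have "1 / real (Suc n) \<le> 1" by simp
    then have "ball 0 (1 / real (Suc n)) \<subseteq> cball (0::'a) 1" by (intro order_trans[OF ball_subset_cball] subset_cball)
    then show ?thesis by (cases "x \<in> ball 0 (1 / real (Suc n))") auto
  qed
  ultimately show ?thesis by (simp only: integral_zero)
qed

lemma integral_small_outside:
  fixes f :: "'a::euclidean_space \<Rightarrow> real"
  assumes f: "integrable lborel (\<lambda>x. indicator (- ball 0 1) x * f x)"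
  shows "(\<lambda>n. \<integral>x. indicator (- cball 0 (real (Suc n))) x * f x \<partial>lborel) \<longlonglongrightarrow> 0"
proof -
  have "(\<lambda>n. \<integral>x. indicator (- cball 0 (real (Suc n))) x * (indicator (- ball 0 1) x * f x) \<partial>lborel)
      \<longlonglongrightarrow> (\<integral>x. 0 \<partial>(lborel :: 'a measure))"
  proof (rule integral_dominated_convergence[where w="\<lambda>x. norm (indicator (- ball 0 1) x * f x)"])
    show "AE x in lborel. (\<lambda>n. indicator (- cball 0 (real (Suc n))) (x::'a) * (indicator (- ball 0 1) x * f x)) \<longlonglongrightarrow> 0"
    proof (intro AE_I2)
      fix x :: 'a
      obtain m :: nat where "norm x < real m" using reals_Archimedean2 by blast
      then have "eventually (\<lambda>n. norm x \<le> real (Suc n)) sequentially"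
        by (intro eventually_sequentiallyI[of m]) auto
      then show "(\<lambda>n. indicator (- cball 0 (real (Suc n))) x * (indicator (- ball 0 1) x * f x)) \<longlonglongrightarrow> 0"
        by (intro tendsto_eventually) (auto elim!: eventually_mono simp: indicator_def)
    qed
  qed (use f in \<open>auto simp: indicator_def borel_measurable_integrable\<close>)
  moreover have "indicator (- cball 0 (real (Suc n))) x * (indicator (- ball 0 1) x * f x) =
      indicator (- cball 0 (real (Suc n))) x * f x" for n and x :: 'a
    by (auto simp: indicator_def)
  ultimately show ?thesis by (simp only: integral_zero)
qed

text \<open>
  Away from the origin and from infinity all weights are comparable to constants, and \<open>s\<^sup>r\<close> is absorbed by
  a constant for small \<open>s\<close>, by \<open>s\<^sup>q\<close> for large \<open>s\<close>, and by \<open>s\<^sup>2\<close> in between. The bound \<open>m v \<le> \<epsilon>\<close> makes the constant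
  negligible on a set of measure \<open>v\<close>.
\<close>

lemma annulus_estimate:
  fixes n \<eta> b r q \<epsilon> v :: real
  assumes n: "1 \<le> n" and e: "0 < \<epsilon>" and \<eta>: "0 \<le> \<eta>" "0 \<le> b" and r: "1 < r" "r < q" and v: "0 \<le> v"
  obtains C m where "0 \<le> C" "0 \<le> m" "m * v \<le> \<epsilon>"
    "\<And>R s. 1 / n \<le> R \<Longrightarrow> R \<le> n \<Longrightarrow> 0 \<le> s \<Longrightarrow> s powr r / R powr \<eta> \<le> \<epsilon> * (s powr q / R powr b) + C * s\<^sup>2 + m"
proof -
  define K where "K = n powr \<eta>"
  have K: "K \<ge> 1" using n \<eta> by (simp add: K_def ge_one_powr_ge_zero)
  define \<mu> where "\<mu> = \<epsilon> / (v + 1)"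
  have \<mu>: "\<mu> > 0" "\<mu> * v \<le> \<epsilon>" using e v by (auto simp: \<mu>_def field_simps)
  \<comment> \<open>Below t the left-hand side is at most \<mu>; above L the excess of q over r beats the constant
    K n powr b / \<epsilon>.\<close>
  define t where "t = (\<mu> / K) powr (1 / r)"
  have t: "t > 0" "t powr r = \<mu> / K" using \<mu> K r by (auto simp: t_def powr_powr)
  define L where "L = (\<epsilon> / (K * n powr b)) powr (1 / (r - q))"
  have L: "L > 0" "L powr (r - q) = \<epsilon> / (K * n powr b)" using e K n r by (auto simp: L_def powr_powr)
  define C where "C = L powr r * K / t\<^sup>2"
  have "s powr r / R powr \<eta> \<le> \<epsilon> * (s powr q / R powr b) + C * s\<^sup>2 + \<mu>"
    if R: "1 / n \<le> R" "R \<le> n" and s: "0 \<le> s" for R s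
  proof -
    have R0: "R > 0" using R(1) n by (smt (verit) divide_pos_pos)
    have nR: "1 / R \<le> n" using R R0 n by (simp add: field_simps)
    have pos: "0 \<le> \<epsilon> * (s powr q / R powr b)" "0 \<le> C * s\<^sup>2" using e K by (auto simp: C_def)
    have "1 / R powr \<eta> = (1 / R) powr \<eta>" using R0 by (simp add: powr_divide)
    also have "\<dots> \<le> K" unfolding K_def using nR R0 \<eta> by (intro powr_mono2) auto
    finally have RK: "s powr r / R powr \<eta> \<le> s powr r * K"
      using mult_left_mono[of "1 / R powr \<eta>" K "s powr r"] by simp
    consider "s \<le> t" | "L \<le> s" | "t < s" "s < L" by linarith
    then show ?thesis
    proof cases
      case 1
      then have "s powr r * K \<le> (\<mu> / K) * K" unfolding t(2)[symmetric] using s r K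
        by (intro mult_right_mono powr_mono2) auto
      then show ?thesis using RK pos K by simp
    next
      case 2
      have "s powr (r - q) \<le> \<epsilon> / (K * n powr b)"
        unfolding L(2)[symmetric] using 2 L r by (intro powr_mono2') auto
      then have "s powr q * s powr (r - q) * K \<le> s powr q * (\<epsilon> / (K * n powr b)) * K"
        using K by (intro mult_right_mono mult_left_mono) auto
      also have "\<dots> = \<epsilon> * (s powr q / n powr b)" using K by simp
      also have "\<dots> \<le> \<epsilon> * (s powr q / R powr b)"
        using R R0 \<eta> e n by (intro mult_left_mono divide_left_mono powr_mono2 mult_pos_pos) auto
      finally have "s powr r * K \<le> \<epsilon> * (s powr q / R powr b)" by (simp add: powr_add[symmetric])
      then show ?thesis using RK pos \<mu> by simp
    next
      case 3
      have "s powr r * K \<le> L powr r * K" using 3 s r K by (intro mult_right_mono powr_mono2) auto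
      also have "\<dots> = C * t\<^sup>2" using t by (simp add: C_def)
      also have "\<dots> \<le> C * s\<^sup>2" using 3 t K by (intro mult_left_mono power_mono) (auto simp: C_def)
      finally show ?thesis using RK pos \<mu> by simp
    qed
  qed
  then show ?thesis using \<mu> K by (intro that[of C \<mu>]) (auto simp: C_def)
qed

text \<open>
  The three regimes are glued at radii \<open>1/n\<close> and \<open>n\<close>. With \<open>n\<close> large the factors \<open>R\<^sup>\<kappa>\<close> near the origin and
  \<open>R\<^sup>-\<^sup>\<kappa>\<close> near infinity fall below \<open>\<epsilon>\<close>, and so do the integrals of the two remainders.
\<close>

lemma subscaled_absorption:
  assumes b: "0 \<le> b" "b < \<eta>" "\<eta> < real DIM('a::euclidean_space)"
    and \<delta>: "q * \<delta> + b = 2 * \<delta> + 2" and r: "1 < r" "r < q" "2 < q"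
    and up: "r * (real DIM('a) - 2) < 2 * (real DIM('a) - \<eta>)" and sub: "r * \<delta> + \<eta> < 2 * \<delta> + 2"
    and low: "q * (real DIM('a) - \<eta>) < r * (real DIM('a) - b)"
    and e: "0 < \<epsilon>"
  obtains C R and h :: "'a::euclidean_space \<Rightarrow> real" where "0 \<le> C" "0 < R" "integrable lborel h" "\<And>x. 0 \<le> h x"
    "(\<integral>x. h x \<partial>lborel) \<le> \<epsilon>"
    "\<And>x s. \<bar>s\<bar> powr r / norm x powr \<eta> \<le>
      \<epsilon> * (s\<^sup>2 / (norm x)\<^sup>2 + \<bar>s\<bar> powr q / norm x powr b) + C * (indicator (cball 0 R) x * s\<^sup>2) + h x"
proof -
  define N where "N = real DIM('a)"
  obtain \<kappa> \<tau> where k0: "\<kappa> > 0" "\<tau> < N" and near: "\<And>R s. 0 < R \<Longrightarrow> R \<le> 1 \<Longrightarrow> 0 \<le> s \<Longrightarrow>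
    s powr r / R powr \<eta> \<le> R powr \<kappa> * (s\<^sup>2 / R\<^sup>2 + s powr q / R powr b) + R powr (- \<tau>)"
    using near_zero_estimate[OF \<delta> r up sub] unfolding N_def by blast
  obtain \<kappa>' \<tau>' where k1: "\<kappa>' > 0" "\<tau>' > N" and far: "\<And>R s. 1 \<le> R \<Longrightarrow> 0 \<le> s \<Longrightarrow>
    s powr r / R powr \<eta> \<le> R powr (- \<kappa>') * (s powr q / R powr b) + R powr (- \<tau>')"
    using near_infinity_estimate[OF r(1,2) low] unfolding N_def by blast
  have i0: "integrable lborel (\<lambda>x::'a. indicator (cball 0 1) x * norm x powr (- \<tau>))"
    using k0 by (intro integrable_norm_powr_ball) (simp add: N_def)
  have i1: "integrable lborel (\<lambda>x::'a. indicator (- ball 0 1) x * norm x powr (- \<tau>'))"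
    using k1 by (intro integrable_norm_powr_outside) (simp add: N_def)
  have "eventually (\<lambda>n. (\<integral>x. indicator (ball 0 (1 / real (Suc n))) (x::'a) * norm x powr (- \<tau>) \<partial>lborel) < \<epsilon> / 3) sequentially"
    by (rule order_tendstoD(2)[OF integral_small_ball[OF i0]]) (use e in simp)
  moreover have "eventually (\<lambda>n. (\<integral>x. indicator (- cball 0 (real (Suc n))) (x::'a) * norm x powr (- \<tau>') \<partial>lborel) < \<epsilon> / 3) sequentially"
    by (rule order_tendstoD(2)[OF integral_small_outside[OF i1]]) (use e in simp)
  moreover have "eventually (\<lambda>n. real (Suc n) powr (- k) < \<epsilon>) sequentially" if "k > 0" for k
  proof -
    have "filterlim (\<lambda>n. real (Suc n)) at_top sequentially"
      by (rule filterlim_compose[OF filterlim_real_sequentially filterlim_Suc])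
    from tendsto_neg_powr[OF _ this, of "- k"] that show ?thesis by (intro order_tendstoD(2)[OF _ e]) auto
  qed
  note this[OF k0(1)] this[OF k1(1)]
  ultimately have "eventually (\<lambda>n. (\<integral>x. indicator (ball 0 (1 / real (Suc n))) (x::'a) * norm x powr (- \<tau>) \<partial>lborel) < \<epsilon> / 3 \<and>
    (\<integral>x. indicator (- cball 0 (real (Suc n))) (x::'a) * norm x powr (- \<tau>') \<partial>lborel) < \<epsilon> / 3 \<and>
    real (Suc n) powr (- \<kappa>) < \<epsilon> \<and> real (Suc n) powr (- \<kappa>') < \<epsilon>) sequentially"
    by eventually_elim simp
  then obtain n0 where n0: "(\<integral>x. indicator (ball 0 (1 / real (Suc n0))) (x::'a) * norm x powr (- \<tau>) \<partial>lborel) < \<epsilon> / 3"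
    "(\<integral>x. indicator (- cball 0 (real (Suc n0))) (x::'a) * norm x powr (- \<tau>') \<partial>lborel) < \<epsilon> / 3"
    "real (Suc n0) powr (- \<kappa>) < \<epsilon>" "real (Suc n0) powr (- \<kappa>') < \<epsilon>"
    by (auto simp: eventually_sequentially)
  define n where "n = real (Suc n0)"
  have n: "1 \<le> n" by (simp add: n_def)
  define v where "v = measure lborel (cball (0::'a) n)"
  obtain C m where C: "0 \<le> C" "0 \<le> m" "m * v \<le> \<epsilon> / 3" and
    mid: "\<And>R s. 1 / n \<le> R \<Longrightarrow> R \<le> n \<Longrightarrow> 0 \<le> s \<Longrightarrow>
      s powr r / R powr \<eta> \<le> \<epsilon> / 3 * (s powr q / R powr b) + C * s\<^sup>2 + m"
    using annulus_estimate[of n "\<epsilon> / 3" \<eta> b r q v] n e b r by (auto simp: v_def)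
  define h where "h x = indicator (ball 0 (1 / n)) x * norm x powr (- \<tau>)
    + indicator (- cball 0 n) x * norm x powr (- \<tau>') + m * indicator (cball 0 n) x" for x :: 'a
  have sub: "ball 0 (1 / n) \<subseteq> cball (0::'a) 1"
    by (intro order_trans[OF ball_subset_cball] subset_cball) (use n in simp)
  have h0: "integrable lborel (\<lambda>x::'a. indicator (ball 0 (1 / n)) x * norm x powr (- \<tau>))"
    by (rule Bochner_Integration.integrable_bound[OF i0])
      (use sub in \<open>auto simp: indicator_def subset_iff intro!: AE_I2\<close>)
  have h1: "integrable lborel (\<lambda>x::'a. indicator (- cball 0 n) x * norm x powr (- \<tau>'))"
    by (rule Bochner_Integration.integrable_bound[OF i1])
      (use n in \<open>auto simp: indicator_def intro!: AE_I2\<close>)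
  have h2: "integrable lborel (\<lambda>x::'a. m * indicator (cball 0 n) x)"
    using emeasure_lborel_cball_finite[of "0::'a" n]
    by (intro integrable_mult_right integrable_real_indicator) simp_all
  show ?thesis
  proof (rule that[of C n h])
    show "integrable lborel h" unfolding h_def[abs_def]
      by (intro Bochner_Integration.integrable_add h0 h1 h2)
    show "0 \<le> h x" for x using C by (simp add: h_def)
    have "(\<integral>x. h x \<partial>lborel) = (\<integral>x. indicator (ball 0 (1 / n)) (x::'a) * norm x powr (- \<tau>) \<partial>lborel)
      + (\<integral>x. indicator (- cball 0 n) (x::'a) * norm x powr (- \<tau>') \<partial>lborel) + m * v"
      unfolding h_def[abs_def] using h0 h1 h2
      by (simp add: v_def)
    then show "(\<integral>x. h x \<partial>lborel) \<le> \<epsilon>" using n0 C unfolding n_def by linarith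
    fix x :: 'a and s :: real
    let ?X = "s\<^sup>2 / (norm x)\<^sup>2 + \<bar>s\<bar> powr q / norm x powr b"
    have X: "0 \<le> ?X" by simp
    have C': "0 \<le> C * (indicator (cball 0 n) x * s\<^sup>2)" using C by simp
    have h': "0 \<le> m * indicator (cball 0 n) x" "0 \<le> indicator (ball 0 (1 / n)) x * norm x powr (- \<tau>)"
      "0 \<le> indicator (- cball 0 n) x * norm x powr (- \<tau>')" using C by simp_all
    consider "x = 0" | "x \<noteq> 0" "norm x < 1 / n" | "1 / n \<le> norm x" "norm x \<le> n" | "n < norm x" by linarith
    then show "\<bar>s\<bar> powr r / norm x powr \<eta> \<le> \<epsilon> * ?X + C * (indicator (cball 0 n) x * s\<^sup>2) + h x"
    proof cases
      case 1
      then show ?thesis using C' h' by (simp add: h_def)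
    next
      case 2
      have "norm x \<le> 1" using 2 n by (smt (verit) divide_le_eq_1)
      from near[OF _ this, of "\<bar>s\<bar>"] 2 have "\<bar>s\<bar> powr r / norm x powr \<eta> \<le> norm x powr \<kappa> * ?X + norm x powr (- \<tau>)"
        by simp
      also have "norm x powr \<kappa> \<le> (1 / n) powr \<kappa>" using 2 k0 by (intro powr_mono2) auto
      also have "(1 / n) powr \<kappa> \<le> \<epsilon>" using n0(3) n by (simp add: powr_divide powr_minus_divide n_def)
      finally have "\<bar>s\<bar> powr r / norm x powr \<eta> \<le> \<epsilon> * ?X + norm x powr (- \<tau>)"
        using X by (simp add: mult_right_mono)
      moreover have "norm x powr (- \<tau>) \<le> h x" using 2 C by (simp add: h_def)
      ultimately show ?thesis using C' by linarith
    next
      case 3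
      have "\<bar>s\<bar> powr r / norm x powr \<eta> \<le> \<epsilon> / 3 * (\<bar>s\<bar> powr q / norm x powr b) + C * s\<^sup>2 + m"
        using mid[OF 3, of "\<bar>s\<bar>"] by simp
      also have "\<epsilon> / 3 * (\<bar>s\<bar> powr q / norm x powr b) \<le> \<epsilon> * ?X"
        using e by (intro mult_mono) auto
      finally have "\<bar>s\<bar> powr r / norm x powr \<eta> \<le> \<epsilon> * ?X + C * s\<^sup>2 + m" by simp
      moreover have "m \<le> h x" using 3 C by (simp add: h_def)
      ultimately show ?thesis using 3 by simp
    next
      case 4
      have "1 \<le> norm x" using 4 n by simp
      from far[OF this, of "\<bar>s\<bar>"] have "\<bar>s\<bar> powr r / norm x powr \<eta>
        \<le> norm x powr (- \<kappa>') * (\<bar>s\<bar> powr q / norm x powr b) + norm x powr (- \<tau>')" by simp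
      also have "norm x powr (- \<kappa>') \<le> n powr (- \<kappa>')" using 4 n k1 by (intro powr_mono2') auto
      also have "n powr (- \<kappa>') \<le> \<epsilon>" using n0(4) by (simp add: n_def)
      finally have *: "\<bar>s\<bar> powr r / norm x powr \<eta> \<le> \<epsilon> * (\<bar>s\<bar> powr q / norm x powr b) + norm x powr (- \<tau>')"
        by (simp add: mult_right_mono divide_right_mono)
      have "\<epsilon> * (\<bar>s\<bar> powr q / norm x powr b) \<le> \<epsilon> * ?X" using e by (intro mult_left_mono) auto
      moreover have "norm x powr (- \<tau>') \<le> h x" using 4 C by (simp add: h_def)
      ultimately show ?thesis using * C' by linarith
    qed
  qed (use C n in auto)
qed

section \<open>Convexity inequalities for powers\<close>

text \<open>
  Convexity applied to \<open>a + d = (1 - t) (a / (1 - t)) + t (d / t)\<close>. As \<open>t \<rightarrow> 0\<close> the coefficient of \<open>\<bar>a\<bar>\<^sup>p\<close> tends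
  to one; the inequality then serves in place of Minkowski's.
\<close>

lemma powr_norm_add_le:
  fixes a d :: "'b::real_normed_vector"
  assumes p: "1 \<le> p" and t: "0 < t" "t < 1"
  shows "norm (a + d) powr p \<le> (1 - t) powr (1 - p) * norm a powr p + t powr (1 - p) * norm d powr p"
proof -
  have one: "1 \<le> s powr (1 - p)" if "0 < s" "s < 1" for s :: real
    using powr_mono'[of "1 - p" 0 s] that p by simp
  consider "a = 0" | "d = 0" | "a \<noteq> 0" "d \<noteq> 0" by blast
  then show ?thesis
  proof cases
    case 1
    then show ?thesis using mult_right_mono[OF one[OF t], of "norm d powr p"] by simp
  next
    case 2
    then show ?thesis using mult_right_mono[OF one[of "1 - t"], of "norm a powr p"] t by simp
  next
    case 3
    have "norm (a + d) powr p \<le> (norm a + norm d) powr p"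
      using p by (intro powr_mono2 norm_triangle_ineq) auto
    also have "\<dots> = ((1 - t) *\<^sub>R (norm a / (1 - t)) + t *\<^sub>R (norm d / t)) powr p" using t by simp
    also have "\<dots> \<le> (1 - t) * (norm a / (1 - t)) powr p + t * (norm d / t) powr p"
      using convex_onD[OF powr_convex[OF p], of t "norm a / (1 - t)" "norm d / t"] t 3 by simp
    also have "\<dots> = (1 - t) powr (1 - p) * norm a powr p + t powr (1 - p) * norm d powr p"
      using t by (simp add: powr_divide powr_diff)
    finally show ?thesis .
  qed
qed

text \<open>
  With \<open>p = q/2 \<ge> 1\<close>: the power \<open>p\<close> is superadditive on nonnegative numbers, the parallelogram identity
  evaluates the sum of squares, and convexity of the power \<open>p\<close> concludes.
\<close>

lemma powr_clarkson:
  fixes a b :: real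
  assumes q: "2 \<le> q"
  shows "\<bar>(a + b) / 2\<bar> powr q + \<bar>(a - b) / 2\<bar> powr q \<le> (\<bar>a\<bar> powr q + \<bar>b\<bar> powr q) / 2"
proof -
  define p where "p = q / 2"
  have p: "1 \<le> p" using q by (simp add: p_def)
  have sq: "\<bar>z\<bar> powr q = (z\<^sup>2) powr p" for z :: real
  proof (cases "z = 0")
    case False
    then have "(z\<^sup>2) powr p = (\<bar>z\<bar> powr 2) powr p" by simp
    also have "\<dots> = \<bar>z\<bar> powr q" by (simp only: powr_powr) (simp add: p_def)
    finally show ?thesis by simp
  qed simp
  have super: "X powr p + Y powr p \<le> (X + Y) powr p" if "0 \<le> X" "0 \<le> Y" for X Y :: real
  proof (cases "X + Y = 0")
    case False
    then have S: "X + Y > 0" using that by linarith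
    have part: "Z powr p \<le> Z / (X + Y) * (X + Y) powr p" if "0 \<le> Z" "Z \<le> X + Y" for Z
    proof -
      have "(Z / (X + Y)) powr p \<le> (Z / (X + Y)) powr 1"
        using that S p by (intro powr_mono') auto
      then have "(Z / (X + Y)) powr p * (X + Y) powr p \<le> Z / (X + Y) * (X + Y) powr p"
        using that S by (intro mult_right_mono) auto
      then show ?thesis using that S by (simp add: powr_mult[symmetric])
    qed
    have "X powr p + Y powr p \<le> X / (X + Y) * (X + Y) powr p + Y / (X + Y) * (X + Y) powr p"
      using that by (intro add_mono part) auto
    also have "\<dots> = (X + Y) powr p" using S by (simp add: distrib_right[symmetric] add_divide_distrib[symmetric])
    finally show ?thesis .
  qed (use that in \<open>simp add: add_nonneg_eq_0_iff\<close>)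
  have half: "((1::real) - 1/2) powr (1 - p) * (1/2) powr p = 1/2"
  proof -
    have "((1::real) - 1/2) powr (1 - p) * (1/2) powr p = (1/2) powr (1 - p + p)"
      by (subst powr_add) simp
    then show ?thesis by simp
  qed
  have "\<bar>(a + b) / 2\<bar> powr q + \<bar>(a - b) / 2\<bar> powr q \<le> (((a + b) / 2)\<^sup>2 + ((a - b) / 2)\<^sup>2) powr p"
    unfolding sq by (rule super) auto
  also have "((a + b) / 2)\<^sup>2 + ((a - b) / 2)\<^sup>2 = norm (a\<^sup>2 / 2 + b\<^sup>2 / 2)"
    by (simp add: power2_eq_square field_simps)
  also have "\<dots> powr p \<le> (1 - 1/2) powr (1 - p) * norm (a\<^sup>2 / 2) powr p + (1/2) powr (1 - p) * norm (b\<^sup>2 / 2) powr p"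
    by (rule powr_norm_add_le[OF p]) auto
  also have "\<dots> = ((1 - 1/2) powr (1 - p) * (1/2) powr p) * (a\<^sup>2) powr p + ((1 - 1/2) powr (1 - p) * (1/2) powr p) * (b\<^sup>2) powr p"
    by (simp add: powr_divide powr_one_eq_one)
  also have "\<dots> = (\<bar>a\<bar> powr q + \<bar>b\<bar> powr q) / 2" unfolding half sq by simp
  finally show ?thesis .
qed

text \<open>
  The power integral is continuous for the associated distance, uniformly on bounded sets. The
  modulus \<open>d\<close> is chosen before the functions, the measure and the weight.
\<close>

lemma powr_integral_continuity:
  fixes M p e :: real
  assumes p: "1 \<le> p" and e: "0 < e"
  obtains d where "0 < d" "\<And>(f :: 'a \<Rightarrow> 'b::real_normed_vector) g \<mu> \<omega>. (\<And>x. 0 \<le> \<omega> x) \<Longrightarrow>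
    integrable \<mu> (\<lambda>x. \<omega> x * norm (f x) powr p) \<Longrightarrow>
    integrable \<mu> (\<lambda>x. \<omega> x * norm (g x) powr p) \<Longrightarrow> integrable \<mu> (\<lambda>x. \<omega> x * norm (f x - g x) powr p) \<Longrightarrow>
    (\<integral>x. \<omega> x * norm (g x) powr p \<partial>\<mu>) \<le> M \<Longrightarrow> (\<integral>x. \<omega> x * norm (f x - g x) powr p \<partial>\<mu>) \<le> d \<Longrightarrow>
    (\<integral>x. \<omega> x * norm (f x) powr p \<partial>\<mu>) \<le> (\<integral>x. \<omega> x * norm (g x) powr p \<partial>\<mu>) + e"
proof -
  have "((\<lambda>t. (1 - t) powr (1 - p) * \<bar>M\<bar> - \<bar>M\<bar>) \<longlongrightarrow> (1 - 0) powr (1 - p) * \<bar>M\<bar> - \<bar>M\<bar>) (at_right 0)"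
    by (intro tendsto_intros) auto
  then have "eventually (\<lambda>t. (1 - t) powr (1 - p) * \<bar>M\<bar> - \<bar>M\<bar> < e / 2) (at_right 0)"
    using e by (intro order_tendstoD(2)) auto
  moreover have "eventually (\<lambda>t::real. 0 < t \<and> t < 1) (at_right 0)"
    unfolding eventually_at_right_field by (auto intro: exI[of _ 1])
  ultimately have "eventually (\<lambda>t. (1 - t) powr (1 - p) * \<bar>M\<bar> - \<bar>M\<bar> < e / 2 \<and> 0 < t \<and> t < 1) (at_right 0)"
    by eventually_elim simp
  then obtain t :: real where t: "(1 - t) powr (1 - p) * \<bar>M\<bar> - \<bar>M\<bar> < e / 2" "0 < t" "t < 1"
    using eventually_happens'[OF trivial_limit_at_right_real] by blast
  define A where "A = (1 - t) powr (1 - p)"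
  define B where "B = t powr (1 - p)"
  have A: "A \<ge> 1" using powr_mono'[of "1 - p" 0 "1 - t"] t p by (simp add: A_def)
  have B: "B > 0" using t by (simp add: B_def)
  show ?thesis
  proof (rule that[of "e / (2 * B)"])
    show "0 < e / (2 * B)" using e B by simp
    fix f g :: "'a \<Rightarrow> 'b" and \<mu> :: "'a measure" and \<omega> :: "'a \<Rightarrow> real"
    assume \<omega>: "\<And>x. 0 \<le> \<omega> x" and int: "integrable \<mu> (\<lambda>x. \<omega> x * norm (f x) powr p)"
      "integrable \<mu> (\<lambda>x. \<omega> x * norm (g x) powr p)" "integrable \<mu> (\<lambda>x. \<omega> x * norm (f x - g x) powr p)"
    let ?G = "\<integral>x. \<omega> x * norm (g x) powr p \<partial>\<mu>" and ?D = "\<integral>x. \<omega> x * norm (f x - g x) powr p \<partial>\<mu>"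
    assume M: "?G \<le> M" and D: "?D \<le> e / (2 * B)"
    have G0: "0 \<le> ?G" using \<omega> by (intro integral_nonneg_AE AE_I2) auto
    have "(\<integral>x. \<omega> x * norm (f x) powr p \<partial>\<mu>)
      \<le> (\<integral>x. A * (\<omega> x * norm (g x) powr p) + B * (\<omega> x * norm (f x - g x) powr p) \<partial>\<mu>)"
    proof (rule integral_mono)
      fix x
      have "norm (g x + (f x - g x)) powr p \<le> A * norm (g x) powr p + B * norm (f x - g x) powr p"
        unfolding A_def B_def by (rule powr_norm_add_le[OF p t(2,3)])
      from mult_left_mono[OF this \<omega>[of x]]
      show "\<omega> x * norm (f x) powr p \<le> A * (\<omega> x * norm (g x) powr p) + B * (\<omega> x * norm (f x - g x) powr p)"
        by (simp add: algebra_simps)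
    qed (use int in auto)
    also have "\<dots> = A * ?G + B * ?D" using int by simp
    also have "\<dots> \<le> (?G + e / 2) + e / 2"
    proof (rule add_mono)
      have "(A - 1) * ?G \<le> (A - 1) * \<bar>M\<bar>" using A M by (intro mult_left_mono) auto
      then show "A * ?G \<le> ?G + e / 2" using t(1) by (simp add: A_def[symmetric] algebra_simps)
      show "B * ?D \<le> e / 2" using D B by (simp add: field_simps)
    qed
    finally show "(\<integral>x. \<omega> x * norm (f x) powr p \<partial>\<mu>) \<le> ?G + e" by simp
  qed
qed

section \<open>Local compactness\<close>

text \<open>
  The lower corner of the grid cube around \<open>x\<close> of side \<open>1/(k+1)\<close>, scaled by \<open>k+1\<close>; it labels the cube.
\<close>

definition grid_point :: "nat \<Rightarrow> 'a::euclidean_space \<Rightarrow> 'a" where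
  "grid_point k x = (\<Sum>i\<in>Basis. of_int \<lfloor>real (Suc k) * (x \<bullet> i)\<rfloor> *\<^sub>R i)"

definition cell :: "nat \<Rightarrow> 'a::euclidean_space \<Rightarrow> 'a set" where
  "cell k z = {y. grid_point k y = z}"

lemma countable_range_grid_point: "countable (range (grid_point k :: 'a::euclidean_space \<Rightarrow> 'a))"
proof -
  have "countable ((\<lambda>g. \<Sum>i\<in>Basis. of_int (g i) *\<^sub>R i) ` ((Basis :: 'a set) \<rightarrow>\<^sub>E (UNIV :: int set)))"
    by (intro countable_image countable_PiE) auto
  moreover have "grid_point k x \<in> (\<lambda>g. \<Sum>i\<in>Basis. of_int (g i) *\<^sub>R i) ` ((Basis :: 'a set) \<rightarrow>\<^sub>E (UNIV :: int set))" for x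
    unfolding grid_point_def
    by (rule image_eqI[where x="\<lambda>i\<in>Basis. \<lfloor>real (Suc k) * (x \<bullet> i)\<rfloor>"]) auto
  ultimately show ?thesis by (meson countable_subset image_subsetI)
qed

lemma borel_measurable_grid_point[measurable]: "grid_point k \<in> borel_measurable borel"
  unfolding grid_point_def[abs_def] by measurable

lemma sets_cell[measurable]: "cell k z \<in> sets borel"
proof -
  have "cell k z = grid_point k -` {z} \<inter> space borel" by (auto simp: cell_def)
  then show ?thesis using measurable_sets[OF borel_measurable_grid_point, of "{z}"] by simp
qed

lemma cell_coordinates:
  assumes "y \<in> cell k (grid_point k x)" "i \<in> Basis"
  shows "\<lfloor>real (Suc k) * (y \<bullet> i)\<rfloor> = \<lfloor>real (Suc k) * (x \<bullet> i)\<rfloor>"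
proof -
  have "grid_point k y \<bullet> i = grid_point k x \<bullet> i" using assms by (simp add: cell_def)
  then show ?thesis using assms(2)
    by (simp add: grid_point_def inner_sum_left inner_Basis if_distrib cong: if_cong)
qed

lemma cell_diff:
  assumes "y \<in> cell k (grid_point k x)"
  shows "y - x \<in> cbox (- (1 / real (Suc k)) *\<^sub>R One) ((1 / real (Suc k)) *\<^sub>R One)"
  unfolding mem_box
proof (intro ballI)
  fix i :: 'a assume i: "i \<in> Basis"
  have "\<bar>real (Suc k) * (y \<bullet> i) - real (Suc k) * (x \<bullet> i)\<bar> \<le> 1"
    using cell_coordinates[OF assms i] by linarith
  then have "\<bar>real (Suc k) * (y \<bullet> i - x \<bullet> i)\<bar> \<le> 1" by (simp add: right_diff_distrib)
  then have "real (Suc k) * \<bar>y \<bullet> i - x \<bullet> i\<bar> \<le> 1" by (simp add: abs_mult)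
  then have "\<bar>y \<bullet> i - x \<bullet> i\<bar> \<le> 1 / real (Suc k)"
    by (simp add: pos_le_divide_eq mult.commute)
  then show "- (1 / real (Suc k)) *\<^sub>R One \<bullet> i \<le> (y - x) \<bullet> i \<and> (y - x) \<bullet> i \<le> (1 / real (Suc k)) *\<^sub>R One \<bullet> i"
    using i by (simp add: inner_diff_left abs_le_iff)
qed

lemma norm_cbox_le:
  assumes "z \<in> cbox (- h *\<^sub>R One) (h *\<^sub>R One :: 'a::euclidean_space)"
  shows "norm z \<le> real DIM('a) * h"
proof -
  have "norm z \<le> (\<Sum>i\<in>Basis. \<bar>z \<bullet> i\<bar>)" by (rule norm_le_l1)
  also have "\<dots> \<le> (\<Sum>i\<in>(Basis :: 'a set). h)"
    using assms by (intro sum_mono) (auto simp: mem_box abs_le_iff minus_le_iff)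
  finally show ?thesis by simp
qed

lemma cell_volume:
  fixes x :: "'a::euclidean_space" and k :: nat
  defines "h \<equiv> 1 / real (Suc k)"
  shows "h ^ DIM('a) \<le> measure lborel (cell k (grid_point k x))"
    and "emeasure lborel (cell k (grid_point k x)) < \<infinity>"
proof -
  define a where "a = h *\<^sub>R grid_point k x"
  have h: "h > 0" by (simp add: h_def)
  have gp: "grid_point k z \<bullet> i = of_int \<lfloor>real (Suc k) * (z \<bullet> i)\<rfloor>" if "i \<in> Basis" for z i :: 'a
    using that by (simp add: grid_point_def inner_sum_left inner_Basis if_distrib cong: if_cong)
  have sub: "box a (a + h *\<^sub>R One) \<subseteq> cell k (grid_point k x)"
  proof
    fix y assume y: "y \<in> box a (a + h *\<^sub>R One)"
    have "\<lfloor>real (Suc k) * (y \<bullet> i)\<rfloor> = \<lfloor>real (Suc k) * (x \<bullet> i)\<rfloor>" if i: "i \<in> Basis" for i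
    proof -
      have "h * of_int \<lfloor>real (Suc k) * (x \<bullet> i)\<rfloor> < y \<bullet> i" "y \<bullet> i < h * of_int \<lfloor>real (Suc k) * (x \<bullet> i)\<rfloor> + h"
        using y i gp[OF i, of x] by (auto simp: mem_box a_def inner_add_left)
      then show ?thesis
        by (intro floor_unique) (auto simp: h_def field_simps simp del: of_nat_Suc)
    qed
    then show "y \<in> cell k (grid_point k x)" by (simp add: cell_def grid_point_def)
  qed
  have sup: "cell k (grid_point k x) \<subseteq> cball x (real DIM('a) * h)"
  proof
    fix y assume "y \<in> cell k (grid_point k x)"
    from norm_cbox_le[OF cell_diff[OF this]]
    show "y \<in> cball x (real DIM('a) * h)" by (simp add: h_def dist_norm norm_minus_commute)
  qed
  have "emeasure lborel (cell k (grid_point k x)) \<le> emeasure lborel (cball x (real DIM('a) * h))"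
    by (intro emeasure_mono sup) simp
  also have "\<dots> < \<infinity>" by (rule emeasure_lborel_cball_finite)
  finally show fin: "emeasure lborel (cell k (grid_point k x)) < \<infinity>" .
  have "h ^ DIM('a) = measure lborel (box a (a + h *\<^sub>R One))"
    using h by (simp add: measure_lborel_box_eq inner_add_left)
  also have "\<dots> \<le> measure lborel (cell k (grid_point k x))"
    using fin by (intro measure_mono_fmeasurable sub fmeasurableI) auto
  finally show "h ^ DIM('a) \<le> measure lborel (cell k (grid_point k x))" .
qed

lemma integrable_test_function:
  "test_function u \<Longrightarrow> integrable lborel u" "test_function u \<Longrightarrow> integrable lborel (\<lambda>x. (u x)\<^sup>2)"
  "test_function u \<Longrightarrow> A \<in> sets borel \<Longrightarrow> integrable lborel (\<lambda>x. indicator A x * u x)"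
  "test_function u \<Longrightarrow> A \<in> sets borel \<Longrightarrow> integrable lborel (\<lambda>x. indicator A x * (u x)\<^sup>2)"
proof -
  assume u: "test_function u"
  note [measurable] = borel_measurable_test_function[OF u]
  obtain M B where MB: "B > 0" "\<And>x. M < norm x \<Longrightarrow> u x = 0" "\<And>x. \<bar>u x\<bar> \<le> B"
    using test_function_support[OF u] by metis
  show 1: "integrable lborel u" by (rule integrable_bounded_support[of _ M B]) (use MB in auto)
  have "(u x)\<^sup>2 \<le> B\<^sup>2" for x using power_mono[OF MB(3)[of x], of 2] by simp
  then show 2: "integrable lborel (\<lambda>x. (u x)\<^sup>2)" by (intro integrable_bounded_support[of _ M "B\<^sup>2"]) (use MB in auto)
  assume A[measurable]: "A \<in> sets borel"
  show "integrable lborel (\<lambda>x. indicator A x * u x)"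
    by (rule Bochner_Integration.integrable_bound[OF 1]) (auto simp: indicator_def)
  show "integrable lborel (\<lambda>x. indicator A x * (u x)\<^sup>2)"
    by (rule Bochner_Integration.integrable_bound[OF 2]) (auto simp: indicator_def)
qed

text \<open>
  Expanding the square in the mean of \<open>(w x - w y)\<^sup>2\<close> over the cube \<open>y \<in> Q\<close> containing \<open>x\<close> bounds \<open>(w x)\<^sup>2\<close> by the
  oscillation in the cube and the square of the mean of \<open>w\<close>.
\<close>

lemma square_le_cell_average:
  fixes w :: "'a::euclidean_space \<Rightarrow> real" and k :: nat
  assumes w: "test_function w"
  defines "h \<equiv> 1 / real (Suc k)"
  shows "(w x)\<^sup>2 \<le> 2 / h ^ DIM('a) * (\<integral>y. indicator (cell k (grid_point k x)) y * (w x - w y)\<^sup>2 \<partial>lborel)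
    + 4 / (h ^ DIM('a))\<^sup>2 * (\<integral>y. indicator (cell k (grid_point k x)) y * w y \<partial>lborel)\<^sup>2"
proof -
  define Q where "Q = cell k (grid_point k x)"
  have [measurable]: "Q \<in> sets borel" by (simp add: Q_def)
  define v where "v = h ^ DIM('a)"
  define V where "V = measure lborel Q"
  have v: "0 < v" "v \<le> V" using cell_volume(1)[of k x] by (simp_all add: v_def V_def Q_def h_def)
  define A where "A = (\<integral>y. indicator Q y * w y \<partial>lborel)"
  define I where "I = (\<integral>y. indicator Q y * (w x - w y)\<^sup>2 \<partial>lborel)"
  have iQ: "integrable lborel (indicat_real Q)"
    using cell_volume(2)[of k x] by (intro integrable_real_indicator) (auto simp: Q_def)
  have i1: "integrable lborel (\<lambda>y. indicator Q y * w y)" "integrable lborel (\<lambda>y. indicator Q y * (w y)\<^sup>2)"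
    by (intro integrable_test_function w; measurable)+
  have "I = (\<integral>y. (w x)\<^sup>2 * indicator Q y - (2 * w x) * (indicator Q y * w y) + indicator Q y * (w y)\<^sup>2 \<partial>lborel)"
    unfolding I_def by (intro Bochner_Integration.integral_cong) (auto simp: power2_eq_square algebra_simps)
  also have "\<dots> = (w x)\<^sup>2 * V - (2 * w x) * A + (\<integral>y. indicator Q y * (w y)\<^sup>2 \<partial>lborel)"
    using iQ i1 by (simp add: V_def A_def)
  finally have I: "(w x)\<^sup>2 * V - (2 * w x) * A \<le> I" by (simp add: integral_nonneg_AE)
  have "2 * (w x * A) \<le> v * (w x)\<^sup>2 / 2 + 2 * A\<^sup>2 / v"
  proof -
    have "0 \<le> (v * w x - 2 * A)\<^sup>2" by simp
    then have "4 * (w x * A) * v \<le> v\<^sup>2 * (w x)\<^sup>2 + 4 * A\<^sup>2" by (simp add: power2_eq_square algebra_simps)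
    then show ?thesis using v(1) by (simp add: field_simps power2_eq_square)
  qed
  moreover have "(w x)\<^sup>2 * v \<le> (w x)\<^sup>2 * V" using v by (intro mult_left_mono) auto
  ultimately have "(w x)\<^sup>2 * v / 2 \<le> I + 2 * A\<^sup>2 / v" using I by (simp add: algebra_simps)
  then have "(w x)\<^sup>2 \<le> 2 / v * I + 4 / v\<^sup>2 * A\<^sup>2"
    using v(1) by (simp add: field_simps power2_eq_square)
  then show ?thesis by (simp add: v_def I_def A_def Q_def)
qed

text \<open>
  For \<open>y\<close> in the cube of \<open>x\<close> the difference \<open>z = y - x\<close> lies in a fixed small cube. Interchanging the
  integrals reduces the claim to the translation estimate for each \<open>z\<close>.
\<close>

lemma cell_oscillation:
  fixes w :: "'a::euclidean_space \<Rightarrow> real" and k :: nat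
  assumes w: "test_function w"
    and grad: "(\<integral>\<^sup>+x. ennreal ((norm (gradient w x))\<^sup>2) \<partial>lborel) \<le> ennreal K" and K: "0 \<le> K"
  defines "h \<equiv> 1 / real (Suc k)"
  shows "(\<integral>\<^sup>+x. ennreal (\<integral>y. indicator (cell k (grid_point k x)) y * (w x - w y)\<^sup>2 \<partial>lborel) \<partial>lborel)
    \<le> ennreal ((2 * h) ^ DIM('a) * ((real DIM('a) * h)\<^sup>2 * K))"
proof -
  note [measurable] = borel_measurable_test_function[OF w]
  define C where "C = cbox (- h *\<^sub>R One) (h *\<^sub>R One :: 'a)"
  have h: "h > 0" by (simp add: h_def)
  have [measurable]: "C \<in> sets borel" by (simp add: C_def)
  have inner: "ennreal (\<integral>y. indicator (cell k (grid_point k x)) y * (w x - w y)\<^sup>2 \<partial>lborel)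
    \<le> (\<integral>\<^sup>+z. ennreal ((w (x + z) - w x)\<^sup>2) * indicator C z \<partial>lborel)" for x
  proof -
    have "ennreal (\<integral>y. indicator (cell k (grid_point k x)) y * (w x - w y)\<^sup>2 \<partial>lborel)
        \<le> (\<integral>\<^sup>+y. ennreal (indicator (cell k (grid_point k x)) y * (w x - w y)\<^sup>2) \<partial>lborel)"
    proof (cases "integrable lborel (\<lambda>y. indicator (cell k (grid_point k x)) y * (w x - w y)\<^sup>2)")
      case True
      then show ?thesis by (subst nn_integral_eq_integral) auto
    qed (simp add: not_integrable_integral_eq)
    also have "\<dots> \<le> (\<integral>\<^sup>+y. ennreal ((w y - w x)\<^sup>2) * indicator C (y - x) \<partial>lborel)"
      using cell_diff[of _ k x] by (intro nn_integral_mono) (auto simp: indicator_def C_def h_def power2_commute)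
    also have "\<dots> = (\<integral>\<^sup>+z. ennreal ((w (x + z) - w x)\<^sup>2) * indicator C (x + z - x) \<partial>lborel)"
      by (rule nn_integral_lborel_translate[symmetric]) measurable
    finally show ?thesis by simp
  qed
  have "(\<integral>\<^sup>+x. ennreal (\<integral>y. indicator (cell k (grid_point k x)) y * (w x - w y)\<^sup>2 \<partial>lborel) \<partial>lborel)
    \<le> (\<integral>\<^sup>+x. \<integral>\<^sup>+z. ennreal ((w (x + z) - w x)\<^sup>2) * indicator C z \<partial>lborel \<partial>lborel)"
    by (intro nn_integral_mono inner)
  also have "\<dots> = (\<integral>\<^sup>+z. \<integral>\<^sup>+x. ennreal ((w (x + z) - w x)\<^sup>2) * indicator C z \<partial>lborel \<partial>lborel)"
    by (rule lborel_pair.Fubini') measurable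
  also have "\<dots> \<le> (\<integral>\<^sup>+z. ennreal ((real DIM('a) * h)\<^sup>2 * K) * indicator C (z::'a) \<partial>lborel)"
  proof (rule nn_integral_mono)
    fix z :: 'a
    show "(\<integral>\<^sup>+x. ennreal ((w (x + z) - w x)\<^sup>2) * indicator C z \<partial>lborel) \<le> ennreal ((real DIM('a) * h)\<^sup>2 * K) * indicator C z"
    proof (cases "z \<in> C")
      case True
      have "(\<integral>\<^sup>+x. ennreal ((w (x + z) - w x)\<^sup>2) \<partial>lborel) \<le> ennreal ((norm z)\<^sup>2) * (\<integral>\<^sup>+x. ennreal ((norm (gradient w x))\<^sup>2) \<partial>lborel)"
        by (rule translation_estimate[OF w])
      also have "\<dots> \<le> ennreal ((real DIM('a) * h)\<^sup>2) * ennreal K"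
        using norm_cbox_le[of z h] True
        by (intro mult_mono grad ennreal_leI power_mono) (auto simp: C_def)
      finally show ?thesis using True K by (simp add: ennreal_mult)
    qed simp
  qed
  also have "\<dots> = ennreal ((real DIM('a) * h)\<^sup>2 * K) * emeasure lborel C"
    by (rule nn_integral_cmult_indicator) simp
  also have "emeasure lborel C = ennreal ((2 * h) ^ DIM('a))"
  proof -
    have "(\<Prod>i\<in>Basis. (h *\<^sub>R One - (- h *\<^sub>R One) :: 'a) \<bullet> i) = (\<Prod>i\<in>(Basis :: 'a set). 2 * h)"
      by (rule prod.cong) (auto simp: inner_diff_left inner_add_left)
    then show ?thesis using h by (simp add: C_def emeasure_lborel_cbox_eq del: scaleR_minus_left diff_minus_eq_add)
  qed
  finally show ?thesis using K h by (simp add: ennreal_mult[symmetric] mult.commute)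
qed

lemma borel_measurable_cell_integral:
  fixes g :: "'a::euclidean_space \<Rightarrow> real"
  assumes [measurable]: "g \<in> borel_measurable borel"
  shows "(\<lambda>x. \<integral>y. indicator (cell k (grid_point k x)) y * g y \<partial>lborel) \<in> borel_measurable borel"
proof -
  have "(\<lambda>x. \<integral>y. (if grid_point k y = grid_point k x then g y else 0) \<partial>lborel) \<in> borel_measurable borel"
    by (rule lborel.borel_measurable_lebesgue_integral) measurable
  moreover have "indicator (cell k (grid_point k x)) y * g y = (if grid_point k y = grid_point k x then g y else 0)" for x y
    by (simp add: cell_def indicator_def)
  ultimately show ?thesis by simp
qed

lemma integral_le_of_nn_integral_le:
  fixes f :: "'a::euclidean_space \<Rightarrow> real"
  assumes [measurable]: "f \<in> borel_measurable borel" and f: "\<And>x. 0 \<le> f x"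
    and le: "(\<integral>\<^sup>+x. ennreal (f x) \<partial>lborel) \<le> ennreal K" and K: "0 \<le> K"
  shows "integrable lborel f" "(\<integral>x. f x \<partial>lborel) \<le> K"
proof -
  have "(\<integral>\<^sup>+x. ennreal (f x) \<partial>lborel) < \<infinity>" using le by (rule le_less_trans) simp
  then show i: "integrable lborel f" using f by (intro integrableI_bounded) auto
  have "ennreal (\<integral>x. f x \<partial>lborel) = (\<integral>\<^sup>+x. ennreal (f x) \<partial>lborel)"
    by (rule nn_integral_eq_integral[symmetric, OF i]) (simp add: f)
  then show "(\<integral>x. f x \<partial>lborel) \<le> K" using le K by (metis ennreal_le_iff)
qed

text \<open>
  A bound that is uniform over the sequence, from \<open>2 \<bar>u\<bar> \<le> 1 + u\<^sup>2\<close> and the Hardy integral on a ball that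
  contains the cube.
\<close>

lemma abs_cell_integral_le:
  fixes u :: "'a::euclidean_space \<Rightarrow> real" and k :: nat
  assumes u: "test_function u" and K: "0 \<le> K"
    and hardy: "(\<integral>\<^sup>+x. ennreal ((u x)\<^sup>2 / (norm x)\<^sup>2) \<partial>lborel) \<le> ennreal K"
    and \<rho>: "norm x + real DIM('a) \<le> \<rho>"
  shows "\<bar>\<integral>y. indicator (cell k (grid_point k x)) y * u y \<partial>lborel\<bar> \<le> (measure lborel (cball (0::'a) \<rho>) + \<rho>\<^sup>2 * K) / 2"
proof -
  note [measurable] = borel_measurable_test_function[OF u]
  define Q where "Q = cell k (grid_point k x)"
  have [measurable]: "Q \<in> sets borel" by (simp add: Q_def)
  have Q: "norm y \<le> \<rho>" if "y \<in> Q" for y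
  proof -
    have "norm (y - x) \<le> real DIM('a) * (1 / real (Suc k))"
      using norm_cbox_le[OF cell_diff[of y k x]] that by (simp add: Q_def)
    also have "\<dots> \<le> real DIM('a) * 1" by (intro mult_left_mono) auto
    finally show ?thesis using \<rho> norm_triangle_ineq[of "y - x" x] by simp
  qed
  define g where "g y = (u y)\<^sup>2 / (norm y)\<^sup>2" for y
  have gm: "g \<in> borel_measurable borel" unfolding g_def[abs_def] by measurable
  have g0: "0 \<le> g y" for y by (simp add: g_def)
  have i1: "integrable lborel g" and le: "(\<integral>x. g x \<partial>lborel) \<le> K"
    using integral_le_of_nn_integral_le[OF gm g0 hardy[folded g_def] K] by blast+
  have i2: "integrable lborel (indicat_real (cball (0::'a) \<rho>))"
    using emeasure_lborel_cball_finite[of "0::'a" \<rho>] by (intro integrable_real_indicator) simp_all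
  have "\<bar>\<integral>y. indicator Q y * u y \<partial>lborel\<bar> \<le> (\<integral>y. \<bar>indicator Q y * u y\<bar> \<partial>lborel)"
    using integral_norm_bound[of lborel "\<lambda>y. indicator Q y * u y"] by simp
  also have "\<dots> \<le> (\<integral>y. (indicator (cball 0 \<rho>) y + \<rho>\<^sup>2 * g y) / 2 \<partial>lborel)"
  proof (rule integral_mono_AE)
    show "integrable lborel (\<lambda>y. \<bar>indicator Q y * u y\<bar>)" by (intro integrable_abs integrable_test_function u) measurable
    show "AE y in lborel. \<bar>indicator Q y * u y\<bar> \<le> (indicator (cball 0 \<rho>) y + \<rho>\<^sup>2 * g y) / 2"
      using AE_lborel_singleton[of "0::'a"]
    proof eventually_elim
      case (elim y)
      show ?case
      proof (cases "y \<in> Q")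
        case True
        have "(norm y)\<^sup>2 * g y \<le> \<rho>\<^sup>2 * g y"
          using Q[OF True] by (intro mult_right_mono power_mono) (auto simp: g_def)
        then have "(u y)\<^sup>2 \<le> \<rho>\<^sup>2 * g y" using elim by (simp add: g_def)
        moreover have "2 * \<bar>u y\<bar> \<le> 1 + (u y)\<^sup>2" using sum_squares_bound[of 1 "\<bar>u y\<bar>"] by simp
        ultimately show ?thesis using True Q[OF True] by simp
      qed (simp add: g_def)
    qed
    show "integrable lborel (\<lambda>y. (indicator (cball 0 \<rho>) y + \<rho>\<^sup>2 * g y) / 2)"
      by (intro integrable_divide Bochner_Integration.integrable_add i2 integrable_mult_right i1)
  qed
  also have "\<dots> = (measure lborel (cball (0::'a) \<rho>) + \<rho>\<^sup>2 * (\<integral>y. g y \<partial>lborel)) / 2"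
    using i1 i2 by simp
  also have "\<dots> \<le> (measure lborel (cball (0::'a) \<rho>) + \<rho>\<^sup>2 * K) / 2"
    using mult_left_mono[OF le, of "\<rho>\<^sup>2"] by simp
  finally show ?thesis by (simp add: Q_def)
qed

lemma gradient_lincomb:
  assumes "test_function u" "test_function v"
  shows "gradient (\<lambda>x. a * u x + c * v x) x = a *\<^sub>R gradient u x + c *\<^sub>R gradient v x"
  by (rule gradient_eqI)
    (auto intro!: derivative_eq_intros assms[THEN test_function_has_derivative] simp: algebra_simps)

lemma gradient_diff:
  assumes "test_function u" "test_function v"
  shows "gradient (\<lambda>x. u x - v x) x = gradient u x - gradient v x"
  using gradient_lincomb[OF assms, of 1 "-1"] by simp

lemma test_function_diff: "test_function u \<Longrightarrow> test_function v \<Longrightarrow> test_function (\<lambda>x. u x - v x)"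
  using test_function_add[of u "\<lambda>x. - 1 * v x"] test_function_cmult[of v "-1"] by simp

lemma nn_integral_norm_diff_le:
  fixes f g :: "'a::euclidean_space \<Rightarrow> 'b::euclidean_space"
  assumes [measurable]: "f \<in> borel_measurable borel" "g \<in> borel_measurable borel"
    and "(\<integral>\<^sup>+x. ennreal ((norm (f x))\<^sup>2) \<partial>lborel) \<le> ennreal K" "(\<integral>\<^sup>+x. ennreal ((norm (g x))\<^sup>2) \<partial>lborel) \<le> ennreal K"
    and K: "0 \<le> K"
  shows "(\<integral>\<^sup>+x. ennreal ((norm (f x - g x))\<^sup>2) \<partial>lborel) \<le> ennreal (4 * K)"
proof -
  have "(\<integral>\<^sup>+x. ennreal ((norm (f x - g x))\<^sup>2) \<partial>lborel)
    \<le> (\<integral>\<^sup>+x. 2 * ennreal ((norm (f x))\<^sup>2) + 2 * ennreal ((norm (g x))\<^sup>2) \<partial>lborel)"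
  proof (rule nn_integral_mono)
    fix x
    have "(norm (f x - g x))\<^sup>2 \<le> (norm (f x) + norm (g x))\<^sup>2"
      by (intro power_mono norm_triangle_ineq4) auto
    also have "\<dots> \<le> 2 * (norm (f x))\<^sup>2 + 2 * (norm (g x))\<^sup>2"
      using sum_squares_bound[of "norm (f x)" "norm (g x)"] by (simp add: power2_sum)
    finally have "ennreal ((norm (f x - g x))\<^sup>2) \<le> ennreal (2 * (norm (f x))\<^sup>2 + 2 * (norm (g x))\<^sup>2)"
      by (rule ennreal_leI)
    then show "ennreal ((norm (f x - g x))\<^sup>2) \<le> 2 * ennreal ((norm (f x))\<^sup>2) + 2 * ennreal ((norm (g x))\<^sup>2)"
      by (simp add: ennreal_mult)
  qed
  also have "\<dots> = 2 * (\<integral>\<^sup>+x. ennreal ((norm (f x))\<^sup>2) \<partial>lborel) + 2 * (\<integral>\<^sup>+x. ennreal ((norm (g x))\<^sup>2) \<partial>lborel)"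
    by (simp add: nn_integral_add nn_integral_cmult)
  also have "\<dots> \<le> 2 * ennreal K + 2 * ennreal K" by (intro add_mono mult_left_mono assms) auto
  also have "2 * ennreal K = ennreal (2 * K)" using K by (simp add: ennreal_mult)
  also have "ennreal (2 * K) + ennreal (2 * K) = ennreal (4 * K)" using K by (subst ennreal_plus[symmetric]) auto
  finally show ?thesis .
qed

text \<open>
  There are countably many cubes, so that a diagonal argument applies. The integrals are normalised
  by the bounds \<open>\<beta>\<close> because these depend on the position of the cube.
\<close>

lemma convergent_cell_integrals:
  fixes u :: "nat \<Rightarrow> 'a::euclidean_space \<Rightarrow> real"
  assumes u: "\<And>n. test_function (u n)" and K: "0 \<le> K"
    and hardy: "\<And>n. (\<integral>\<^sup>+x. ennreal ((u n x)\<^sup>2 / (norm x)\<^sup>2) \<partial>lborel) \<le> ennreal K"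
  shows "\<exists>f :: nat \<Rightarrow> nat. strict_mono f \<and>
    (\<forall>k x. convergent (\<lambda>n. \<integral>y. indicator (cell k (grid_point k x)) y * u (f n) y \<partial>lborel))"
proof -
  define N where "N = real DIM('a)"
  define \<beta> where "\<beta> \<rho> = (measure lborel (cball (0::'a) \<rho>) + \<rho>\<^sup>2 * K) / 2 + 1" for \<rho>
  define pt where "pt k z = (SOME x::'a. grid_point k x = z)" for k z
  define S where "S = Sigma (UNIV::nat set) (\<lambda>k. range (grid_point k :: 'a \<Rightarrow> 'a))"
  define F where "F n = (\<lambda>(k, z). (\<integral>y. indicator (cell k z) y * u n y \<partial>lborel) / \<beta> (norm (pt k z) + N))" for n
  have b0: "\<beta> \<rho> > 0" for \<rho> using K by (simp add: \<beta>_def add_nonneg_pos)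
  have "countable S" unfolding S_def by (intro countable_SIGMA countable_range_grid_point) auto
  moreover have "norm (F n s) \<le> 1" if sS: "s \<in> S" for n s
  proof -
    obtain k z where s: "s = (k, z)" and z: "z \<in> range (grid_point k)" using sS by (cases s) (auto simp: S_def)
    have "grid_point k (pt k z) = z" using z unfolding pt_def by (metis (mono_tags, lifting) rangeE someI)
    then have "\<bar>\<integral>y. indicator (cell k z) y * u n y \<partial>lborel\<bar> \<le> \<beta> (norm (pt k z) + N)"
      using abs_cell_integral_le[OF u K hardy, of "pt k z" "norm (pt k z) + N" k n]
      unfolding \<beta>_def N_def \<open>grid_point k (pt k z) = z\<close> by (intro order_trans[OF _ less_imp_le[OF less_add_one]]) simp
    then show ?thesis using b0[of "norm (pt k z) + N"] by (simp add: F_def s divide_le_eq)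
  qed
  ultimately obtain f where f: "strict_mono (f::nat \<Rightarrow> nat)" "\<And>s. s \<in> S \<Longrightarrow> \<exists>l. (\<lambda>n. F (f n) s) \<longlonglongrightarrow> l"
    using function_convergent_subsequence[of S F 1] by blast
  show ?thesis
  proof (intro exI[of _ f] conjI allI f(1))
    fix k x
    define c where "c = \<beta> (norm (pt k (grid_point k x)) + N)"
    obtain l where "(\<lambda>n. F (f n) (k, grid_point k x)) \<longlonglongrightarrow> l" using f(2)[of "(k, grid_point k x)"] by (auto simp: S_def)
    then have "(\<lambda>n. c * F (f n) (k, grid_point k x)) \<longlonglongrightarrow> c * l" by (intro tendsto_intros)
    moreover have "c * F n (k, grid_point k x) = (\<integral>y. indicator (cell k (grid_point k x)) y * u n y \<partial>lborel)" for n
      using b0[of "norm (pt k (grid_point k x)) + N"] by (simp add: F_def c_def)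
    ultimately show "convergent (\<lambda>n. \<integral>y. indicator (cell k (grid_point k x)) y * u (f n) y \<partial>lborel)"
      by (auto simp: convergent_def)
  qed
qed

text \<open>
  By \<open>square_le_cell_average\<close>, the square of a difference \<open>w\<close> of two members of the sequence is bounded
  by its oscillation within grid cubes, whose integral is \<open>O(h\<^sup>2)\<close> for mesh \<open>h\<close>, and by the squares of its
  integrals over cubes, which tend to zero along a subsequence independent of \<open>h\<close>. The Hardy
  integrals provide the local bounds that the Dirichlet integrals alone do not.
\<close>

lemma rellich:
  fixes u :: "nat \<Rightarrow> 'a::euclidean_space \<Rightarrow> real"
  assumes u: "\<And>n. test_function (u n)" and K: "0 \<le> K"
    and grad: "\<And>n. (\<integral>\<^sup>+x. ennreal ((norm (gradient (u n) x))\<^sup>2) \<partial>lborel) \<le> ennreal K"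
    and hardy: "\<And>n. (\<integral>\<^sup>+x. ennreal ((u n x)\<^sup>2 / (norm x)\<^sup>2) \<partial>lborel) \<le> ennreal K"
  shows "\<exists>f :: nat \<Rightarrow> nat. strict_mono f \<and> (\<forall>R. \<forall>e>0. \<exists>n0. \<forall>m\<ge>n0. \<forall>n\<ge>n0.
      (\<integral>x. indicator (cball 0 R) x * (u (f m) x - u (f n) x)\<^sup>2 \<partial>lborel) \<le> e)"
proof -
  obtain f where f: "strict_mono (f :: nat \<Rightarrow> nat)"
    "\<And>k x. convergent (\<lambda>n. \<integral>y. indicator (cell k (grid_point k x)) y * u (f n) y \<partial>lborel)"
    using convergent_cell_integrals[of u K, OF u K hardy] by blast
  note [measurable] = borel_measurable_test_function[OF u]
  show ?thesis
  proof (intro exI[of _ f] conjI allI impI f(1))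
    fix R e :: real assume e: "0 < e"
    have [measurable]: "cball (0::'a) R \<in> sets borel" by simp
    define N where "N = real DIM('a)"
    have "(\<lambda>k. 2 * 2 ^ DIM('a) * N\<^sup>2 * (4 * K) * (1 / real (Suc k))\<^sup>2) \<longlonglongrightarrow> 2 * 2 ^ DIM('a) * N\<^sup>2 * (4 * K) * 0\<^sup>2"
      using LIMSEQ_inverse_real_of_nat by (intro tendsto_intros) (simp add: inverse_eq_divide)
    then have "eventually (\<lambda>k. 2 * 2 ^ DIM('a) * N\<^sup>2 * (4 * K) * (1 / real (Suc k))\<^sup>2 < e / 2) sequentially"
      using e by (intro order_tendstoD(2)) auto
    \<comment> \<open>The mesh is chosen first, so that the oscillation part takes at most half of e.\<close>
    then obtain k where k: "2 * 2 ^ DIM('a) * N\<^sup>2 * (4 * K) * (1 / real (Suc k))\<^sup>2 < e / 2"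
      by (auto simp: eventually_sequentially)
    define h where "h = 1 / real (Suc k)"
    define v where "v = h ^ DIM('a)"
    have h: "h > 0" and v: "v > 0" by (simp_all add: h_def v_def)
    define G where "G n x = (\<integral>y. indicator (cell k (grid_point k x)) y * u (f n) y \<partial>lborel)" for n x
    define L where "L x = lim (\<lambda>n. G n x)" for x
    have [measurable]: "G n \<in> borel_measurable borel" for n
      unfolding G_def[abs_def] by (intro borel_measurable_cell_integral) measurable
    have lim: "(\<lambda>n. G n x) \<longlonglongrightarrow> L x" for x
      using f(2)[of k x] by (simp add: L_def G_def convergent_LIMSEQ_iff)
    have [measurable]: "L \<in> borel_measurable borel" unfolding L_def[abs_def] by measurable
    define \<rho> where "\<rho> = \<bar>R\<bar> + N"
    define \<beta> where "\<beta> = (measure lborel (cball (0::'a) \<rho>) + \<rho>\<^sup>2 * K) / 2"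
    have G: "\<bar>G n x\<bar> \<le> \<beta>" if "x \<in> cball 0 R" for n x
      unfolding G_def \<beta>_def using that by (intro abs_cell_integral_le u K hardy) (auto simp: \<rho>_def N_def)
    have L: "\<bar>L x\<bar> \<le> \<beta>" if "x \<in> cball 0 R" for x
      by (rule LIMSEQ_le_const2[OF tendsto_rabs[OF lim]]) (use G[OF that] in auto)
    have ib: "integrable lborel (\<lambda>x::'a. c * indicator (cball 0 R) x)" for c :: real
      using emeasure_lborel_cball_finite[of "0::'a" R]
      by (intro integrable_mult_right integrable_real_indicator) simp_all
    have GL: "norm (indicator (cball 0 R) x * (G n x - L x)\<^sup>2) \<le> (2 * \<beta>)\<^sup>2 * indicator (cball 0 R) x" for n x
    proof (cases "x \<in> cball 0 R")
      case True
      then have "\<bar>G n x - L x\<bar> \<le> 2 * \<beta>" using G[OF True, of n] L[OF True] by linarith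
      then have "\<bar>G n x - L x\<bar>\<^sup>2 \<le> (2 * \<beta>)\<^sup>2" by (intro power_mono) auto
      then show ?thesis using True by simp
    qed simp
    have iGL: "integrable lborel (\<lambda>x. indicator (cball 0 R) x * (G n x - L x)\<^sup>2)" for n
      by (rule Bochner_Integration.integrable_bound[OF ib[of "(2 * \<beta>)\<^sup>2"]]) (use GL[of _ n] in auto)
    have "(\<lambda>n. \<integral>x. indicator (cball 0 R) x * (G n x - L x)\<^sup>2 \<partial>lborel) \<longlonglongrightarrow> (\<integral>x. 0 \<partial>(lborel :: 'a measure))"
    proof (rule integral_dominated_convergence[where w="\<lambda>x. (2 * \<beta>)\<^sup>2 * indicator (cball 0 R) x"])
      show "AE x in lborel. (\<lambda>n. indicat_real (cball 0 R) x * (G n x - L x)\<^sup>2) \<longlonglongrightarrow> 0"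
        by (intro AE_I2 tendsto_mult_right_zero tendsto_null_power) (use lim in \<open>auto simp: LIM_zero\<close>)
      show "AE x in lborel. norm (indicat_real (cball 0 R) x * (G n x - L x)\<^sup>2) \<le> (2 * \<beta>)\<^sup>2 * indicat_real (cball 0 R) x" for n
        using GL by (intro AE_I2)
    qed (use ib in auto)
    \<comment> \<open>The threshold makes \<open>8 / v\<^sup>2\<close> times two such terms equal to e / 2.\<close>
    then have "eventually (\<lambda>n. (\<integral>x. indicator (cball 0 R) x * (G n x - L x)\<^sup>2 \<partial>lborel) < e * v\<^sup>2 / 32) sequentially"
      using e v by (intro order_tendstoD(2)) auto
    then obtain n0 where n0: "\<And>n. n \<ge> n0 \<Longrightarrow> (\<integral>x. indicator (cball 0 R) x * (G n x - L x)\<^sup>2 \<partial>lborel) < e * v\<^sup>2 / 32"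
      by (auto simp: eventually_sequentially)
    show "\<exists>n0. \<forall>m\<ge>n0. \<forall>n\<ge>n0. (\<integral>x. indicator (cball 0 R) x * (u (f m) x - u (f n) x)\<^sup>2 \<partial>lborel) \<le> e"
    proof (intro exI[of _ n0] allI impI)
      fix m n assume mn: "m \<ge> n0" "n \<ge> n0"
      define w where "w x = u (f m) x - u (f n) x" for x
      have w: "test_function w" unfolding w_def[abs_def] by (intro test_function_diff u)
      note [measurable] = borel_measurable_test_function[OF w]
      have gw: "(\<integral>\<^sup>+x. ennreal ((norm (gradient w x))\<^sup>2) \<partial>lborel) \<le> ennreal (4 * K)"
        unfolding w_def[abs_def] gradient_diff[OF u u] by (intro nn_integral_norm_diff_le grad K) measurable
      define I where "I x = (\<integral>y. indicator (cell k (grid_point k x)) y * (w x - w y)\<^sup>2 \<partial>lborel)" for x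
      have Iw: "I \<in> borel_measurable borel"
      proof -
        have "(\<lambda>x. \<integral>y. (if grid_point k y = grid_point k x then (w x - w y)\<^sup>2 else 0) \<partial>lborel) \<in> borel_measurable borel"
          by (rule lborel.borel_measurable_lebesgue_integral) measurable
        moreover have "indicator (cell k (grid_point k x)) y * (w x - w y)\<^sup>2 = (if grid_point k y = grid_point k x then (w x - w y)\<^sup>2 else 0)" for x y
          by (simp add: cell_def indicator_def)
        ultimately show ?thesis unfolding I_def[abs_def] by simp
      qed
      note [measurable] = Iw
      have I0: "0 \<le> I x" for x by (simp add: I_def integral_nonneg_AE)
      have "(\<integral>\<^sup>+x. ennreal (I x) \<partial>lborel) \<le> ennreal ((2 * h) ^ DIM('a) * ((N * h)\<^sup>2 * (4 * K)))"
        unfolding I_def h_def N_def using K by (intro cell_oscillation w gw) auto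
      moreover have "0 \<le> (2 * h) ^ DIM('a) * ((N * h)\<^sup>2 * (4 * K))" using h K by auto
      ultimately have iI: "integrable lborel I" and leI: "(\<integral>x. I x \<partial>lborel) \<le> (2 * h) ^ DIM('a) * ((N * h)\<^sup>2 * (4 * K))"
        using integral_le_of_nn_integral_le[OF Iw I0] by blast+
      have point: "indicator (cball 0 R) x * (w x)\<^sup>2 \<le> 2 / v * I x +
          8 / v\<^sup>2 * (indicator (cball 0 R) x * (G m x - L x)\<^sup>2 + indicator (cball 0 R) x * (G n x - L x)\<^sup>2)" for x
      proof (cases "x \<in> cball 0 R")
        case True
        have "(\<integral>y. indicator (cell k (grid_point k x)) y * w y \<partial>lborel) = G m x - G n x"
          unfolding G_def w_def right_diff_distrib
          by (intro Bochner_Integration.integral_diff integrable_test_function u) measurable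
        then have "(w x)\<^sup>2 \<le> 2 / v * I x + 4 / v\<^sup>2 * (G m x - G n x)\<^sup>2"
          using square_le_cell_average[OF w, of x k] by (simp add: v_def h_def I_def)
        also have "4 / v\<^sup>2 * (G m x - G n x)\<^sup>2 \<le> 4 / v\<^sup>2 * (2 * (G m x - L x)\<^sup>2 + 2 * (G n x - L x)\<^sup>2)"
          using zero_le_power2[of "(G m x - L x) + (G n x - L x)"] v
          by (intro mult_left_mono) (simp_all add: power2_eq_square algebra_simps)
        also have "\<dots> = 8 / v\<^sup>2 * ((G m x - L x)\<^sup>2 + (G n x - L x)\<^sup>2)" by (simp add: algebra_simps)
        finally show ?thesis using True by simp
      next
        case False
        then show ?thesis using I0[of x] v by simp
      qed
      have "(\<integral>x. indicator (cball 0 R) x * (w x)\<^sup>2 \<partial>lborel) \<le> (\<integral>x. 2 / v * I x +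
          8 / v\<^sup>2 * (indicator (cball 0 R) x * (G m x - L x)\<^sup>2 + indicator (cball 0 R) x * (G n x - L x)\<^sup>2) \<partial>lborel)"
        by (rule integral_mono) (use iI iGL point in \<open>auto intro: integrable_test_function[OF w]\<close>)
      also have "\<dots> = 2 / v * (\<integral>x. I x \<partial>lborel) + 8 / v\<^sup>2 * ((\<integral>x. indicator (cball 0 R) x * (G m x - L x)\<^sup>2 \<partial>lborel)
          + (\<integral>x. indicator (cball 0 R) x * (G n x - L x)\<^sup>2 \<partial>lborel))"
        using iI iGL by simp
      also have "\<dots> \<le> 2 / v * ((2 * h) ^ DIM('a) * ((N * h)\<^sup>2 * (4 * K))) + 8 / v\<^sup>2 * (e * v\<^sup>2 / 32 + e * v\<^sup>2 / 32)"
        using v n0[OF mn(1)] n0[OF mn(2)] leI by (intro add_mono mult_left_mono) auto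
      also have "\<dots> = 2 * 2 ^ DIM('a) * N\<^sup>2 * (4 * K) * h\<^sup>2 + e / 2"
        using v h by (simp add: v_def power_mult_distrib field_simps)
      also have "\<dots> \<le> e" using k by (simp add: h_def)
      finally show "(\<integral>x. indicator (cball 0 R) x * (u (f m) x - u (f n) x)\<^sup>2 \<partial>lborel) \<le> e"
        by (simp add: w_def)
    qed
  qed
qed

section \<open>Completeness of weighted Lebesgue spaces\<close>

text \<open>
  The Riesz-Fischer argument: a subsequence whose successive distances are at most \<open>4\<^sup>-\<^sup>k\<close>. The sum
  of the increments weighted with \<open>2\<^sup>k\<close> has a finite integral, so almost everywhere the increments
  decay geometrically.
\<close>

lemma AE_convergent_subsequence:
  fixes g :: "nat \<Rightarrow> 'a::euclidean_space \<Rightarrow> 'b::euclidean_space" and \<omega> :: "'a \<Rightarrow> real"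
  assumes g: "\<And>n. g n \<in> borel_measurable borel" and \<omega>: "\<omega> \<in> borel_measurable borel" "AE x in lborel. 0 < \<omega> x"
    and \<omega>0: "\<And>x. 0 \<le> \<omega> x" and p: "0 < p"
    and int: "\<And>m n. integrable lborel (\<lambda>x. \<omega> x * norm (g m x - g n x) powr p)"
    and cauchy: "\<And>e. 0 < e \<Longrightarrow> \<exists>n0. \<forall>m\<ge>n0. \<forall>n\<ge>n0. (\<integral>x. \<omega> x * norm (g m x - g n x) powr p \<partial>lborel) \<le> e"
  shows "\<exists>f :: nat \<Rightarrow> nat. strict_mono f \<and> (AE x in lborel. convergent (\<lambda>n. g (f n) x))"
proof -
  note [measurable] = g \<omega>(1)
  have "\<forall>k::nat. \<exists>n0. \<forall>m\<ge>n0. \<forall>n\<ge>n0. (\<integral>x. \<omega> x * norm (g m x - g n x) powr p \<partial>lborel) \<le> (1/4) ^ k"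
    using cauchy by simp
  then obtain n0 where n0: "\<And>k m n. n0 k \<le> m \<Longrightarrow> n0 k \<le> n \<Longrightarrow>
      (\<integral>x. \<omega> x * norm (g m x - g n x) powr p \<partial>lborel) \<le> (1/4) ^ k"
    by metis
  define f where "f = rec_nat (n0 0) (\<lambda>k fk. max (Suc fk) (n0 (Suc k)))"
  have fS: "f (Suc k) = max (Suc (f k)) (n0 (Suc k))" for k by (simp add: f_def)
  have f: "strict_mono f" by (rule strict_monoI_Suc) (simp add: fS)
  have fn: "n0 k \<le> f k" for k by (cases k) (simp_all add: f_def)
  define d where "d k x = g (f (Suc k)) x - g (f k) x" for k x
  define S where "S x = (\<Sum>k. ennreal (2 ^ k * (\<omega> x * norm (d k x) powr p)))" for x
  have [measurable]: "d k \<in> borel_measurable borel" for k unfolding d_def[abs_def] by measurable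
  have term_le: "(\<integral>\<^sup>+x. ennreal (2 ^ k * (\<omega> x * norm (d k x) powr p)) \<partial>lborel) \<le> ennreal ((1/2) ^ k)" for k
  proof -
    have "(\<integral>\<^sup>+x. ennreal (2 ^ k * (\<omega> x * norm (d k x) powr p)) \<partial>lborel)
      = ennreal (\<integral>x. 2 ^ k * (\<omega> x * norm (d k x) powr p) \<partial>lborel)"
      using int \<omega>0 by (intro nn_integral_eq_integral) (auto simp: d_def)
    also have "\<dots> \<le> ennreal (2 ^ k * (1/4) ^ k)"
      using n0[of k "f (Suc k)" "f k"] fn[of k] strict_monoD[OF f, of k "Suc k"]
      by (intro ennreal_leI) (simp add: d_def mult_left_mono)
    also have "(2::real) ^ k * (1/4) ^ k = (1/2) ^ k" by (simp add: power_mult_distrib[symmetric])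
    finally show ?thesis .
  qed
  have "(\<integral>\<^sup>+x. S x \<partial>lborel) = (\<Sum>k. \<integral>\<^sup>+x. ennreal (2 ^ k * (\<omega> x * norm (d k x) powr p)) \<partial>lborel)"
    unfolding S_def by (rule nn_integral_suminf) measurable
  also have "\<dots> \<le> (\<Sum>k. ennreal ((1/2) ^ k))" by (intro suminf_le term_le summableI)
  also have "\<dots> = ennreal (\<Sum>k. (1/2) ^ k)" by (intro suminf_ennreal2 summable_geometric) auto
  finally have "(\<integral>\<^sup>+x. S x \<partial>lborel) \<noteq> \<infinity>" by (auto simp: top_unique)
  moreover have "S \<in> borel_measurable lborel" unfolding S_def[abs_def] by measurable
  ultimately have "AE x in lborel. S x \<noteq> \<infinity>" by (rule nn_integral_noteq_infinite[rotated])
  then have "AE x in lborel. convergent (\<lambda>n. g (f n) x)"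
    using \<omega>(2)
  proof eventually_elim
    case (elim x)
    then obtain s where s: "S x = ennreal s" "0 \<le> s" by (cases "S x") auto
    define c where "c = (s / \<omega> x) powr (1 / p)"
    have bound: "norm (d k x) \<le> c * ((1/2) powr (1 / p)) ^ k" for k
    proof -
      have "ennreal (2 ^ k * (\<omega> x * norm (d k x) powr p)) \<le> S x"
        unfolding S_def using sum_le_suminf[of "\<lambda>k. ennreal (2 ^ k * (\<omega> x * norm (d k x) powr p))" "{k}"] by simp
      then have "2 ^ k * (\<omega> x * norm (d k x) powr p) \<le> s" using s by simp
      then have "norm (d k x) powr p \<le> (s / \<omega> x) * (1/2) ^ k"
        using elim(2) by (simp add: field_simps power_divide)
      then have "(norm (d k x) powr p) powr (1 / p) \<le> ((s / \<omega> x) * (1/2) ^ k) powr (1 / p)"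
        using p by (intro powr_mono2) auto
      also have "\<dots> = c * ((1/2) ^ k) powr (1 / p)"
        using s elim(2) unfolding c_def by (intro powr_mult)
      also have "((1/2::real) ^ k) powr (1 / p) = ((1/2) powr (1 / p)) ^ k"
      proof -
        have "((1/2::real) ^ k) powr (1 / p) = ((1/2) powr real k) powr (1 / p)" by (simp add: powr_realpow)
        also have "\<dots> = ((1/2) powr (1 / p)) powr real k" by (rule powr_powr_swap)
        also have "\<dots> = ((1/2) powr (1 / p)) ^ k" by (rule powr_realpow) simp
        finally show ?thesis .
      qed
      finally show ?thesis using p by (simp add: powr_powr)
    qed
    have "(1/2::real) powr (1 / p) < 1"
      using powr_less_mono'[of "1/2" 0 "1/p"] p by simp
    then have "summable (\<lambda>k. c * ((1/2) powr (1 / p)) ^ k)"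
      by (intro summable_mult summable_geometric) auto
    then have "summable (\<lambda>k. d k x)"
      by (rule summable_comparison_test[rotated]) (use bound in auto)
    then have "convergent (\<lambda>n. \<Sum>k<n. d k x)" by (simp add: summable_iff_convergent)
    then have "convergent (\<lambda>n. g (f n) x - g (f 0) x)"
      by (simp add: d_def sum_lessThan_telescope[of "\<lambda>k. g (f k) x"])
    then obtain l where "(\<lambda>n. g (f n) x - g (f 0) x) \<longlonglongrightarrow> l" by (auto simp: convergent_def)
    from tendsto_add[OF this tendsto_const[of "g (f 0) x"]]
    show ?case by (auto simp: convergent_def)
  qed
  then show ?thesis using f by blast
qed

text \<open>
  Fatou's lemma in the first argument of the distance.
\<close>

lemma integral_powr_le_of_AE_limit:
  fixes g :: "nat \<Rightarrow> 'a::euclidean_space \<Rightarrow> 'b::euclidean_space" and \<omega> :: "'a \<Rightarrow> real"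
  assumes g: "\<And>n. g n \<in> borel_measurable borel" and G: "G \<in> borel_measurable borel"
    and \<omega>: "\<omega> \<in> borel_measurable borel" "\<And>x. 0 \<le> \<omega> x" and p: "0 < p"
    and lim: "AE x in lborel. (\<lambda>m. g m x) \<longlonglongrightarrow> G x"
    and int: "\<And>m. integrable lborel (\<lambda>x. \<omega> x * norm (g m x - h x) powr p)" and h: "h \<in> borel_measurable borel"
    and e: "\<And>m. n0 \<le> m \<Longrightarrow> (\<integral>x. \<omega> x * norm (g m x - h x) powr p \<partial>lborel) \<le> e"
  shows "integrable lborel (\<lambda>x. \<omega> x * norm (G x - h x) powr p)"
    and "(\<integral>x. \<omega> x * norm (G x - h x) powr p \<partial>lborel) \<le> e"
proof -
  note [measurable] = g G \<omega>(1) h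
  have nn: "(\<integral>\<^sup>+x. ennreal (\<omega> x * norm (g m x - h x) powr p) \<partial>lborel) \<le> ennreal e" if "n0 \<le> m" for m
    using e[OF that] int[of m] \<omega>(2) by (subst nn_integral_eq_integral) (auto intro: ennreal_leI)
  have e0: "0 \<le> e" using e[of n0] \<omega>(2) integral_nonneg_AE[of "\<lambda>x. \<omega> x * norm (g n0 x - h x) powr p" lborel] by fastforce
  have "(\<integral>\<^sup>+x. ennreal (\<omega> x * norm (G x - h x) powr p) \<partial>lborel)
    = (\<integral>\<^sup>+x. liminf (\<lambda>m. ennreal (\<omega> x * norm (g m x - h x) powr p)) \<partial>lborel)"
  proof (rule nn_integral_cong_AE)
    show "AE x in lborel. ennreal (\<omega> x * norm (G x - h x) powr p) = liminf (\<lambda>m. ennreal (\<omega> x * norm (g m x - h x) powr p))"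
      using lim
    proof eventually_elim
      case (elim x)
      have "(\<lambda>m. ennreal (\<omega> x * norm (g m x - h x) powr p)) \<longlonglongrightarrow> ennreal (\<omega> x * norm (G x - h x) powr p)"
        using elim p by (intro tendsto_ennrealI tendsto_mult tendsto_const tendsto_powr' tendsto_norm tendsto_diff) auto
      then show ?case by (rule lim_imp_Liminf[symmetric, rotated]) simp
    qed
  qed
  also have "\<dots> \<le> liminf (\<lambda>m. \<integral>\<^sup>+x. ennreal (\<omega> x * norm (g m x - h x) powr p) \<partial>lborel)"
    by (rule nn_integral_liminf) measurable
  also have "\<dots> \<le> ennreal e"
    by (rule Liminf_le) (use nn in \<open>auto simp: eventually_sequentially\<close>)
  finally have fin: "(\<integral>\<^sup>+x. ennreal (\<omega> x * norm (G x - h x) powr p) \<partial>lborel) \<le> ennreal e" .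
  show i: "integrable lborel (\<lambda>x. \<omega> x * norm (G x - h x) powr p)"
    using fin \<omega>(2) by (intro integrableI_bounded) (auto simp: abs_mult top_unique less_top[symmetric])
  have "ennreal (\<integral>x. \<omega> x * norm (G x - h x) powr p \<partial>lborel) \<le> ennreal e"
    using fin by (subst nn_integral_eq_integral[symmetric, OF i]) (use \<omega>(2) in auto)
  then show "(\<integral>x. \<omega> x * norm (G x - h x) powr p \<partial>lborel) \<le> e" using e0 by simp
qed

section \<open>Minimising the action over a symmetric class\<close>

definition weighted_power :: "real \<Rightarrow> real \<Rightarrow> ('a::euclidean_space \<Rightarrow> real) \<Rightarrow> real" where
  "weighted_power \<tau> p u = (\<integral>x. \<bar>u x\<bar> powr p / norm x powr \<tau> \<partial>lborel)"

definition dirichlet :: "('a::euclidean_space \<Rightarrow> 'a) \<Rightarrow> real" where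
  "dirichlet G = (\<integral>x. (norm (G x))\<^sup>2 \<partial>lborel)"

text \<open>
  The gradient is a separate argument because the minimiser need not be differentiable in the
  classical sense; its weak gradient takes the place of \<open>gradient u\<close>.
\<close>

definition action :: "real \<Rightarrow> real \<Rightarrow> real \<Rightarrow> real \<Rightarrow> ('a::euclidean_space \<Rightarrow> real) \<Rightarrow> ('a \<Rightarrow> 'a) \<Rightarrow> real" where
  "action b q \<eta> r u G = dirichlet G / 2 + weighted_power b q u / q - weighted_power \<eta> r u / r"

lemma weighted_power_nonneg: "0 \<le> weighted_power \<tau> p u"
  by (simp add: weighted_power_def)

lemma dirichlet_nonneg: "0 \<le> dirichlet G"
  by (simp add: dirichlet_def)

lemma borel_measurable_weighted_power:
  assumes [measurable]: "u \<in> borel_measurable borel"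
  shows "(\<lambda>x::'a::euclidean_space. \<bar>u x\<bar> powr p / norm x powr \<tau>) \<in> borel_measurable borel"
  by measurable

lemma integrable_test_weighted_power:
  fixes u :: "'a::euclidean_space \<Rightarrow> real"
  assumes u: "test_function u" and \<tau>: "0 \<le> \<tau>" "\<tau> < real DIM('a)" and p: "0 < p"
  shows "integrable lborel (\<lambda>x. \<bar>u x\<bar> powr p / norm x powr \<tau>)"
proof -
  note [measurable] = borel_measurable_test_function[OF u]
  obtain M B where MB: "B > 0" "\<And>x. M < norm x \<Longrightarrow> u x = 0" "\<And>x. \<bar>u x\<bar> \<le> B"
    using test_function_support[OF u] by metis
  show ?thesis
  proof (rule Bochner_Integration.integrable_bound)
    show "integrable lborel (\<lambda>x::'a. B powr p * (indicator (cball 0 M) x * norm x powr (- \<tau>)))"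
      by (intro integrable_mult_right integrable_norm_powr_cball \<tau>)
    show "AE x in lborel. norm (\<bar>u x\<bar> powr p / norm x powr \<tau>)
        \<le> norm (B powr p * (indicator (cball 0 M) x * norm x powr (- \<tau>)))"
    proof (intro AE_I2)
      fix x
      show "norm (\<bar>u x\<bar> powr p / norm x powr \<tau>) \<le> norm (B powr p * (indicator (cball 0 M) x * norm x powr (- \<tau>)))"
      proof (cases "norm x \<le> M")
        case True
        have "\<bar>u x\<bar> powr p \<le> B powr p" using MB p by (intro powr_mono2) auto
        then have "\<bar>u x\<bar> powr p / norm x powr \<tau> \<le> B powr p / norm x powr \<tau>" by (rule divide_right_mono) simp
        then show ?thesis using True by (simp add: powr_minus_divide)
      qed (simp add: MB)
    qed
  qed (use borel_measurable_weighted_power in simp)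
qed

lemma integrable_test_dirichlet:
  fixes u :: "'a::euclidean_space \<Rightarrow> real"
  assumes u: "test_function u"
  shows "integrable lborel (\<lambda>x. (norm (gradient u x))\<^sup>2)"
    and "(\<integral>\<^sup>+x. ennreal ((norm (gradient u x))\<^sup>2) \<partial>lborel) = ennreal (dirichlet (gradient u))"
proof -
  note [measurable] = borel_measurable_test_function[OF u]
  obtain M B where MB: "B > 0" "\<And>x. M < norm x \<Longrightarrow> gradient u x = 0" "\<And>x. norm (gradient u x) \<le> B"
    using test_function_support[OF u] by metis
  show i: "integrable lborel (\<lambda>x. (norm (gradient u x))\<^sup>2)"
    by (rule integrable_bounded_support[of _ M "B\<^sup>2"]) (use MB in \<open>auto intro!: power_mono\<close>)
  show "(\<integral>\<^sup>+x. ennreal ((norm (gradient u x))\<^sup>2) \<partial>lborel) = ennreal (dirichlet (gradient u))"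
    unfolding dirichlet_def by (rule nn_integral_eq_integral[OF i]) simp
qed

lemma weighted_power_continuity:
  fixes M p e \<tau> :: real
  assumes p: "1 \<le> p" and e: "0 < e"
  shows "\<exists>d>0. \<forall>f g :: 'a::euclidean_space \<Rightarrow> real.
    integrable lborel (\<lambda>x. \<bar>f x\<bar> powr p / norm x powr \<tau>) \<longrightarrow>
    integrable lborel (\<lambda>x. \<bar>g x\<bar> powr p / norm x powr \<tau>) \<longrightarrow>
    integrable lborel (\<lambda>x. \<bar>f x - g x\<bar> powr p / norm x powr \<tau>) \<longrightarrow>
    weighted_power \<tau> p g \<le> M \<longrightarrow> weighted_power \<tau> p (\<lambda>x. f x - g x) \<le> d \<longrightarrow>
    weighted_power \<tau> p f \<le> weighted_power \<tau> p g + e"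
proof -
  obtain d where d: "0 < d" and le: "\<And>(f :: 'a \<Rightarrow> real) g \<mu> \<omega>. (\<And>x. 0 \<le> \<omega> x) \<Longrightarrow>
    integrable \<mu> (\<lambda>x. \<omega> x * norm (f x) powr p) \<Longrightarrow>
    integrable \<mu> (\<lambda>x. \<omega> x * norm (g x) powr p) \<Longrightarrow> integrable \<mu> (\<lambda>x. \<omega> x * norm (f x - g x) powr p) \<Longrightarrow>
    (\<integral>x. \<omega> x * norm (g x) powr p \<partial>\<mu>) \<le> M \<Longrightarrow> (\<integral>x. \<omega> x * norm (f x - g x) powr p \<partial>\<mu>) \<le> d \<Longrightarrow>
    (\<integral>x. \<omega> x * norm (f x) powr p \<partial>\<mu>) \<le> (\<integral>x. \<omega> x * norm (g x) powr p \<partial>\<mu>) + e"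
    using powr_integral_continuity[OF p e, where 'a='a and 'b=real and M=M] by blast
  show ?thesis
    by (intro exI[of _ d] conjI d allI impI, rule le[where \<omega>="\<lambda>x. 1 / norm x powr \<tau>" and \<mu>=lborel, simplified, folded weighted_power_def])
qed

lemma integral_hardy_le:
  fixes u :: "'a::euclidean_space \<Rightarrow> real"
  assumes u: "test_function u" and H: "0 \<le> H"
    and hardy: "(\<integral>\<^sup>+x. ennreal ((u x)\<^sup>2 / (norm x)\<^sup>2) \<partial>lborel) \<le> ennreal H"
  shows "integrable lborel (\<lambda>x. (u x)\<^sup>2 / (norm x)\<^sup>2)" "(\<integral>x. (u x)\<^sup>2 / (norm x)\<^sup>2 \<partial>lborel) \<le> H"
proof -
  note [measurable] = borel_measurable_test_function[OF u]
  have "(\<lambda>x. (u x)\<^sup>2 / (norm x)\<^sup>2) \<in> borel_measurable borel" by measurable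
  from integral_le_of_nn_integral_le[OF this _ hardy H]
  show "integrable lborel (\<lambda>x. (u x)\<^sup>2 / (norm x)\<^sup>2)" "(\<integral>x. (u x)\<^sup>2 / (norm x)\<^sup>2 \<partial>lborel) \<le> H"
    by simp_all
qed

text \<open>
  Since \<open>C\<close> and \<open>R\<close> are chosen before the function and the bound \<open>H\<close> for its Hardy integral, they can be fixed
  before the angle of the rotation is made small.
\<close>

lemma weighted_power_absorption:
  assumes b: "0 \<le> b" "b < \<eta>" "\<eta> < real DIM('a::euclidean_space)"
    and \<delta>: "q * \<delta> + b = 2 * \<delta> + 2" and r: "1 < r" "r < q" "2 < q"
    and up: "r * (real DIM('a) - 2) < 2 * (real DIM('a) - \<eta>)" and sub: "r * \<delta> + \<eta> < 2 * \<delta> + 2"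
    and low: "q * (real DIM('a) - \<eta>) < r * (real DIM('a) - b)"
    and \<epsilon>: "0 < \<epsilon>"
  shows "\<exists>C\<ge>0. \<exists>R. \<forall>(u :: 'a \<Rightarrow> real) H. test_function u \<longrightarrow> 0 \<le> H \<longrightarrow>
    (\<integral>\<^sup>+x. ennreal ((u x)\<^sup>2 / (norm x)\<^sup>2) \<partial>lborel) \<le> ennreal H \<longrightarrow>
    weighted_power \<eta> r u \<le> \<epsilon> * (H + weighted_power b q u) + C * (\<integral>x. indicator (cball 0 R) x * (u x)\<^sup>2 \<partial>lborel) + \<epsilon>"
proof -
  obtain C R and h :: "'a \<Rightarrow> real" where C: "0 \<le> C" "0 < R" and h: "integrable lborel h" "\<And>x. 0 \<le> h x"
    "(\<integral>x. h x \<partial>lborel) \<le> \<epsilon>" and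
    le: "\<And>x s. \<bar>s\<bar> powr r / norm x powr \<eta> \<le>
      \<epsilon> * (s\<^sup>2 / (norm x)\<^sup>2 + \<bar>s\<bar> powr q / norm x powr b) + C * (indicator (cball 0 R) x * s\<^sup>2) + h x"
    using subscaled_absorption[OF b \<delta> r up sub low \<epsilon>] by blast
  have "weighted_power \<eta> r u \<le> \<epsilon> * (K + weighted_power b q u) + C * (\<integral>x. indicator (cball 0 R) x * (u x)\<^sup>2 \<partial>lborel) + \<epsilon>"
    if t: "test_function u" and K: "0 \<le> K" "(\<integral>\<^sup>+x. ennreal ((u x)\<^sup>2 / (norm x)\<^sup>2) \<partial>lborel) \<le> ennreal K" for u :: "'a \<Rightarrow> real" and K
  proof -
    define H where "H x = (u x)\<^sup>2 / (norm x)\<^sup>2" for x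
    define P where "P x = \<bar>u x\<bar> powr q / norm x powr b" for x
    have iH: "integrable lborel H" "(\<integral>x. H x \<partial>lborel) \<le> K"
      using integral_hardy_le[OF t K] by (simp_all add: H_def[abs_def])
    have iP: "integrable lborel P" "(\<integral>x. P x \<partial>lborel) = weighted_power b q u"
      using integrable_test_weighted_power[OF t, of b q] b r by (simp_all add: P_def[abs_def] weighted_power_def)
    have iI: "integrable lborel (\<lambda>x. indicator (cball 0 R) x * (u x)\<^sup>2)"
      by (rule integrable_test_function(4)[OF t]) simp
    have "weighted_power \<eta> r u \<le> (\<integral>x. \<epsilon> * (H x + P x) + C * (indicator (cball 0 R) x * (u x)\<^sup>2) + h x \<partial>lborel)"
      unfolding weighted_power_def
    proof (rule integral_mono)
      show "integrable lborel (\<lambda>x. \<bar>u x\<bar> powr r / norm x powr \<eta>)"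
        using b r by (intro integrable_test_weighted_power t) auto
      show "integrable lborel (\<lambda>x. \<epsilon> * (H x + P x) + C * (indicator (cball 0 R) x * (u x)\<^sup>2) + h x)"
        by (intro Bochner_Integration.integrable_add integrable_mult_right iH iP iI h)
      show "\<bar>u x\<bar> powr r / norm x powr \<eta> \<le> \<epsilon> * (H x + P x) + C * (indicator (cball 0 R) x * (u x)\<^sup>2) + h x" for x
        using le[of "u x" x] by (simp add: H_def P_def)
    qed
    also have "\<dots> = \<epsilon> * ((\<integral>x. H x \<partial>lborel) + weighted_power b q u) + C * (\<integral>x. indicator (cball 0 R) x * (u x)\<^sup>2 \<partial>lborel) + (\<integral>x. h x \<partial>lborel)"
      using iH iP iI h by simp
    also have "\<dots> \<le> \<epsilon> * (K + weighted_power b q u) + C * (\<integral>x. indicator (cball 0 R) x * (u x)\<^sup>2 \<partial>lborel) + \<epsilon>"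
      using iH h \<epsilon> C(1) by (intro add_mono mult_left_mono) auto
    finally show ?thesis .
  qed
  then show ?thesis using C by blast
qed

text \<open>
  The part of the argument that uses the symmetry only through a Hardy inequality. The coefficients
  \<open>1/4\<close> and \<open>1/(2q)\<close> leave half of each positive term of the action, which bounds minimising sequences.
\<close>

locale minimization =
  fixes b q \<eta> r \<delta> c :: real and D :: "('a::euclidean_space \<Rightarrow> real) set"
  assumes b: "0 \<le> b" "b < \<eta>" "\<eta> < real DIM('a)"
    and \<delta>: "q * \<delta> + b = 2 * \<delta> + 2" and r: "1 < r" "r < q" "2 < q"
    and up: "r * (real DIM('a) - 2) < 2 * (real DIM('a) - \<eta>)" and sub: "r * \<delta> + \<eta> < 2 * \<delta> + 2"
    and low: "q * (real DIM('a) - \<eta>) < r * (real DIM('a) - b)"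
    and D_test: "\<And>u. u \<in> D \<Longrightarrow> test_function u"
    and D_lin: "\<And>u v s t. u \<in> D \<Longrightarrow> v \<in> D \<Longrightarrow> (\<lambda>x. s * u x + t * v x) \<in> D"
    and D_ne: "D \<noteq> {}" and c: "0 \<le> c"
    and hardy: "\<And>u. u \<in> D \<Longrightarrow> (\<integral>\<^sup>+x. ennreal ((u x)\<^sup>2 / (norm x)\<^sup>2) \<partial>lborel)
      \<le> ennreal c * (\<integral>\<^sup>+x. ennreal ((norm (gradient u x))\<^sup>2) \<partial>lborel)"
    and coercive: "\<And>u. u \<in> D \<Longrightarrow> weighted_power \<eta> r u / r
      \<le> dirichlet (gradient u) / 4 + weighted_power b q u / (2 * q) + 1"
begin

abbreviation "B \<equiv> weighted_power \<eta> r"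
abbreviation "Q \<equiv> weighted_power b q"
abbreviation "E u \<equiv> dirichlet (gradient u)"
abbreviation "J u \<equiv> action b q \<eta> r u (gradient u)"

lemma integrable_B: "test_function (u :: 'a \<Rightarrow> real) \<Longrightarrow> integrable lborel (\<lambda>x. \<bar>u x\<bar> powr r / norm x powr \<eta>)"
  using b r by (intro integrable_test_weighted_power) auto

lemma integrable_Q: "test_function (u :: 'a \<Rightarrow> real) \<Longrightarrow> integrable lborel (\<lambda>x. \<bar>u x\<bar> powr q / norm x powr b)"
  using b r by (intro integrable_test_weighted_power) auto

lemma D_diff: "u \<in> D \<Longrightarrow> v \<in> D \<Longrightarrow> (\<lambda>x. u x - v x) \<in> D"
  using D_lin[of u v 1 "-1"] by simp

lemma hardy_integral:
  assumes u: "u \<in> D"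
  shows "(\<integral>\<^sup>+x. ennreal ((u x)\<^sup>2 / (norm x)\<^sup>2) \<partial>lborel) \<le> ennreal (c * E u)"
  using hardy[OF u] integrable_test_dirichlet(2)[OF D_test[OF u]] c
  by (simp add: ennreal_mult dirichlet_nonneg)

lemma B_absorption:
  assumes \<epsilon>: "0 < \<epsilon>"
  shows "\<exists>C\<ge>0. \<exists>R. \<forall>u\<in>D. B u \<le> \<epsilon> * (c * E u + Q u) + C * (\<integral>x. indicator (cball 0 R) x * (u x)\<^sup>2 \<partial>lborel) + \<epsilon>"
proof -
  obtain C R where C: "0 \<le> C" and le: "\<And>(u :: 'a \<Rightarrow> real) H. test_function u \<Longrightarrow> 0 \<le> H \<Longrightarrow>
    (\<integral>\<^sup>+x. ennreal ((u x)\<^sup>2 / (norm x)\<^sup>2) \<partial>lborel) \<le> ennreal H \<Longrightarrow>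
    B u \<le> \<epsilon> * (H + Q u) + C * (\<integral>x. indicator (cball 0 R) x * (u x)\<^sup>2 \<partial>lborel) + \<epsilon>"
    using weighted_power_absorption[OF b \<delta> r up sub low \<epsilon>] by blast
  have "B u \<le> \<epsilon> * (c * E u + Q u) + C * (\<integral>x. indicator (cball 0 R) x * (u x)\<^sup>2 \<partial>lborel) + \<epsilon>" if u: "u \<in> D" for u
    using c by (intro le[OF D_test[OF u] _ hardy_integral[OF u]]) (simp add: dirichlet_nonneg)
  then show ?thesis using C by blast
qed

lemma J_lower: "u \<in> D \<Longrightarrow> E u / 4 + Q u / (2 * q) - 1 \<le> J u"
proof -
  assume "u \<in> D"
  moreover have "Q u / q = Q u / (2 * q) + Q u / (2 * q)" by simp
  ultimately show ?thesis using coercive[of u] unfolding action_def by linarith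
qed

lemma J_ge: "u \<in> D \<Longrightarrow> - 1 \<le> J u"
proof -
  assume "u \<in> D"
  moreover have "0 \<le> E u / 4" "0 \<le> Q u / (2 * q)"
    using r by (simp_all add: dirichlet_nonneg weighted_power_nonneg)
  ultimately show ?thesis using J_lower[of u] by linarith
qed

lemma bdd_below_J: "bdd_below (J ` D)"
  using J_ge by (intro bdd_belowI2[of _ "-1"])

definition "level = Inf (J ` D)"

lemma level_le: "u \<in> D \<Longrightarrow> level \<le> J u"
  unfolding level_def by (rule cInf_lower[OF _ bdd_below_J]) simp

lemma E_midpoint:
  fixes u v :: "'a \<Rightarrow> real"
  assumes u: "test_function u" and v: "test_function v"
  shows "dirichlet (gradient (\<lambda>x. (u x + v x) / 2)) + dirichlet (gradient (\<lambda>x. (u x - v x) / 2))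
    = (dirichlet (gradient u) + dirichlet (gradient v)) / 2"
proof -
  have g: "gradient (\<lambda>x. (u x + v x) / 2) x = (1/2) *\<^sub>R gradient u x + (1/2) *\<^sub>R gradient v x"
    "gradient (\<lambda>x. (u x - v x) / 2) x = (1/2) *\<^sub>R gradient u x + (- 1/2) *\<^sub>R gradient v x" for x
    using gradient_lincomb[OF u v, of "1/2" "1/2" x] gradient_lincomb[OF u v, of "1/2" "-1/2" x]
    by (simp_all add: field_simps)
  have t: "test_function (\<lambda>x. (u x + v x) / 2)" "test_function (\<lambda>x. (u x - v x) / 2)"
    using test_function_add[OF test_function_cmult[OF u, of "1/2"] test_function_cmult[OF v, of "1/2"]]
      test_function_add[OF test_function_cmult[OF u, of "1/2"] test_function_cmult[OF v, of "-1/2"]]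
    by (simp_all add: field_simps)
  have "dirichlet (gradient (\<lambda>x. (u x + v x) / 2)) + dirichlet (gradient (\<lambda>x. (u x - v x) / 2))
    = (\<integral>x. (norm (gradient (\<lambda>x. (u x + v x) / 2) x))\<^sup>2 + (norm (gradient (\<lambda>x. (u x - v x) / 2) x))\<^sup>2 \<partial>lborel)"
    unfolding dirichlet_def
    by (rule Bochner_Integration.integral_add[symmetric]) (intro integrable_test_dirichlet t)+
  also have "\<dots> = (\<integral>x. ((norm (gradient u x))\<^sup>2 + (norm (gradient v x))\<^sup>2) / 2 \<partial>lborel)"
    unfolding g power2_norm_eq_inner
    by (intro Bochner_Integration.integral_cong refl) (simp add: inner_add_left inner_add_right inner_commute algebra_simps)
  also have "\<dots> = (dirichlet (gradient u) + dirichlet (gradient v)) / 2"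
    unfolding dirichlet_def using integrable_test_dirichlet(1)[OF u] integrable_test_dirichlet(1)[OF v] by simp
  finally show ?thesis .
qed

lemma E_half_diff:
  fixes u v :: "'a \<Rightarrow> real"
  assumes u: "test_function u" and v: "test_function v"
  shows "dirichlet (gradient (\<lambda>x. u x - v x)) = 4 * dirichlet (gradient (\<lambda>x. (u x - v x) / 2))"
proof -
  have "(norm (gradient (\<lambda>x. u x - v x) x))\<^sup>2 = 4 * (norm (gradient (\<lambda>x. (u x - v x) / 2) x))\<^sup>2" for x
  proof -
    have "gradient (\<lambda>x. (u x - v x) / 2) x = (1/2) *\<^sub>R gradient u x + (- 1/2) *\<^sub>R gradient v x"
      using gradient_lincomb[OF u v, of "1/2" "-1/2" x] by (simp add: field_simps)
    then have "gradient (\<lambda>x. u x - v x) x = 2 *\<^sub>R gradient (\<lambda>x. (u x - v x) / 2) x"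
      by (simp add: gradient_diff[OF u v] scaleR_right_diff_distrib)
    then show ?thesis by (simp add: power_mult_distrib)
  qed
  then show ?thesis by (simp add: dirichlet_def)
qed

lemma Q_half_diff:
  fixes u v :: "'a \<Rightarrow> real"
  shows "Q (\<lambda>x. u x - v x) = 2 powr q * Q (\<lambda>x. (u x - v x) / 2)"
proof -
  have eq: "\<bar>u x - v x\<bar> powr q / norm x powr b = 2 powr q * (\<bar>(u x - v x) / 2\<bar> powr q / norm x powr b)" for x
    by (simp add: powr_divide)
  show ?thesis by (simp only: weighted_power_def eq integral_mult_right_zero)
qed

lemma Q_midpoint:
  fixes u v :: "'a \<Rightarrow> real"
  assumes u: "test_function u" and v: "test_function v"
  shows "Q (\<lambda>x. (u x + v x) / 2) + Q (\<lambda>x. (u x - v x) / 2) \<le> (Q u + Q v) / 2"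
proof -
  have t: "test_function (\<lambda>x. (u x + v x) / 2)" "test_function (\<lambda>x. (u x - v x) / 2)"
    using test_function_add[OF test_function_cmult[OF u, of "1/2"] test_function_cmult[OF v, of "1/2"]]
      test_function_add[OF test_function_cmult[OF u, of "1/2"] test_function_cmult[OF v, of "-1/2"]]
    by (simp_all add: field_simps)
  have "Q (\<lambda>x. (u x + v x) / 2) + Q (\<lambda>x. (u x - v x) / 2)
    = (\<integral>x. \<bar>(u x + v x) / 2\<bar> powr q / norm x powr b + \<bar>(u x - v x) / 2\<bar> powr q / norm x powr b \<partial>lborel)"
    unfolding weighted_power_def by (rule Bochner_Integration.integral_add[symmetric]) (rule integrable_Q, rule t)+
  also have "\<dots> \<le> (\<integral>x. (\<bar>u x\<bar> powr q / norm x powr b + \<bar>v x\<bar> powr q / norm x powr b) / 2 \<partial>lborel)"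
  proof (rule integral_mono)
    fix x
    have "(\<bar>(u x + v x) / 2\<bar> powr q + \<bar>(u x - v x) / 2\<bar> powr q) / norm x powr b
      \<le> ((\<bar>u x\<bar> powr q + \<bar>v x\<bar> powr q) / 2) / norm x powr b"
      using r by (intro divide_right_mono powr_clarkson) auto
    then show "\<bar>(u x + v x) / 2\<bar> powr q / norm x powr b + \<bar>(u x - v x) / 2\<bar> powr q / norm x powr b
      \<le> (\<bar>u x\<bar> powr q / norm x powr b + \<bar>v x\<bar> powr q / norm x powr b) / 2"
      by (simp add: add_divide_distrib)
  qed (intro integrable_divide Bochner_Integration.integrable_add integrable_Q u v t)+
  also have "\<dots> = (Q u + Q v) / 2"
    unfolding weighted_power_def using integrable_Q[OF u] integrable_Q[OF v] by simp
  finally show ?thesis .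
qed

lemma weighted_power_cmult: "weighted_power \<tau> p (\<lambda>x. k * u x) = \<bar>k\<bar> powr p * weighted_power \<tau> p u"
  unfolding weighted_power_def
  by (simp add: abs_mult powr_mult times_divide_eq_right[symmetric] del: times_divide_eq_right)

text \<open>
  Coercivity bounds the sequence, and the Hardy inequality makes \<open>rellich\<close> applicable. Absorption turns
  local convergence in \<open>L\<^sup>2\<close> into the Cauchy property for the \<open>r\<close>-term.
\<close>

lemma minimizing_sequence:
  obtains u K where "\<And>n. u n \<in> D" "0 \<le> K" "\<And>n. E (u n) \<le> K" "\<And>n. Q (u n) \<le> K" "(\<lambda>n. J (u n)) \<longlonglongrightarrow> level"
    "\<And>e. 0 < e \<Longrightarrow> \<exists>n0. \<forall>m\<ge>n0. \<forall>n\<ge>n0. B (\<lambda>x. u m x - u n x) \<le> e"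
proof -
  have "\<exists>u\<in>D. J u < level + 1 / real (Suc n)" for n
  proof -
    have "Inf (J ` D) < level + 1 / real (Suc n)" by (simp add: level_def)
    from cInf_lessD[OF _ this] show ?thesis using D_ne by blast
  qed
  then obtain v where v: "\<And>n. v n \<in> D" "\<And>n. J (v n) < level + 1 / real (Suc n)" by metis
  have lim: "(\<lambda>n. J (v n)) \<longlonglongrightarrow> level"
  proof (rule tendsto_sandwich[where f="\<lambda>_. level" and h="\<lambda>n. level + 1 / real (Suc n)"])
    show "(\<lambda>n. level + 1 / real (Suc n)) \<longlonglongrightarrow> level"
      using tendsto_add[OF tendsto_const[of level] LIMSEQ_inverse_real_of_nat] by (simp add: inverse_eq_divide)
    show "eventually (\<lambda>n. J (v n) \<le> level + 1 / real (Suc n)) sequentially"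
      using v(2) by (intro always_eventually allI less_imp_le)
    show "eventually (\<lambda>n. level \<le> J (v n)) sequentially" using v(1) level_le by simp
  qed simp
  define K0 where "K0 = level + 2"
  have Jv: "J (v n) \<le> K0 - 1" for n
  proof -
    have "1 / real (Suc n) \<le> 1" by simp
    then show ?thesis using v(2)[of n] unfolding K0_def by linarith
  qed
  have EQ: "E (v n) / 4 + Q (v n) / (2 * q) \<le> K0" for n using J_lower[OF v(1)[of n]] Jv[of n] by linarith
  have qn: "0 \<le> Q (v n) / (2 * q)" "0 \<le> E (v n) / 4" for n
    using r by (simp_all add: weighted_power_nonneg dirichlet_nonneg)
  have K0: "0 \<le> K0" using EQ[of 0] qn[of 0] by linarith
  \<comment> \<open>K bounds both terms: E / 4 \<le> K0 and Q / (2 q) \<le> K0.\<close>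
  define K where "K = 4 * K0 + 2 * q * K0"
  have Ev: "E (v n) \<le> K" for n
    using EQ[of n] qn(1)[of n] mult_nonneg_nonneg[of "2 * q" K0] K0 r unfolding K_def by linarith
  have Qv: "Q (v n) \<le> K" for n
  proof -
    have "Q (v n) / (2 * q) \<le> K0" using EQ[of n] qn(2)[of n] by linarith
    then have "Q (v n) \<le> 2 * q * K0" using r by (simp add: divide_le_eq mult_ac)
    then show ?thesis using K0 by (simp add: K_def)
  qed
  have K: "0 \<le> K" using K0 r by (simp add: K_def)
  define K' where "K' = (1 + c) * K"
  have K': "0 \<le> K'" using K c by (simp add: K'_def)
  have "\<exists>f :: nat \<Rightarrow> nat. strict_mono f \<and> (\<forall>R. \<forall>e>0. \<exists>n0. \<forall>m\<ge>n0. \<forall>n\<ge>n0.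
      (\<integral>x. indicator (cball 0 R) x * (v (f m) x - v (f n) x)\<^sup>2 \<partial>lborel) \<le> e)"
  proof (rule rellich[OF D_test[OF v(1)] K'])
    show "(\<integral>\<^sup>+x. ennreal ((norm (gradient (v n) x))\<^sup>2) \<partial>lborel) \<le> ennreal K'" for n
    proof -
      have "E (v n) \<le> K'" using Ev[of n] mult_nonneg_nonneg[OF c K] unfolding K'_def by (simp add: algebra_simps)
      then show ?thesis unfolding integrable_test_dirichlet(2)[OF D_test[OF v(1)]] by (rule ennreal_leI)
    qed
    show "(\<integral>\<^sup>+x. ennreal ((v n x)\<^sup>2 / (norm x)\<^sup>2) \<partial>lborel) \<le> ennreal K'" for n
    proof -
      have "c * E (v n) \<le> K'" using mult_left_mono[OF Ev[of n] c] K unfolding K'_def by (simp add: algebra_simps)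
      then show ?thesis using hardy_integral[OF v(1)[of n]] by (meson ennreal_leI order_trans)
    qed
  qed
  then obtain f :: "nat \<Rightarrow> nat" where f: "strict_mono f" and loc: "\<And>R e. 0 < e \<Longrightarrow> \<exists>n0. \<forall>m\<ge>n0. \<forall>n\<ge>n0.
      (\<integral>x. indicator (cball 0 R) x * (v (f m) x - v (f n) x)\<^sup>2 \<partial>lborel) \<le> e" by blast
  define u where "u n = v (f n)" for n
  have uD: "u n \<in> D" for n using v by (simp add: u_def)
  have "\<exists>n0. \<forall>m\<ge>n0. \<forall>n\<ge>n0. B (\<lambda>x. u m x - u n x) \<le> e" if e: "0 < e" for e
  proof -
    \<comment> \<open>A collects the bounds 4 K and 2 powr q K for the energies of differences, with the Hardy constant c.\<close>
    define A where "A = c * (4 * K) + 2 powr q * K + 1"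
    have A: "A \<ge> 1" using c K by (simp add: A_def)
    define \<epsilon> where "\<epsilon> = e / (2 * A)"
    have \<epsilon>: "0 < \<epsilon>" using e A by (simp add: \<epsilon>_def)
    obtain C R where C: "0 \<le> C" and abs: "\<And>w. w \<in> D \<Longrightarrow>
        B w \<le> \<epsilon> * (c * E w + Q w) + C * (\<integral>x. indicator (cball 0 R) x * (w x)\<^sup>2 \<partial>lborel) + \<epsilon>"
      using B_absorption[OF \<epsilon>] by blast
    obtain n0 where n0: "\<And>m n. m \<ge> n0 \<Longrightarrow> n \<ge> n0 \<Longrightarrow>
        (\<integral>x. indicator (cball 0 R) x * (v (f m) x - v (f n) x)\<^sup>2 \<partial>lborel) \<le> e / (2 * (C + 1))"
      using loc[of "e / (2 * (C + 1))" R] e C by fastforce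
    have "B (\<lambda>x. u m x - u n x) \<le> e" if mn: "m \<ge> n0" "n \<ge> n0" for m n
    proof -
      let ?w = "\<lambda>x. u m x - u n x"
      have t: "test_function (u m)" "test_function (u n)" using uD D_test by auto
      have Ew: "E ?w \<le> 4 * K"
      proof -
        have "E ?w = 4 * E (\<lambda>x. (u m x - u n x) / 2)" by (rule E_half_diff[OF t])
        also have "\<dots> \<le> 4 * ((E (u m) + E (u n)) / 2)"
          using E_midpoint[OF t] dirichlet_nonneg[of "gradient (\<lambda>x. (u m x + u n x) / 2)"] by simp
        also have "\<dots> \<le> 4 * K" using Ev[of "f m"] Ev[of "f n"] by (simp add: u_def)
        finally show ?thesis .
      qed
      have Qw: "Q ?w \<le> 2 powr q * K"
      proof -
        have "Q ?w = 2 powr q * Q (\<lambda>x. (u m x - u n x) / 2)"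
          by (rule Q_half_diff)
        also have "Q (\<lambda>x. (u m x - u n x) / 2) \<le> K"
          using Q_midpoint[OF t] weighted_power_nonneg[of b q "\<lambda>x. (u m x + u n x) / 2"] Qv[of "f m"] Qv[of "f n"]
          by (simp add: u_def)
        finally show ?thesis by (simp add: mult_left_mono)
      qed
      have "B ?w \<le> \<epsilon> * (c * E ?w + Q ?w) + C * (\<integral>x. indicator (cball 0 R) x * (?w x)\<^sup>2 \<partial>lborel) + \<epsilon>"
        by (intro abs D_diff uD)
      also have "\<dots> \<le> \<epsilon> * (c * (4 * K) + 2 powr q * K) + C * (e / (2 * (C + 1))) + \<epsilon>"
        using n0[OF mn] \<epsilon> c C Ew Qw by (intro add_mono mult_left_mono) (auto simp: u_def)
      also have "\<dots> = \<epsilon> * A + (C / (C + 1)) * (e / 2)" by (simp add: A_def algebra_simps)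
      also have "\<dots> \<le> e / 2 + 1 * (e / 2)"
        using A C e by (intro add_mono mult_right_mono) (auto simp: \<epsilon>_def)
      finally show ?thesis by simp
    qed
    then show ?thesis by blast
  qed
  moreover have "(\<lambda>n. J (u n)) \<longlonglongrightarrow> level"
    using LIMSEQ_subseq_LIMSEQ[OF lim f] by (simp add: u_def comp_def)
  ultimately show ?thesis using uD K Ev Qv by (intro that[of u K]) (auto simp: u_def)
qed

text \<open>
  The action at the midpoint of two members of the sequence is at least the infimum, while the
  parallelogram identity and Clarkson's inequality say that averaging lowers the first two terms by
  the size of the half difference. The \<open>r\<close>-term changes little, since it is nearly equal at the three points.
\<close>

lemma minimizing_sequence_cauchy:
  assumes u: "\<And>n. u n \<in> D" and K: "\<And>n. E (u n) \<le> K" "\<And>n. Q (u n) \<le> K" and lim: "(\<lambda>n. J (u n)) \<longlonglongrightarrow> level"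
    and B: "\<And>e. 0 < e \<Longrightarrow> \<exists>n0. \<forall>m\<ge>n0. \<forall>n\<ge>n0. B (\<lambda>x. u m x - u n x) \<le> e" and e: "0 < e"
  shows "\<exists>n0. \<forall>m\<ge>n0. \<forall>n\<ge>n0. E (\<lambda>x. u m x - u n x) \<le> e \<and> Q (\<lambda>x. u m x - u n x) \<le> e"
proof -
  \<comment> \<open>E of a difference is 8 times E / 2 of the half difference, and Q of it is q 2 powr q times Q / q of
    the half difference.\<close>
  define A where "A = 8 + q * 2 powr q"
  have A: "A > 0" using r by (simp add: A_def add_pos_nonneg)
  define \<epsilon> where "\<epsilon> = e / (A * (1 + 1 / r))"
  have \<epsilon>: "0 < \<epsilon>" using e A r by (simp add: \<epsilon>_def add_pos_pos)
  \<comment> \<open>By coercivity M bounds the r-term at midpoints.\<close>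
  define M where "M = r * (K / 4 + K / (2 * q) + 1)"
  obtain d where d: "0 < d" and cont: "\<And>f g :: 'a \<Rightarrow> real.
    integrable lborel (\<lambda>x. \<bar>f x\<bar> powr r / norm x powr \<eta>) \<Longrightarrow>
    integrable lborel (\<lambda>x. \<bar>g x\<bar> powr r / norm x powr \<eta>) \<Longrightarrow>
    integrable lborel (\<lambda>x. \<bar>f x - g x\<bar> powr r / norm x powr \<eta>) \<Longrightarrow>
    B g \<le> M \<Longrightarrow> B (\<lambda>x. f x - g x) \<le> d \<Longrightarrow> B f \<le> B g + \<epsilon>"
    using weighted_power_continuity[OF less_imp_le[OF r(1)] \<epsilon>, of \<eta> M, where 'a='a] by blast
  obtain n1 where n1: "\<And>m n. m \<ge> n1 \<Longrightarrow> n \<ge> n1 \<Longrightarrow> B (\<lambda>x. u m x - u n x) \<le> d" using B[OF d] by blast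
  have "eventually (\<lambda>n. J (u n) < level + \<epsilon>) sequentially" using lim \<epsilon> by (intro order_tendstoD(2)) auto
  then obtain n2 where n2: "\<And>n. n \<ge> n2 \<Longrightarrow> J (u n) < level + \<epsilon>" by (auto simp: eventually_sequentially)
  have "E (\<lambda>x. u m x - u n x) \<le> e \<and> Q (\<lambda>x. u m x - u n x) \<le> e" if mn: "m \<ge> max n1 n2" "n \<ge> max n1 n2" for m n
  proof -
    note t = D_test[OF u[of m]] D_test[OF u[of n]]
    let ?w = "\<lambda>x. (u m x - u n x) / 2" and ?v = "\<lambda>x. (u m x + u n x) / 2"
    have wD: "?w \<in> D" using D_lin[OF u[of m] u[of n], of "1/2" "-1/2"] by (simp add: field_simps)
    have vD: "?v \<in> D" using D_lin[OF u[of m] u[of n], of "1/2" "1/2"] by (simp add: field_simps)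
    have half: "B ?w \<le> d"
    proof -
      have "B ?w = (1/2) powr r * B (\<lambda>x. u m x - u n x)"
        using weighted_power_cmult[of \<eta> r "1/2" "\<lambda>x. u m x - u n x"] by simp
      also have "\<dots> \<le> 1 * B (\<lambda>x. u m x - u n x)"
        using r by (intro mult_right_mono weighted_power_nonneg) (simp add: powr_le1)
      finally show ?thesis using n1[of m n] mn by simp
    qed
    have mid: "X \<le> K" if "X + Y \<le> (S + T) / 2" "0 \<le> Y" "S \<le> K" "T \<le> K" for X Y S T :: real
      using that by (simp add: field_simps)
    have Ev: "E ?v \<le> K" by (rule mid[OF eq_refl[OF E_midpoint[OF t]] dirichlet_nonneg K(1) K(1)])
    have Qv: "Q ?v \<le> K" by (rule mid[OF Q_midpoint[OF t] weighted_power_nonneg K(2) K(2)])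
    have "B ?v / r \<le> K / 4 + K / (2 * q) + 1"
      using coercive[OF vD] Ev divide_right_mono[OF Qv, of "2 * q"] r by simp
    then have vM: "B ?v \<le> M" using r by (simp add: M_def divide_le_eq mult.commute)
    have Bm: "B (u m) \<le> B ?v + \<epsilon>"
    proof (rule cont[OF integrable_B[OF t(1)] integrable_B[OF D_test[OF vD]] _ vM])
      have eq: "(\<lambda>x. u m x - ?v x) = ?w" by (auto simp: field_simps)
      show "B (\<lambda>x. u m x - ?v x) \<le> d" unfolding eq by (rule half)
      show "integrable lborel (\<lambda>x. \<bar>u m x - ?v x\<bar> powr r / norm x powr \<eta>)"
        using integrable_B[OF D_test[OF wD]] eq by metis
    qed
    have Bn: "B (u n) \<le> B ?v + \<epsilon>"
    proof (rule cont[OF integrable_B[OF t(2)] integrable_B[OF D_test[OF vD]] _ vM])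
      have eq: "(\<lambda>x. \<bar>u n x - ?v x\<bar>) = (\<lambda>x. \<bar>?w x\<bar>)" by (auto simp: field_simps abs_minus_commute)
      have eq': "\<bar>u n x - ?v x\<bar> = \<bar>?w x\<bar>" for x using eq by metis
      show "B (\<lambda>x. u n x - ?v x) \<le> d" using half unfolding weighted_power_def eq' .
      show "integrable lborel (\<lambda>x. \<bar>u n x - ?v x\<bar> powr r / norm x powr \<eta>)"
        unfolding eq' by (rule integrable_B[OF D_test[OF wD]])
    qed
    have lv: "level \<le> J ?v" by (rule level_le[OF vD])
    have "E ?w / 2 + Q ?w / q \<le> \<epsilon> + \<epsilon> / r"
    proof -
      have "(Q ?v + Q ?w) / q \<le> ((Q (u m) + Q (u n)) / 2) / q"
        using Q_midpoint[OF t] r by (intro divide_right_mono) auto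
      moreover have "(B (u m) + B (u n)) / 2 / r \<le> (B ?v + \<epsilon>) / r"
        using Bm Bn r by (intro divide_right_mono) auto
      moreover have "J (u m) < level + \<epsilon>" "J (u n) < level + \<epsilon>" using n2 mn by auto
      ultimately show ?thesis using lv E_midpoint[OF t] unfolding action_def
        by (simp add: add_divide_distrib)
    qed
    also have "\<epsilon> + \<epsilon> / r = e / A"
    proof -
      have "\<epsilon> + \<epsilon> / r = \<epsilon> * (1 + 1 / r)" by (simp add: algebra_simps)
      also have "\<dots> = e / A"
      proof -
        have "0 < 1 + 1 / r" using r by (simp add: add_pos_pos)
        then show ?thesis by (simp add: \<epsilon>_def)
      qed
      finally show ?thesis .
    qed
    finally have main: "E ?w / 2 + Q ?w / q \<le> e / A" .
    have nn: "0 \<le> E ?w / 2" "0 \<le> Q ?w / q" using r by (simp_all add: dirichlet_nonneg weighted_power_nonneg)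
    have part: "E ?w / 2 \<le> e / A" "Q ?w / q \<le> e / A" using main nn by linarith+
    have A8: "8 \<le> A" "q * 2 powr q \<le> A" using r by (simp_all add: A_def)
    have "E (\<lambda>x. u m x - u n x) = 8 * (E ?w / 2)" by (simp add: E_half_diff[OF t])
    also have "\<dots> \<le> A * (e / A)"
      by (rule mult_mono[OF A8(1) part(1)]) (use A nn in auto)
    finally have 1: "E (\<lambda>x. u m x - u n x) \<le> e" using A by simp
    have "Q (\<lambda>x. u m x - u n x) = (q * 2 powr q) * (Q ?w / q)"
      using r by (simp add: Q_half_diff)
    also have "\<dots> \<le> A * (e / A)"
      by (rule mult_mono[OF A8(2) part(2)]) (use A nn in auto)
    finally show ?thesis using 1 A by simp
  qed
  then show ?thesis by blast
qed

end

section \<open>Passing to the limit and differentiating\<close>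

lemma powr_integral_tendsto:
  fixes f :: "nat \<Rightarrow> 'a \<Rightarrow> 'b::real_normed_vector" and \<omega> :: "'a \<Rightarrow> real"
  assumes p: "1 \<le> p" and \<omega>: "\<And>x. 0 \<le> \<omega> x"
    and f: "\<And>n. integrable \<mu> (\<lambda>x. \<omega> x * norm (f n x) powr p)"
    and F: "integrable \<mu> (\<lambda>x. \<omega> x * norm (F x) powr p)"
    and d: "\<And>n. integrable \<mu> (\<lambda>x. \<omega> x * norm (F x - f n x) powr p)"
    and lim: "(\<lambda>n. \<integral>x. \<omega> x * norm (F x - f n x) powr p \<partial>\<mu>) \<longlonglongrightarrow> 0"
  shows "(\<lambda>n. \<integral>x. \<omega> x * norm (f n x) powr p \<partial>\<mu>) \<longlonglongrightarrow> (\<integral>x. \<omega> x * norm (F x) powr p \<partial>\<mu>)"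
proof -
  let ?I = "\<lambda>g. \<integral>x. \<omega> x * norm (g x) powr p \<partial>\<mu>"
  have d': "integrable \<mu> (\<lambda>x. \<omega> x * norm (f n x - F x) powr p)" for n
    using d[of n] by (simp add: norm_minus_commute)
  have above: "eventually (\<lambda>n. ?I (f n) \<le> ?I F + e) sequentially" if e: "0 < e" for e
  proof -
    obtain k where k: "0 < k" "\<And>(f :: 'a \<Rightarrow> 'b) g \<mu> \<omega>. (\<And>x. 0 \<le> \<omega> x) \<Longrightarrow>
      integrable \<mu> (\<lambda>x. \<omega> x * norm (f x) powr p) \<Longrightarrow>
      integrable \<mu> (\<lambda>x. \<omega> x * norm (g x) powr p) \<Longrightarrow> integrable \<mu> (\<lambda>x. \<omega> x * norm (f x - g x) powr p) \<Longrightarrow>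
      (\<integral>x. \<omega> x * norm (g x) powr p \<partial>\<mu>) \<le> ?I F \<Longrightarrow> (\<integral>x. \<omega> x * norm (f x - g x) powr p \<partial>\<mu>) \<le> k \<Longrightarrow>
      (\<integral>x. \<omega> x * norm (f x) powr p \<partial>\<mu>) \<le> (\<integral>x. \<omega> x * norm (g x) powr p \<partial>\<mu>) + e"
      using powr_integral_continuity[OF p e, where 'a='a and 'b='b and M="?I F"] by blast
    have "eventually (\<lambda>n. (\<integral>x. \<omega> x * norm (F x - f n x) powr p \<partial>\<mu>) < k) sequentially"
      using lim k(1) by (rule order_tendstoD(2))
    then show ?thesis
    proof eventually_elim
      case (elim n)
      then show ?case
        by (intro k(2)[OF \<omega> f F d' order_refl]) (simp add: norm_minus_commute)
    qed
  qed
  have below: "eventually (\<lambda>n. ?I F \<le> ?I (f n) + e) sequentially" if e: "0 < e" for e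
  proof -
    obtain k where k: "0 < k" "\<And>(f :: 'a \<Rightarrow> 'b) g \<mu> \<omega>. (\<And>x. 0 \<le> \<omega> x) \<Longrightarrow>
      integrable \<mu> (\<lambda>x. \<omega> x * norm (f x) powr p) \<Longrightarrow>
      integrable \<mu> (\<lambda>x. \<omega> x * norm (g x) powr p) \<Longrightarrow> integrable \<mu> (\<lambda>x. \<omega> x * norm (f x - g x) powr p) \<Longrightarrow>
      (\<integral>x. \<omega> x * norm (g x) powr p \<partial>\<mu>) \<le> ?I F + 1 \<Longrightarrow> (\<integral>x. \<omega> x * norm (f x - g x) powr p \<partial>\<mu>) \<le> k \<Longrightarrow>
      (\<integral>x. \<omega> x * norm (f x) powr p \<partial>\<mu>) \<le> (\<integral>x. \<omega> x * norm (g x) powr p \<partial>\<mu>) + e"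
      using powr_integral_continuity[OF p e, where 'a='a and 'b='b and M="?I F + 1"] by blast
    have "eventually (\<lambda>n. (\<integral>x. \<omega> x * norm (F x - f n x) powr p \<partial>\<mu>) < k) sequentially"
      using lim k(1) by (rule order_tendstoD(2))
    then show ?thesis using above[OF zero_less_one]
    proof eventually_elim
      case (elim n)
      then show ?case by (intro k(2)[OF \<omega> F f d]) simp_all
    qed
  qed
  show ?thesis
  proof (rule tendstoI)
    fix e :: real assume e: "0 < e"
    have e2: "0 < e / 2" using e by simp
    show "eventually (\<lambda>n. dist (?I (f n)) (?I F) < e) sequentially"
      using above[OF e2] below[OF e2]
      by eventually_elim (use e in \<open>simp add: dist_real_def abs_less_iff field_simps\<close>)
  qed
qed

lemma powr_norm_convex:
  fixes a d :: "'b::real_normed_vector"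
  assumes p: "1 \<le> p" and t: "0 \<le> t" "t \<le> 1"
  shows "norm ((1 - t) *\<^sub>R a + t *\<^sub>R d) powr p \<le> (1 - t) * norm a powr p + t * norm d powr p"
proof (cases "t = 0 \<or> t = 1")
  case False
  then have t': "0 < t" "t < 1" using t by auto
  have s: "s powr (1 - p) * (s * X) powr p = s * X powr p" if "0 < s" "0 \<le> X" for s X :: real
  proof -
    have "s powr (1 - p) * (s * X) powr p = (s powr (1 - p) * s powr p) * X powr p"
      using that by (simp add: powr_mult)
    also have "s powr (1 - p) * s powr p = s" using that by (simp add: powr_add[symmetric])
    finally show ?thesis .
  qed
  show ?thesis
    using powr_norm_add_le[OF p t', of "(1 - t) *\<^sub>R a" "t *\<^sub>R d"] t' s[of "1 - t" "norm a"] s[of t "norm d"] by simp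
qed (use p in auto)

lemma DERIV_abs_powr:
  fixes s p :: real
  assumes p: "1 < p"
  shows "((\<lambda>s. \<bar>s\<bar> powr p) has_real_derivative p * (\<bar>s\<bar> powr (p - 2) * s)) (at s)"
proof -
  consider "s > 0" | "s < 0" | "s = 0" by linarith
  then show ?thesis
  proof cases
    case 1
    have "((\<lambda>s. s powr p) has_real_derivative p * s powr (p - 1)) (at s)"
      using 1 by (rule has_real_derivative_powr)
    also have "s powr (p - 1) = \<bar>s\<bar> powr (p - 2) * s"
      using 1 powr_add[of s "p - 2" 1] by simp
    finally show ?thesis
      by (rule has_field_derivative_transform_within_open[of _ _ _ "{0<..}"]) (use 1 in auto)
  next
    case 2
    have "((\<lambda>s. (- s) powr p) has_real_derivative - (p * (- s) powr (p - 1))) (at s)"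
      using 2 by (auto intro!: derivative_eq_intros simp: powr_diff)
    also have "- (p * (- s) powr (p - 1)) = p * (\<bar>s\<bar> powr (p - 2) * s)"
      using 2 powr_add[of "- s" "p - 2" 1] by simp
    finally show ?thesis
      by (rule has_field_derivative_transform_within_open[of _ _ _ "{..<0}"]) (use 2 in auto)
  next
    case 3
    have "((\<lambda>h. \<bar>h\<bar> powr (p - 1)) \<longlongrightarrow> \<bar>0::real\<bar> powr (p - 1)) (at 0)"
      using p by (intro tendsto_powr' tendsto_intros) auto
    then have "((\<lambda>h::real. \<bar>h\<bar> powr (p - 1)) \<longlongrightarrow> 0) (at 0)" by simp
    moreover have "eventually (\<lambda>h::real. norm (\<bar>h\<bar> powr p / h) \<le> \<bar>h\<bar> powr (p - 1)) (at 0)"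
      unfolding eventually_at_filter by (intro always_eventually) (simp add: powr_diff)
    ultimately have "((\<lambda>h::real. \<bar>h\<bar> powr p / h) \<longlongrightarrow> 0) (at 0)"
      by (rule Lim_null_comparison[rotated])
    then show ?thesis using 3 by (simp add: has_field_derivative_iff)
  qed
qed

text \<open>
  By convexity, the slope of the secant of \<open>t \<rightarrow> \<bar>a + t d\<bar>\<^sup>p\<close> over \<open>[0, t]\<close> lies between the slopes over \<open>[-1, 0]\<close> and
  \<open>[0, 1]\<close>. The bound does not depend on \<open>t\<close> and serves for dominated convergence.
\<close>

lemma power_difference_quotient_bound:
  fixes a d t p :: real
  assumes p: "1 \<le> p" and t: "0 < t" "t \<le> 1"
  shows "\<bar>(\<bar>a + t * d\<bar> powr p - \<bar>a\<bar> powr p) / t\<bar> \<le> \<bar>a + d\<bar> powr p + 2 * \<bar>a\<bar> powr p + \<bar>a - d\<bar> powr p"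
proof -
  define f0 fp fm ft where f: "f0 = \<bar>a\<bar> powr p" "fp = \<bar>a + d\<bar> powr p" "fm = \<bar>a - d\<bar> powr p" "ft = \<bar>a + t * d\<bar> powr p"
  have nn: "0 \<le> f0" "0 \<le> fp" "0 \<le> fm" by (simp_all add: f)
  have "ft \<le> (1 - t) * f0 + t * fp"
    using powr_norm_convex[OF p, of t a "a + d"] t by (simp add: f algebra_simps)
  then have "ft - f0 \<le> t * (fp - f0)" by (simp add: algebra_simps)
  then have up: "(ft - f0) / t \<le> fp - f0" using t by (simp add: divide_le_eq mult.commute)
  \<comment> \<open>With this s the point a is the convex combination of a + t d and a - d with weights 1 - s and s.\<close>
  define s where "s = t / (1 + t)"
  have s: "0 \<le> s" "s \<le> 1" "1 - s = 1 / (1 + t)" using t by (auto simp: s_def field_simps)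
  have ts: "t * (1 - s) = s" unfolding s(3) by (simp add: s_def)
  have "(1 - s) * (a + t * d) + s * (a - d) = a + d * (t * (1 - s) - s)" by (simp add: algebra_simps)
  also have "\<dots> = a" using ts by simp
  finally have "(1 - s) * (a + t * d) + s * (a - d) = a" .
  then have "f0 \<le> (1 - s) * ft + s * fm"
    using powr_norm_convex[OF p s(1,2), of "a + t * d" "a - d"] by (simp add: f)
  then have "(1 + t) * f0 \<le> (1 + t) * ((1 - s) * ft + s * fm)" using t by (intro mult_left_mono) auto
  also have "\<dots> = ((1 + t) * (1 - s)) * ft + ((1 + t) * s) * fm" by (simp only: distrib_left mult.assoc)
  also have "\<dots> = ft + t * fm"
  proof -
    have "(1 + t) * (1 - s) = 1" "(1 + t) * s = t" unfolding s(3) using t by (simp_all add: s_def)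
    then show ?thesis by simp
  qed
  finally have "(f0 - fm) * t \<le> ft - f0" by (simp add: algebra_simps)
  then have "f0 - fm \<le> (ft - f0) / t" using t by (simp add: pos_le_divide_eq)
  then have "\<bar>(ft - f0) / t\<bar> \<le> fp + 2 * f0 + fm" using up nn by (simp add: abs_le_iff)
  then show ?thesis by (simp add: f)
qed

lemma power_difference_quotient_tendsto:
  fixes U v \<omega> :: "'a::euclidean_space \<Rightarrow> real"
  assumes p: "1 < p" and [measurable]: "U \<in> borel_measurable borel" "v \<in> borel_measurable borel" "\<omega> \<in> borel_measurable borel"
    and \<omega>: "\<And>x. 0 \<le> \<omega> x"
    and int: "\<And>t. integrable lborel (\<lambda>x. \<omega> x * \<bar>U x + t * v x\<bar> powr p)"
  shows "integrable lborel (\<lambda>x. \<omega> x * (\<bar>U x\<bar> powr (p - 2) * U x * v x))"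
    and "(\<lambda>n. ((\<integral>x. \<omega> x * \<bar>U x + (1 / real (Suc n)) * v x\<bar> powr p \<partial>lborel) - (\<integral>x. \<omega> x * \<bar>U x\<bar> powr p \<partial>lborel)) / (1 / real (Suc n)))
      \<longlonglongrightarrow> p * (\<integral>x. \<omega> x * (\<bar>U x\<bar> powr (p - 2) * U x * v x) \<partial>lborel)"
proof -
  define t where "t n = 1 / real (Suc n)" for n
  have t: "0 < t n" "t n \<le> 1" for n by (auto simp: t_def)
  define W where "W x = \<omega> x * \<bar>U x + 1 * v x\<bar> powr p + 2 * (\<omega> x * \<bar>U x + 0 * v x\<bar> powr p) + \<omega> x * \<bar>U x + (-1) * v x\<bar> powr p" for x
  have W: "integrable lborel W"
    unfolding W_def[abs_def] by (intro Bochner_Integration.integrable_add integrable_mult_right int)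
  define q where "q n x = \<omega> x * ((\<bar>U x + t n * v x\<bar> powr p - \<bar>U x\<bar> powr p) / t n)" for n x
  have qm: "q n \<in> borel_measurable lborel" for n unfolding q_def[abs_def] by measurable
  have lm: "(\<lambda>x. \<omega> x * (p * (\<bar>U x\<bar> powr (p - 2) * U x * v x))) \<in> borel_measurable lborel" by measurable
  have lim: "AE x in lborel. (\<lambda>n. q n x) \<longlonglongrightarrow> \<omega> x * (p * (\<bar>U x\<bar> powr (p - 2) * U x * v x))"
  proof (intro AE_I2)
    fix x
    have "((\<lambda>s. \<bar>U x + s * v x\<bar> powr p) has_real_derivative (p * (\<bar>U x + 0 * v x\<bar> powr (p - 2) * (U x + 0 * v x))) * v x) (at 0)"
      by (rule DERIV_chain2[OF DERIV_abs_powr[OF p]]) (auto intro!: derivative_eq_intros)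
    then have "((\<lambda>s. (\<bar>U x + s * v x\<bar> powr p - \<bar>U x\<bar> powr p) / s) \<longlongrightarrow> p * (\<bar>U x\<bar> powr (p - 2) * U x * v x)) (at 0)"
      by (simp add: has_field_derivative_iff mult.assoc)
    moreover have "filterlim t (at 0) sequentially"
      unfolding filterlim_at using LIMSEQ_inverse_real_of_nat t
      by (auto simp: t_def[abs_def] inverse_eq_divide)
    ultimately have "(\<lambda>n. (\<bar>U x + t n * v x\<bar> powr p - \<bar>U x\<bar> powr p) / t n) \<longlonglongrightarrow> p * (\<bar>U x\<bar> powr (p - 2) * U x * v x)"
      by (rule filterlim_compose)
    then show "(\<lambda>n. q n x) \<longlonglongrightarrow> \<omega> x * (p * (\<bar>U x\<bar> powr (p - 2) * U x * v x))"
      unfolding q_def by (intro tendsto_mult tendsto_const)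
  qed
  have bd: "AE x in lborel. norm (q n x) \<le> W x" for n
  proof (intro AE_I2)
    fix x
    have "\<omega> x * \<bar>(\<bar>U x + t n * v x\<bar> powr p - \<bar>U x\<bar> powr p) / t n\<bar>
      \<le> \<omega> x * (\<bar>U x + v x\<bar> powr p + 2 * \<bar>U x\<bar> powr p + \<bar>U x - v x\<bar> powr p)"
      using p t by (intro mult_left_mono power_difference_quotient_bound \<omega>) auto
    moreover have "norm (q n x) = \<omega> x * \<bar>(\<bar>U x + t n * v x\<bar> powr p - \<bar>U x\<bar> powr p) / t n\<bar>"
      by (simp only: q_def real_norm_def abs_mult abs_of_nonneg[OF \<omega>])
    moreover have "W x = \<omega> x * (\<bar>U x + v x\<bar> powr p + 2 * \<bar>U x\<bar> powr p + \<bar>U x - v x\<bar> powr p)"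
      by (simp add: W_def algebra_simps)
    ultimately show "norm (q n x) \<le> W x" by simp
  qed
  have "integrable lborel (\<lambda>x. \<omega> x * (p * (\<bar>U x\<bar> powr (p - 2) * U x * v x)))"
    by (rule integrable_dominated_convergence[OF lm qm W lim bd])
  then have "integrable lborel (\<lambda>x. (1 / p) * (\<omega> x * (p * (\<bar>U x\<bar> powr (p - 2) * U x * v x))))"
    by (rule integrable_mult_right)
  then show "integrable lborel (\<lambda>x. \<omega> x * (\<bar>U x\<bar> powr (p - 2) * U x * v x))" using p by (simp add: mult.assoc)
  have "(\<lambda>n. \<integral>x. q n x \<partial>lborel) \<longlonglongrightarrow> (\<integral>x. \<omega> x * (p * (\<bar>U x\<bar> powr (p - 2) * U x * v x)) \<partial>lborel)"
    by (rule integral_dominated_convergence[OF lm qm W lim bd])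
  also have "(\<integral>x. \<omega> x * (p * (\<bar>U x\<bar> powr (p - 2) * U x * v x)) \<partial>lborel) = p * (\<integral>x. \<omega> x * (\<bar>U x\<bar> powr (p - 2) * U x * v x) \<partial>lborel)"
    by (simp only: mult.left_commute[of _ p] integral_mult_right_zero)
  also have "(\<lambda>n. \<integral>x. q n x \<partial>lborel) = (\<lambda>n. ((\<integral>x. \<omega> x * \<bar>U x + t n * v x\<bar> powr p \<partial>lborel) - (\<integral>x. \<omega> x * \<bar>U x\<bar> powr p \<partial>lborel)) / t n)"
  proof
    fix n
    have "(\<integral>x. q n x \<partial>lborel) = (\<integral>x. (\<omega> x * \<bar>U x + t n * v x\<bar> powr p - \<omega> x * \<bar>U x + 0 * v x\<bar> powr p) / t n \<partial>lborel)"
      by (intro Bochner_Integration.integral_cong refl) (simp add: q_def right_diff_distrib)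
    also have "\<dots> = ((\<integral>x. \<omega> x * \<bar>U x + t n * v x\<bar> powr p \<partial>lborel) - (\<integral>x. \<omega> x * \<bar>U x + 0 * v x\<bar> powr p \<partial>lborel)) / t n"
      by (simp only: integral_divide_zero Bochner_Integration.integral_diff[OF int int])
    finally show "(\<integral>x. q n x \<partial>lborel) = ((\<integral>x. \<omega> x * \<bar>U x + t n * v x\<bar> powr p \<partial>lborel) - (\<integral>x. \<omega> x * \<bar>U x\<bar> powr p \<partial>lborel)) / t n" by simp
  qed
  finally show "(\<lambda>n. ((\<integral>x. \<omega> x * \<bar>U x + (1 / real (Suc n)) * v x\<bar> powr p \<partial>lborel) - (\<integral>x. \<omega> x * \<bar>U x\<bar> powr p \<partial>lborel)) / (1 / real (Suc n)))
      \<longlonglongrightarrow> p * (\<integral>x. \<omega> x * (\<bar>U x\<bar> powr (p - 2) * U x * v x) \<partial>lborel)"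
    by (simp only: t_def)
qed

lemma integrable_powr_add:
  fixes f g :: "'a::euclidean_space \<Rightarrow> 'b::euclidean_space" and \<omega> :: "'a \<Rightarrow> real"
  assumes p: "1 \<le> p" and [measurable]: "f \<in> borel_measurable borel" "g \<in> borel_measurable borel" "\<omega> \<in> borel_measurable borel"
    and \<omega>: "\<And>x. 0 \<le> \<omega> x"
    and int: "integrable lborel (\<lambda>x. \<omega> x * norm (f x) powr p)" "integrable lborel (\<lambda>x. \<omega> x * norm (g x) powr p)"
  shows "integrable lborel (\<lambda>x. \<omega> x * norm (f x + g x) powr p)"
proof (rule Bochner_Integration.integrable_bound)
  define C where "C = (1/2::real) powr (1 - p)"
  show "integrable lborel (\<lambda>x. C * (\<omega> x * norm (f x) powr p) + C * (\<omega> x * norm (g x) powr p))"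
    by (intro Bochner_Integration.integrable_add integrable_mult_right int)
  show "AE x in lborel. norm (\<omega> x * norm (f x + g x) powr p) \<le> norm (C * (\<omega> x * norm (f x) powr p) + C * (\<omega> x * norm (g x) powr p))"
  proof (intro AE_I2)
    fix x
    have "\<omega> x * norm (f x + g x) powr p \<le> \<omega> x * (C * norm (f x) powr p + C * norm (g x) powr p)"
      using powr_norm_add_le[OF p, of "1/2" "f x" "g x"] by (intro mult_left_mono \<omega>) (simp add: C_def)
    also have "\<dots> = C * (\<omega> x * norm (f x) powr p) + C * (\<omega> x * norm (g x) powr p)" by (simp add: algebra_simps)
    finally show "norm (\<omega> x * norm (f x + g x) powr p) \<le> norm (C * (\<omega> x * norm (f x) powr p) + C * (\<omega> x * norm (g x) powr p))"
      using \<omega>[of x] by simp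
  qed
qed measurable

text \<open>
  This replaces Hoelder's inequality on sets of finite measure: the first term is small with \<open>s\<close>, and
  for fixed \<open>s\<close> the second is a multiple of the \<open>p\<close>-th power.
\<close>

lemma abs_le_powr_interpolation:
  fixes d s p :: real
  assumes "0 < s" "1 \<le> p"
  shows "\<bar>d\<bar> \<le> s + s powr (1 - p) * \<bar>d\<bar> powr p"
proof (cases "\<bar>d\<bar> \<le> s")
  case False
  then have "\<bar>d\<bar> powr (1 - p) \<le> s powr (1 - p)" using assms by (intro powr_mono2') auto
  then have "\<bar>d\<bar> powr (1 - p) * \<bar>d\<bar> powr p \<le> s powr (1 - p) * \<bar>d\<bar> powr p" by (intro mult_right_mono) auto
  moreover have "\<bar>d\<bar> powr (1 - p) * \<bar>d\<bar> powr p = \<bar>d\<bar>" using False assms by (simp add: powr_add[symmetric])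
  ultimately show ?thesis using assms by simp
qed (simp add: add_increasing2)

text \<open>
  Convergence in a weighted space implies convergence against bounded functions of bounded support,
  provided that the weight is bounded below on bounded sets away from the origin.
\<close>

lemma pairing_tendsto_0:
  fixes f :: "nat \<Rightarrow> 'a::euclidean_space \<Rightarrow> real" and \<omega> \<psi> :: "'a \<Rightarrow> real"
  assumes p: "1 < p" and f: "\<And>n. f n \<in> borel_measurable borel" and \<psi>: "\<psi> \<in> borel_measurable borel"
    and B: "\<And>x. \<bar>\<psi> x\<bar> \<le> B" "\<forall>x. M < norm x \<longrightarrow> \<psi> x = 0"
    and \<omega>: "\<And>x. 0 \<le> \<omega> x" "0 \<le> C" "\<forall>x. x \<noteq> 0 \<longrightarrow> norm x \<le> M \<longrightarrow> 1 \<le> C * \<omega> x"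
    and int: "\<And>n. integrable lborel (\<lambda>x. \<omega> x * \<bar>f n x\<bar> powr p)"
    and lim: "(\<lambda>n. \<integral>x. \<omega> x * \<bar>f n x\<bar> powr p \<partial>lborel) \<longlonglongrightarrow> 0"
  shows "\<And>n. integrable lborel (\<lambda>x. f n x * \<psi> x)" "(\<lambda>n. \<integral>x. f n x * \<psi> x \<partial>lborel) \<longlonglongrightarrow> 0"
proof -
  note [measurable] = f \<psi>
  have B0: "0 \<le> B" using B(1)[of 0] by simp
  have ib: "integrable lborel (\<lambda>x::'a. k * indicator (cball 0 M) x)" for k :: real
    using emeasure_lborel_cball_finite[of "0::'a" M]
    by (intro integrable_mult_right integrable_real_indicator) simp_all
  define W where "W s n x = (B * s) * indicator (cball 0 M) x + (B * s powr (1 - p) * C) * (\<omega> x * \<bar>f n x\<bar> powr p)" for s n x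
  have iW: "integrable lborel (W s n)" for s n unfolding W_def[abs_def]
    by (intro Bochner_Integration.integrable_add ib integrable_mult_right int)
  have bound: "AE x in lborel. norm (f n x * \<psi> x) \<le> W s n x" if s: "0 < s" for s n
    using AE_lborel_singleton[of "0::'a"]
  proof eventually_elim
    case (elim x)
    have W0: "0 \<le> W s n x" using B0 s \<omega> by (simp add: W_def)
    show ?case
    proof (cases "norm x \<le> M")
      case True
      have "norm (f n x * \<psi> x) \<le> (s + s powr (1 - p) * \<bar>f n x\<bar> powr p) * B"
        unfolding real_norm_def abs_mult using p s by (intro mult_mono abs_le_powr_interpolation B) auto
      also have "\<dots> = B * s + (B * s powr (1 - p)) * (1 * \<bar>f n x\<bar> powr p)" by (simp add: algebra_simps)
      also have "\<dots> \<le> B * s + (B * s powr (1 - p)) * ((C * \<omega> x) * \<bar>f n x\<bar> powr p)"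
        using \<omega>(3)[rule_format, OF elim True] B0 by (intro add_left_mono mult_left_mono mult_right_mono) auto
      also have "\<dots> = W s n x" using True by (simp add: W_def mult_ac)
      finally show ?thesis .
    next
      case False
      then show ?thesis using B(2) W0 by simp
    qed
  qed
  show i: "integrable lborel (\<lambda>x. f n x * \<psi> x)" for n
  proof (rule Bochner_Integration.integrable_bound[OF iW[of 1 n]])
    show "AE x in lborel. norm (f n x * \<psi> x) \<le> norm (W 1 n x)"
      using bound[OF zero_less_one, of n] by eventually_elim auto
  qed measurable
  define V where "V = measure lborel (cball (0::'a) M)"
  have est: "\<bar>\<integral>x. f n x * \<psi> x \<partial>lborel\<bar> \<le> B * s * V + (B * s powr (1 - p) * C) * (\<integral>x. \<omega> x * \<bar>f n x\<bar> powr p \<partial>lborel)" if s: "0 < s" for s n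
  proof -
    have "\<bar>\<integral>x. f n x * \<psi> x \<partial>lborel\<bar> \<le> (\<integral>x. norm (f n x * \<psi> x) \<partial>lborel)"
      using integral_norm_bound[of lborel "\<lambda>x. f n x * \<psi> x"] by simp
    also have "\<dots> \<le> (\<integral>x. W s n x \<partial>lborel)"
      by (intro integral_mono_AE integrable_norm i iW bound s)
    also have "\<dots> = B * s * V + (B * s powr (1 - p) * C) * (\<integral>x. \<omega> x * \<bar>f n x\<bar> powr p \<partial>lborel)"
      unfolding W_def[abs_def] V_def
      by (subst Bochner_Integration.integral_add[OF ib integrable_mult_right[OF int]]) simp
    finally show ?thesis .
  qed
  show "(\<lambda>n. \<integral>x. f n x * \<psi> x \<partial>lborel) \<longlonglongrightarrow> 0"
  proof (rule tendstoI)
    fix e :: real assume e: "0 < e"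
    define s where "s = e / (2 * (B * V + 1))"
    have V0: "0 \<le> B * V" using B0 by (simp add: V_def)
    have s: "0 < s" using e V0 by (simp add: s_def add_nonneg_pos)
    have "s * (2 * (B * V + 1)) = e" using V0 by (simp add: s_def add_nonneg_eq_0_iff)
    then have sB: "B * s * V < e / 2" using s by (simp add: algebra_simps)
    have "(\<lambda>n. (B * s powr (1 - p) * C) * (\<integral>x. \<omega> x * \<bar>f n x\<bar> powr p \<partial>lborel)) \<longlonglongrightarrow> (B * s powr (1 - p) * C) * 0"
      by (intro tendsto_mult tendsto_const lim)
    then have "eventually (\<lambda>n. (B * s powr (1 - p) * C) * (\<integral>x. \<omega> x * \<bar>f n x\<bar> powr p \<partial>lborel) < e / 2) sequentially"
      using e by (intro order_tendstoD(2)) auto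
    then show "eventually (\<lambda>n. dist (\<integral>x. f n x * \<psi> x \<partial>lborel) 0 < e) sequentially"
    proof eventually_elim
      case (elim n)
      show ?case using est[OF s, of n] sB elim by (simp add: dist_real_def)
    qed
  qed
qed

lemma powr_integral_limit:
  fixes w :: "nat \<Rightarrow> 'a::euclidean_space \<Rightarrow> 'b::euclidean_space" and \<omega> :: "'a \<Rightarrow> real"
  assumes p: "1 \<le> p" and w: "\<And>n. w n \<in> borel_measurable borel" and U: "U \<in> borel_measurable borel"
    and \<omega>: "\<omega> \<in> borel_measurable borel" "\<And>x. 0 \<le> \<omega> x"
    and lim: "AE x in lborel. (\<lambda>n. w n x) \<longlonglongrightarrow> U x"
    and int: "\<And>n. integrable lborel (\<lambda>x. \<omega> x * norm (w n x) powr p)"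
    and cauchy: "\<And>e. 0 < e \<Longrightarrow> \<exists>n0. \<forall>m\<ge>n0. \<forall>n\<ge>n0. (\<integral>x. \<omega> x * norm (w m x - w n x) powr p \<partial>lborel) \<le> e"
  shows "integrable lborel (\<lambda>x. \<omega> x * norm (U x) powr p)"
    and "\<And>n. integrable lborel (\<lambda>x. \<omega> x * norm (U x - w n x) powr p)"
    and "(\<lambda>n. \<integral>x. \<omega> x * norm (U x - w n x) powr p \<partial>lborel) \<longlonglongrightarrow> 0"
proof -
  note [measurable] = w U \<omega>(1)
  have diff: "integrable lborel (\<lambda>x. \<omega> x * norm (f x - g x) powr p)"
    if "f \<in> borel_measurable borel" "g \<in> borel_measurable borel"
      "integrable lborel (\<lambda>x. \<omega> x * norm (f x) powr p)" "integrable lborel (\<lambda>x. \<omega> x * norm (g x) powr p)"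
    for f g :: "'a \<Rightarrow> 'b"
  proof -
    have "(\<lambda>x. - g x) \<in> borel_measurable borel" using that by simp
    from integrable_powr_add[OF p that(1) this \<omega> that(3)] that(4) show ?thesis by simp
  qed
  have wd: "integrable lborel (\<lambda>x. \<omega> x * norm (w m x - w n x) powr p)" for m n
    by (intro diff w int)
  have le: "\<exists>n0. \<forall>n\<ge>n0. integrable lborel (\<lambda>x. \<omega> x * norm (U x - w n x) powr p) \<and>
      (\<integral>x. \<omega> x * norm (U x - w n x) powr p \<partial>lborel) \<le> e" if e: "0 < e" for e
  proof -
    obtain n0 where n0: "\<And>m n. m \<ge> n0 \<Longrightarrow> n \<ge> n0 \<Longrightarrow> (\<integral>x. \<omega> x * norm (w m x - w n x) powr p \<partial>lborel) \<le> e"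
      using cauchy[OF e] by blast
    have "integrable lborel (\<lambda>x. \<omega> x * norm (U x - w n x) powr p) \<and>
      (\<integral>x. \<omega> x * norm (U x - w n x) powr p \<partial>lborel) \<le> e" if n: "n \<ge> n0" for n
    proof
      have p0: "0 < p" using p by simp
      note * = integral_powr_le_of_AE_limit[where g=w and G=U and \<omega>=\<omega> and h="w n" and ?n0.0=n0 and e=e,
          OF w U \<omega> p0 lim wd w n0[OF _ n]]
      show "integrable lborel (\<lambda>x. \<omega> x * norm (U x - w n x) powr p)" by (rule *(1))
      show "(\<integral>x. \<omega> x * norm (U x - w n x) powr p \<partial>lborel) \<le> e" by (rule *(2))
    qed
    then show ?thesis by blast
  qed
  obtain n1 where "integrable lborel (\<lambda>x. \<omega> x * norm (U x - w n1 x) powr p)" using le[OF zero_less_one] by blast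
  then have "integrable lborel (\<lambda>x. \<omega> x * norm ((U x - w n1 x) + w n1 x) powr p)"
    by (intro integrable_powr_add p \<omega> int) measurable
  then show iU: "integrable lborel (\<lambda>x. \<omega> x * norm (U x) powr p)" by simp
  show "integrable lborel (\<lambda>x. \<omega> x * norm (U x - w n x) powr p)" for n
    by (intro diff w U iU int)
  show "(\<lambda>n. \<integral>x. \<omega> x * norm (U x - w n x) powr p \<partial>lborel) \<longlonglongrightarrow> 0"
  proof (rule tendstoI)
    fix e :: real assume e: "0 < e"
    obtain n0 where n0: "\<And>n. n \<ge> n0 \<Longrightarrow> (\<integral>x. \<omega> x * norm (U x - w n x) powr p \<partial>lborel) \<le> e / 2"
      using le[of "e / 2"] e by auto
    have "dist (\<integral>x. \<omega> x * norm (U x - w n x) powr p \<partial>lborel) 0 < e" if "n \<ge> n0" for n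
    proof -
      have "0 \<le> (\<integral>x. \<omega> x * norm (U x - w n x) powr p \<partial>lborel)"
        by (rule integral_nonneg_AE) (simp add: \<omega>(2))
      then show ?thesis using n0[OF that] e by (simp add: dist_real_def)
    qed
    then show "eventually (\<lambda>n. dist (\<integral>x. \<omega> x * norm (U x - w n x) powr p \<partial>lborel) 0 < e) sequentially"
      by (auto simp: eventually_sequentially)
  qed
qed

section \<open>The minimiser and its Euler-Lagrange equation\<close>

lemma weight_nonneg: "0 \<le> 1 / norm (x::'a::euclidean_space) powr \<tau>"
  by simp

lemma weight_measurable: "(\<lambda>x::'a::euclidean_space. 1 / norm x powr \<tau>) \<in> borel_measurable borel"
  by measurable

lemma weight_form: "1 / norm (x::'a::euclidean_space) powr \<tau> * norm (s::real) powr p = \<bar>s\<bar> powr p / norm x powr \<tau>"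
  by simp

lemma one_form: "1 * norm (y::'a::euclidean_space) powr 2 = (norm y)\<^sup>2"
  by simp

lemma double_eventually_subseq:
  fixes P :: "nat \<Rightarrow> nat \<Rightarrow> bool" and g :: "nat \<Rightarrow> nat"
  assumes g: "strict_mono g" and ex: "\<exists>n0. \<forall>m\<ge>n0. \<forall>n\<ge>n0. P m n"
  shows "\<exists>n0. \<forall>m\<ge>n0. \<forall>n\<ge>n0. P (g m) (g n)"
proof -
  obtain n0 where n0: "\<And>m n. n0 \<le> m \<Longrightarrow> n0 \<le> n \<Longrightarrow> P m n" using ex by blast
  have "n0 \<le> g m" if "n0 \<le> m" for m by (rule order_trans[OF that seq_suble[OF g]])
  then show ?thesis using n0 by blast
qed

text \<open>
  The minimiser \<open>U\<close> with its weak gradient \<open>G\<close> need not belong to \<open>D\<close>. It is kept together with an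
  approximating sequence \<open>w\<close> in \<open>D\<close>, which converges in all three terms of the action as well as almost
  everywhere.
\<close>

locale minimizer = minimization b q \<eta> r \<delta> c D
  for b q \<eta> r \<delta> c and D :: "('a::euclidean_space \<Rightarrow> real) set" +
  fixes U :: "'a \<Rightarrow> real" and G :: "'a \<Rightarrow> 'a" and w :: "nat \<Rightarrow> 'a \<Rightarrow> real"
  assumes w: "\<And>n. w n \<in> D" and U: "U \<in> borel_measurable borel" and G: "G \<in> borel_measurable borel"
    and limU: "AE x in lborel. (\<lambda>n. w n x) \<longlonglongrightarrow> U x"
    and limG: "AE x in lborel. (\<lambda>n. gradient (w n) x) \<longlonglongrightarrow> G x"
    and intQ: "integrable lborel (\<lambda>x. \<bar>U x\<bar> powr q / norm x powr b)"
    and intB: "integrable lborel (\<lambda>x. \<bar>U x\<bar> powr r / norm x powr \<eta>)"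
    and intG: "integrable lborel (\<lambda>x. (norm (G x))\<^sup>2)"
    and dQ: "\<And>n. integrable lborel (\<lambda>x. \<bar>U x - w n x\<bar> powr q / norm x powr b)"
    and dB: "\<And>n. integrable lborel (\<lambda>x. \<bar>U x - w n x\<bar> powr r / norm x powr \<eta>)"
    and dG: "\<And>n. integrable lborel (\<lambda>x. (norm (G x - gradient (w n) x))\<^sup>2)"
    and limQ: "(\<lambda>n. weighted_power b q (\<lambda>x. U x - w n x)) \<longlonglongrightarrow> 0"
    and limB: "(\<lambda>n. weighted_power \<eta> r (\<lambda>x. U x - w n x)) \<longlonglongrightarrow> 0"
    and limD: "(\<lambda>n. dirichlet (\<lambda>x. G x - gradient (w n) x)) \<longlonglongrightarrow> 0"
    and limJ: "(\<lambda>n. action b q \<eta> r (w n) (gradient (w n))) \<longlonglongrightarrow> minimization.level b q \<eta> r D"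

text \<open>
  Completeness is applied twice, once to the functions and once to their gradients along the
  subsequence already chosen.
\<close>

lemma (in minimization) minimizer_exists: "\<exists>U G w. minimizer b q \<eta> r \<delta> c D U G w"
proof -
  obtain u K where u: "\<And>n. u n \<in> D" and K: "0 \<le> K" "\<And>n. E (u n) \<le> K" "\<And>n. Q (u n) \<le> K"
    and J: "(\<lambda>n. J (u n)) \<longlonglongrightarrow> level" and cB: "\<And>e. 0 < e \<Longrightarrow> \<exists>n0. \<forall>m\<ge>n0. \<forall>n\<ge>n0. B (\<lambda>x. u m x - u n x) \<le> e"
    using minimizing_sequence by blast
  have cEQ: "\<exists>n0. \<forall>m\<ge>n0. \<forall>n\<ge>n0. E (\<lambda>x. u m x - u n x) \<le> e \<and> Q (\<lambda>x. u m x - u n x) \<le> e" if "0 < e" for e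
    by (rule minimizing_sequence_cauchy[OF u K(2,3) J cB that])
  have tu: "test_function (u n)" for n by (rule D_test[OF u])
  have td: "test_function (\<lambda>x. u m x - u n x)" for m n by (rule test_function_diff[OF tu tu])
  have grad_diff: "dirichlet (\<lambda>x. gradient (u m) x - gradient (u n) x) = E (\<lambda>x. u m x - u n x)" for m n
    by (simp add: dirichlet_def gradient_diff[OF tu tu])
  have cE: "\<exists>n0. \<forall>m\<ge>n0. \<forall>n\<ge>n0. (\<integral>x. (norm (gradient (u m) x - gradient (u n) x))\<^sup>2 \<partial>lborel) \<le> e" if e: "0 < e" for e
  proof -
    obtain n0 where n0: "\<And>m n. n0 \<le> m \<Longrightarrow> n0 \<le> n \<Longrightarrow> E (\<lambda>x. u m x - u n x) \<le> e" using cEQ[OF e] by blast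
    show ?thesis
    proof (intro exI[of _ n0] allI impI)
      fix m n assume "n0 \<le> m" "n0 \<le> n"
      then have "dirichlet (\<lambda>x. gradient (u m) x - gradient (u n) x) \<le> e" unfolding grad_diff by (rule n0)
      then show "(\<integral>x. (norm (gradient (u m) x - gradient (u n) x))\<^sup>2 \<partial>lborel) \<le> e" unfolding dirichlet_def .
    qed
  qed
  have "\<exists>f :: nat \<Rightarrow> nat. strict_mono f \<and> (AE x in lborel. convergent (\<lambda>n. u (f n) x))"
  proof (rule AE_convergent_subsequence[where g=u and \<omega>="\<lambda>x. 1 / norm x powr b" and p=q, unfolded weight_form])
    show "AE x in lborel. 0 < 1 / norm (x::'a) powr b"
      using AE_lborel_singleton[of "0::'a"] by eventually_elim simp
    show "integrable lborel (\<lambda>x. \<bar>u m x - u n x\<bar> powr q / norm x powr b)" for m n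
      by (rule integrable_Q[OF td])
    show "\<exists>n0. \<forall>m\<ge>n0. \<forall>n\<ge>n0. (\<integral>x. \<bar>u m x - u n x\<bar> powr q / norm x powr b \<partial>lborel) \<le> e" if "0 < e" for e
      using cEQ[OF that] unfolding weighted_power_def by blast
  qed (use borel_measurable_test_function[OF tu] weight_measurable r in auto)
  then obtain f1 :: "nat \<Rightarrow> nat" where f1: "strict_mono f1" "AE x in lborel. convergent (\<lambda>n. u (f1 n) x)" by blast
  have "\<exists>f :: nat \<Rightarrow> nat. strict_mono f \<and> (AE x in lborel. convergent (\<lambda>n. gradient (u (f1 (f n))) x))"
  proof (rule AE_convergent_subsequence[where \<omega>="\<lambda>x. 1" and p=2 and g="\<lambda>n. gradient (u (f1 n))", unfolded one_form])
    show "integrable lborel (\<lambda>x. (norm (gradient (u (f1 m)) x - gradient (u (f1 n)) x))\<^sup>2)" for m n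
      unfolding gradient_diff[OF tu tu, symmetric] by (rule integrable_test_dirichlet(1)[OF td])
    show "\<exists>n0. \<forall>m\<ge>n0. \<forall>n\<ge>n0. (\<integral>x. (norm (gradient (u (f1 m)) x - gradient (u (f1 n)) x))\<^sup>2 \<partial>lborel) \<le> e" if "0 < e" for e
    proof (rule double_eventually_subseq[where P="\<lambda>m n. (\<integral>x. (norm (gradient (u m) x - gradient (u n) x))\<^sup>2 \<partial>lborel) \<le> e", OF f1(1)])
      show "\<exists>n0. \<forall>m\<ge>n0. \<forall>n\<ge>n0. (\<integral>x. (norm (gradient (u m) x - gradient (u n) x))\<^sup>2 \<partial>lborel) \<le> e"
        by (rule cE[OF that])
    qed
  qed (use borel_measurable_test_function[OF tu] in auto)
  then obtain f2 :: "nat \<Rightarrow> nat" where f2: "strict_mono f2" "AE x in lborel. convergent (\<lambda>n. gradient (u (f1 (f2 n))) x)" by blast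
  define f where "f = f1 \<circ> f2"
  have f: "strict_mono f" unfolding f_def by (rule strict_mono_o[OF f1(1) f2(1)])
  define w where "w n = u (f n)" for n
  have w: "w n \<in> D" for n by (simp add: w_def u)
  note tw = D_test[OF w]
  note mw = borel_measurable_test_function[OF tw]
  define U where "U x = lim (\<lambda>n. w n x)" for x
  define G where "G x = lim (\<lambda>n. gradient (w n) x)" for x
  have U: "U \<in> borel_measurable borel" unfolding U_def[abs_def] by (rule borel_measurable_lim_metric) (rule mw)
  have G: "G \<in> borel_measurable borel" unfolding G_def[abs_def] by (rule borel_measurable_lim_metric) (rule mw)
  have limU: "AE x in lborel. (\<lambda>n. w n x) \<longlonglongrightarrow> U x"
    using f1(2)
  proof eventually_elim
    case (elim x)
    have "convergent (\<lambda>n. w n x)"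
      using convergent_subseq_convergent[OF elim f2(1)] by (simp add: w_def f_def comp_def)
    then show ?case by (simp add: U_def convergent_LIMSEQ_iff)
  qed
  have limG: "AE x in lborel. (\<lambda>n. gradient (w n) x) \<longlonglongrightarrow> G x"
    using f2(2) by eventually_elim (simp add: G_def w_def f_def convergent_LIMSEQ_iff)
  have cQ: "\<exists>n0. \<forall>m\<ge>n0. \<forall>n\<ge>n0. (\<integral>x. \<bar>w m x - w n x\<bar> powr q / norm x powr b \<partial>lborel) \<le> e" if "0 < e" for e
    unfolding w_def by (rule double_eventually_subseq[where P="\<lambda>m n. (\<integral>x. \<bar>u m x - u n x\<bar> powr q / norm x powr b \<partial>lborel) \<le> e", OF f])
      (use cEQ[OF that] in \<open>unfold weighted_power_def, blast\<close>)
  have cB': "\<exists>n0. \<forall>m\<ge>n0. \<forall>n\<ge>n0. (\<integral>x. \<bar>w m x - w n x\<bar> powr r / norm x powr \<eta> \<partial>lborel) \<le> e" if "0 < e" for e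
    unfolding w_def by (rule double_eventually_subseq[where P="\<lambda>m n. (\<integral>x. \<bar>u m x - u n x\<bar> powr r / norm x powr \<eta> \<partial>lborel) \<le> e", OF f])
      (use cB[OF that] in \<open>unfold weighted_power_def, blast\<close>)
  have cG: "\<exists>n0. \<forall>m\<ge>n0. \<forall>n\<ge>n0. (\<integral>x. (norm (gradient (w m) x - gradient (w n) x))\<^sup>2 \<partial>lborel) \<le> e" if "0 < e" for e
    unfolding w_def
  proof (rule double_eventually_subseq[where P="\<lambda>m n. (\<integral>x. (norm (gradient (u m) x - gradient (u n) x))\<^sup>2 \<partial>lborel) \<le> e", OF f])
    show "\<exists>n0. \<forall>m\<ge>n0. \<forall>n\<ge>n0. (\<integral>x. (norm (gradient (u m) x - gradient (u n) x))\<^sup>2 \<partial>lborel) \<le> e"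
      by (rule cE[OF that])
  qed
  have q1: "1 \<le> q" and r1: "1 \<le> r" using r by auto
  note Qs = powr_integral_limit[where w=w and U=U and \<omega>="\<lambda>x. 1 / norm x powr b" and p=q,
      OF q1 mw(1) U weight_measurable weight_nonneg limU, unfolded weight_form, OF integrable_Q[OF tw] cQ]
  note Bs = powr_integral_limit[where w=w and U=U and \<omega>="\<lambda>x. 1 / norm x powr \<eta>" and p=r,
      OF r1 mw(1) U weight_measurable weight_nonneg limU, unfolded weight_form, OF integrable_B[OF tw] cB']
  note Gs = powr_integral_limit[where w="\<lambda>n. gradient (w n)" and U=G and \<omega>="\<lambda>x. 1" and p=2,
      OF _ mw(2) G _ _ limG, unfolded one_form, OF _ _ _ integrable_test_dirichlet(1)[OF tw] cG, simplified]
  have "(\<lambda>n. J (w n)) \<longlonglongrightarrow> level"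
    using LIMSEQ_subseq_LIMSEQ[OF J f] by (simp add: w_def comp_def)
  then have "minimizer b q \<eta> r \<delta> c D U G w"
    by (intro minimizer.intro minimizer_axioms.intro minimization_axioms)
      (use w U G limU limG Qs Bs Gs in \<open>simp_all add: weighted_power_def dirichlet_def\<close>)
  then show ?thesis by blast
qed

context minimizer
begin

lemma test_function_w: "test_function (w n)" by (rule D_test[OF w])

lemma integrable_pairing_square:
  fixes g h :: "'a \<Rightarrow> 'a"
  assumes [measurable]: "g \<in> borel_measurable borel" "h \<in> borel_measurable borel"
    and "integrable lborel (\<lambda>x. (norm (g x))\<^sup>2)" "integrable lborel (\<lambda>x. (norm (h x))\<^sup>2)"
  shows "integrable lborel (\<lambda>x. g x \<bullet> h x)"
proof (rule Bochner_Integration.integrable_bound)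
  show "integrable lborel (\<lambda>x. ((norm (g x))\<^sup>2 + (norm (h x))\<^sup>2) / 2)"
    by (intro integrable_divide Bochner_Integration.integrable_add assms)
  show "AE x in lborel. norm (g x \<bullet> h x) \<le> norm (((norm (g x))\<^sup>2 + (norm (h x))\<^sup>2) / 2)"
  proof (intro AE_I2)
    fix x
    have "\<bar>g x \<bullet> h x\<bar> \<le> norm (g x) * norm (h x)" by (rule Cauchy_Schwarz_ineq2)
    also have "\<dots> \<le> ((norm (g x))\<^sup>2 + (norm (h x))\<^sup>2) / 2"
      using sum_squares_bound[of "norm (g x)" "norm (h x)"] by simp
    finally show "norm (g x \<bullet> h x) \<le> norm (((norm (g x))\<^sup>2 + (norm (h x))\<^sup>2) / 2)" by simp
  qed
qed measurable

text \<open>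
  Since \<open>w + t v\<close> stays in \<open>D\<close> for \<open>v \<in> D\<close>, this carries the minimality from the members of \<open>D\<close> over to the
  perturbations of the limit.
\<close>

lemma action_limit:
  assumes tv: "test_function v"
  shows "(\<lambda>n. J (\<lambda>x. w n x + t * v x)) \<longlonglongrightarrow> action b q \<eta> r (\<lambda>x. U x + t * v x) (\<lambda>x. G x + t *\<^sub>R gradient v x)"
    and "integrable lborel (\<lambda>x. \<bar>U x + t * v x\<bar> powr q / norm x powr b)"
    and "integrable lborel (\<lambda>x. \<bar>U x + t * v x\<bar> powr r / norm x powr \<eta>)"
proof -
  note ttv = test_function_cmult[OF tv, of t]
  note [measurable] = U G borel_measurable_test_function[OF tv] borel_measurable_test_function[OF test_function_w] weight_measurable
  have tws: "test_function (\<lambda>x. w n x + t * v x)" for n by (rule test_function_add[OF test_function_w ttv])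
  have q1: "1 \<le> q" and r1: "1 \<le> r" using r by auto
  show iQ: "integrable lborel (\<lambda>x. \<bar>U x + t * v x\<bar> powr q / norm x powr b)"
    by (rule integrable_powr_add[where 'b=real and \<omega>="\<lambda>x. 1 / norm x powr b", OF q1 _ _ weight_measurable weight_nonneg, unfolded weight_form])
      (use intQ integrable_Q[OF ttv] in auto)
  show iB: "integrable lborel (\<lambda>x. \<bar>U x + t * v x\<bar> powr r / norm x powr \<eta>)"
    by (rule integrable_powr_add[where 'b=real and \<omega>="\<lambda>x. 1 / norm x powr \<eta>", OF r1 _ _ weight_measurable weight_nonneg, unfolded weight_form])
      (use intB integrable_B[OF ttv] in auto)
  have gt: "gradient (\<lambda>x. w n x + t * v x) x = gradient (w n) x + t *\<^sub>R gradient v x" for n x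
    using gradient_lincomb[OF test_function_w tv, of 1 n t x] by simp
  have iG: "integrable lborel (\<lambda>x. (norm (G x + t *\<^sub>R gradient v x))\<^sup>2)"
  proof -
    have "integrable lborel (\<lambda>x. 1 * norm (G x + t *\<^sub>R gradient v x) powr 2)"
      by (rule integrable_powr_add) (use intG integrable_test_dirichlet(1)[OF tv] in \<open>auto simp: power_mult_distrib\<close>)
    then show ?thesis by simp
  qed
  have "(\<lambda>n. Q (\<lambda>x. w n x + t * v x)) \<longlonglongrightarrow> Q (\<lambda>x. U x + t * v x)"
    unfolding weighted_power_def
    by (rule powr_integral_tendsto[where 'b=real and \<omega>="\<lambda>x. 1 / norm x powr b", OF q1 weight_nonneg, unfolded weight_form])
      (use integrable_Q[OF tws] iQ dQ limQ in \<open>simp_all add: weighted_power_def\<close>)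
  moreover have "(\<lambda>n. B (\<lambda>x. w n x + t * v x)) \<longlonglongrightarrow> B (\<lambda>x. U x + t * v x)"
    unfolding weighted_power_def
    by (rule powr_integral_tendsto[where 'b=real and \<omega>="\<lambda>x. 1 / norm x powr \<eta>", OF r1 weight_nonneg, unfolded weight_form])
      (use integrable_B[OF tws] iB dB limB in \<open>simp_all add: weighted_power_def\<close>)
  moreover have "(\<lambda>n. E (\<lambda>x. w n x + t * v x)) \<longlonglongrightarrow> dirichlet (\<lambda>x. G x + t *\<^sub>R gradient v x)"
    unfolding dirichlet_def gt
    by (rule powr_integral_tendsto[where 'b='a and \<omega>="\<lambda>x. 1" and p=2, unfolded one_form])
      (use integrable_test_dirichlet(1)[OF tws] iG dG limD in \<open>simp_all add: dirichlet_def gt\<close>)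
  ultimately show "(\<lambda>n. J (\<lambda>x. w n x + t * v x)) \<longlonglongrightarrow> action b q \<eta> r (\<lambda>x. U x + t * v x) (\<lambda>x. G x + t *\<^sub>R gradient v x)"
    unfolding action_def using r by (intro tendsto_intros) auto
qed

lemma action_eq_level: "action b q \<eta> r U G = level"
proof -
  have "(\<lambda>n. J (w n)) \<longlonglongrightarrow> action b q \<eta> r U G"
    using action_limit(1)[OF test_function_w[of 0], of 0] by simp
  then show ?thesis using limJ LIMSEQ_unique by blast
qed

lemma level_le_action:
  assumes v: "v \<in> D"
  shows "level \<le> action b q \<eta> r (\<lambda>x. U x + t * v x) (\<lambda>x. G x + t *\<^sub>R gradient v x)"
proof (rule LIMSEQ_le_const[OF action_limit(1)[OF D_test[OF v]]])
  have "(\<lambda>x. w n x + t * v x) \<in> D" for n using D_lin[OF w[of n] v, of 1 t] by simp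
  then show "\<exists>N. \<forall>n\<ge>N. level \<le> J (\<lambda>x. w n x + t * v x)" using level_le by blast
qed

definition "pairing v = (\<integral>x. G x \<bullet> gradient v x \<partial>lborel) + (\<integral>x. \<bar>U x\<bar> powr (q - 2) * U x * v x / norm x powr b \<partial>lborel)
   - (\<integral>x. \<bar>U x\<bar> powr (r - 2) * U x * v x / norm x powr \<eta> \<partial>lborel)"

lemma pairing_integrable:
  assumes tv: "test_function v"
  shows "integrable lborel (\<lambda>x. G x \<bullet> gradient v x)"
    and "integrable lborel (\<lambda>x. \<bar>U x\<bar> powr (q - 2) * U x * v x / norm x powr b)"
    and "integrable lborel (\<lambda>x. \<bar>U x\<bar> powr (r - 2) * U x * v x / norm x powr \<eta>)"
proof -
  have vm: "v \<in> borel_measurable borel" by (rule borel_measurable_test_function[OF tv])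
  have form: "1 / norm (x::'a) powr \<tau> * y = y / norm x powr \<tau>" for x \<tau> y by simp
  have q1: "1 < q" using r by simp
  show "integrable lborel (\<lambda>x. G x \<bullet> gradient v x)"
    by (intro integrable_pairing_square G borel_measurable_test_function tv intG integrable_test_dirichlet)
  show "integrable lborel (\<lambda>x. \<bar>U x\<bar> powr (q - 2) * U x * v x / norm x powr b)"
    by (rule power_difference_quotient_tendsto(1)[OF q1 U vm weight_measurable weight_nonneg, unfolded form, OF action_limit(2)[OF tv]])
  show "integrable lborel (\<lambda>x. \<bar>U x\<bar> powr (r - 2) * U x * v x / norm x powr \<eta>)"
    by (rule power_difference_quotient_tendsto(1)[OF r(1) U vm weight_measurable weight_nonneg, unfolded form, OF action_limit(3)[OF tv]])
qed

lemma pairing_lincomb: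
  assumes tu: "test_function u" and tv: "test_function v"
  shows "pairing (\<lambda>x. s * u x + t * v x) = s * pairing u + t * pairing v"
proof -
  note iu = pairing_integrable[OF tu] and iv = pairing_integrable[OF tv]
  have lin: "(\<integral>x. s * f x + t * g x \<partial>lborel) = s * (\<integral>x. f x \<partial>lborel) + t * (\<integral>x. g x \<partial>lborel)"
    if "integrable lborel f" "integrable lborel g" for f g :: "'a \<Rightarrow> real"
    using that by simp
  have 1: "(\<integral>x. G x \<bullet> gradient (\<lambda>x. s * u x + t * v x) x \<partial>lborel)
      = s * (\<integral>x. G x \<bullet> gradient u x \<partial>lborel) + t * (\<integral>x. G x \<bullet> gradient v x \<partial>lborel)"
    unfolding lin[OF iu(1) iv(1), symmetric]
    by (simp add: gradient_lincomb[OF tu tv] inner_add_right)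
  have 2: "(\<integral>x. \<bar>U x\<bar> powr (q - 2) * U x * (s * u x + t * v x) / norm x powr b \<partial>lborel)
      = s * (\<integral>x. \<bar>U x\<bar> powr (q - 2) * U x * u x / norm x powr b \<partial>lborel)
      + t * (\<integral>x. \<bar>U x\<bar> powr (q - 2) * U x * v x / norm x powr b \<partial>lborel)"
    unfolding lin[OF iu(2) iv(2), symmetric]
    by (intro Bochner_Integration.integral_cong refl) (simp add: algebra_simps add_divide_distrib)
  have 3: "(\<integral>x. \<bar>U x\<bar> powr (r - 2) * U x * (s * u x + t * v x) / norm x powr \<eta> \<partial>lborel)
      = s * (\<integral>x. \<bar>U x\<bar> powr (r - 2) * U x * u x / norm x powr \<eta> \<partial>lborel)
      + t * (\<integral>x. \<bar>U x\<bar> powr (r - 2) * U x * v x / norm x powr \<eta> \<partial>lborel)"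
    unfolding lin[OF iu(3) iv(3), symmetric]
    by (intro Bochner_Integration.integral_cong refl) (simp add: algebra_simps add_divide_distrib)
  show ?thesis unfolding pairing_def 1 2 3 by (simp add: algebra_simps)
qed

lemma pairing_sum:
  assumes "\<And>m. m \<in> S \<Longrightarrow> test_function (f m)"
  shows "pairing (\<lambda>x. \<Sum>m\<in>S. a m * f m x) = (\<Sum>m\<in>S. a m * pairing (f m))"
  using assms
proof (induction S rule: infinite_finite_induct)
  case (insert m S)
  have "test_function (\<lambda>x. \<Sum>m\<in>S. a m * f m x)"
    by (intro test_function_sum test_function_cmult insert.prems) auto
  from pairing_lincomb[OF insert.prems[of m] this, of "a m" 1] insert show ?case by simp
qed (use pairing_lincomb[OF test_function_w test_function_w, of 0 0 0 0] in simp_all)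

text \<open>
  The right derivative at \<open>t = 0\<close> of the action of \<open>U + t v\<close>, which has a minimum there. Since \<open>D\<close> is a linear
  space, applying this to \<open>v\<close> and to \<open>-v\<close> gives the Euler-Lagrange equation on \<open>D\<close>.
\<close>

lemma pairing_nonneg:
  assumes v: "v \<in> D"
  shows "0 \<le> pairing v"
proof -
  note tv = D_test[OF v]
  note [measurable] = U G borel_measurable_test_function[OF tv] weight_measurable
  define t where "t n = 1 / real (Suc n)" for n
  have t: "0 < t n" for n by (simp add: t_def)
  have t0: "t \<longlonglongrightarrow> 0" using LIMSEQ_inverse_real_of_nat by (simp add: t_def[abs_def] inverse_eq_divide)
  have vm: "v \<in> borel_measurable borel" by (rule borel_measurable_test_function[OF tv])
  have form: "1 / norm (x::'a) powr \<tau> * y = y / norm x powr \<tau>" for x \<tau> y by simp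
  have q1: "1 < q" using r by simp
  have Q: "(\<lambda>n. (Q (\<lambda>x. U x + t n * v x) - Q U) / t n) \<longlonglongrightarrow> q * (\<integral>x. \<bar>U x\<bar> powr (q - 2) * U x * v x / norm x powr b \<partial>lborel)"
    unfolding weighted_power_def t_def
    by (rule power_difference_quotient_tendsto(2)[OF q1 U vm weight_measurable weight_nonneg, unfolded form, OF action_limit(2)[OF tv]])
  have B: "(\<lambda>n. (B (\<lambda>x. U x + t n * v x) - B U) / t n) \<longlonglongrightarrow> r * (\<integral>x. \<bar>U x\<bar> powr (r - 2) * U x * v x / norm x powr \<eta> \<partial>lborel)"
    unfolding weighted_power_def t_def
    by (rule power_difference_quotient_tendsto(2)[OF r(1) U vm weight_measurable weight_nonneg, unfolded form, OF action_limit(3)[OF tv]])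
  note ig = pairing_integrable(1)[OF tv]
  have expand: "dirichlet (\<lambda>x. G x + s *\<^sub>R gradient v x) = dirichlet G + 2 * s * (\<integral>x. G x \<bullet> gradient v x \<partial>lborel) + s\<^sup>2 * E v" for s
  proof -
    have "(norm (G x + s *\<^sub>R gradient v x))\<^sup>2 = (norm (G x))\<^sup>2 + (2 * s) * (G x \<bullet> gradient v x) + s\<^sup>2 * (norm (gradient v x))\<^sup>2" for x
      unfolding power2_norm_eq_inner by (simp add: inner_add_left inner_add_right inner_commute power2_eq_square algebra_simps)
    then show ?thesis unfolding dirichlet_def
      using intG ig integrable_test_dirichlet(1)[OF tv] by simp
  qed
  have D: "(\<lambda>n. (dirichlet (\<lambda>x. G x + t n *\<^sub>R gradient v x) - dirichlet G) / t n) \<longlonglongrightarrow> 2 * (\<integral>x. G x \<bullet> gradient v x \<partial>lborel)"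
  proof -
    have "(dirichlet (\<lambda>x. G x + t n *\<^sub>R gradient v x) - dirichlet G) / t n = 2 * (\<integral>x. G x \<bullet> gradient v x \<partial>lborel) + t n * E v" for n
      using t[of n] unfolding expand by (simp add: field_simps power2_eq_square)
    moreover have "(\<lambda>n. 2 * (\<integral>x. G x \<bullet> gradient v x \<partial>lborel) + t n * E v) \<longlonglongrightarrow> 2 * (\<integral>x. G x \<bullet> gradient v x \<partial>lborel) + 0 * E v"
      by (intro tendsto_intros t0)
    ultimately show ?thesis by simp
  qed
  have "(\<lambda>n. (dirichlet (\<lambda>x. G x + t n *\<^sub>R gradient v x) - dirichlet G) / t n / 2
      + (Q (\<lambda>x. U x + t n * v x) - Q U) / t n / q - (B (\<lambda>x. U x + t n * v x) - B U) / t n / r)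
    \<longlonglongrightarrow> 2 * (\<integral>x. G x \<bullet> gradient v x \<partial>lborel) / 2 + q * (\<integral>x. \<bar>U x\<bar> powr (q - 2) * U x * v x / norm x powr b \<partial>lborel) / q
      - r * (\<integral>x. \<bar>U x\<bar> powr (r - 2) * U x * v x / norm x powr \<eta> \<partial>lborel) / r"
    using r by (intro tendsto_add tendsto_diff tendsto_divide tendsto_const D Q B) auto
  moreover have "2 * (\<integral>x. G x \<bullet> gradient v x \<partial>lborel) / 2 + q * (\<integral>x. \<bar>U x\<bar> powr (q - 2) * U x * v x / norm x powr b \<partial>lborel) / q
      - r * (\<integral>x. \<bar>U x\<bar> powr (r - 2) * U x * v x / norm x powr \<eta> \<partial>lborel) / r = pairing v"
    using r by (simp add: pairing_def)
  ultimately have lim: "(\<lambda>n. (dirichlet (\<lambda>x. G x + t n *\<^sub>R gradient v x) - dirichlet G) / t n / 2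
      + (Q (\<lambda>x. U x + t n * v x) - Q U) / t n / q - (B (\<lambda>x. U x + t n * v x) - B U) / t n / r) \<longlonglongrightarrow> pairing v"
    by (simp only:)
  have nonneg: "0 \<le> (dirichlet (\<lambda>x. G x + t n *\<^sub>R gradient v x) - dirichlet G) / t n / 2
      + (Q (\<lambda>x. U x + t n * v x) - Q U) / t n / q - (B (\<lambda>x. U x + t n * v x) - B U) / t n / r" for n
  proof -
    have "0 \<le> (action b q \<eta> r (\<lambda>x. U x + t n * v x) (\<lambda>x. G x + t n *\<^sub>R gradient v x) - action b q \<eta> r U G) / t n"
      using level_le_action[OF v, of "t n"] action_eq_level t[of n] by simp
    also have "\<dots> = (dirichlet (\<lambda>x. G x + t n *\<^sub>R gradient v x) - dirichlet G) / t n / 2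
      + (Q (\<lambda>x. U x + t n * v x) - Q U) / t n / q - (B (\<lambda>x. U x + t n * v x) - B U) / t n / r"
      unfolding action_def using t[of n] r by (simp add: diff_divide_distrib add_divide_distrib mult.commute)
    finally show ?thesis .
  qed
  show ?thesis by (rule LIMSEQ_le_const[OF lim]) (use nonneg in blast)
qed

lemma pairing_eq_0:
  assumes v: "v \<in> D"
  shows "pairing v = 0"
proof -
  have mv: "(\<lambda>x. - v x) \<in> D" using D_lin[OF v v, of "-1" 0] by simp
  have "gradient (\<lambda>x. - v x) x = - gradient v x" for x
    using gradient_lincomb[OF D_test[OF v] D_test[OF v], of "-1" 0 x] by simp
  then have "pairing (\<lambda>x. - v x) = - pairing v" by (simp add: pairing_def)
  then show ?thesis using pairing_nonneg[OF v] pairing_nonneg[OF mv] by simp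
qed

text \<open>
  On bounded sets each function is dominated by an integrable one: \<open>\<bar>s\<bar> \<le> 1 + \<bar>s\<bar>\<^sup>q\<close> for \<open>U\<close>,
  \<open>2 \<bar>s\<bar> \<le> 1 + \<bar>s\<bar>\<^sup>2\<close> for \<open>G\<close>, and \<open>\<bar>s\<bar>\<^sup>r\<^sup>-\<^sup>1 \<le> 1 + \<bar>s\<bar>\<^sup>r\<close> for the nonlinearity.
\<close>

lemma locally_integrable_limits: "locally_integrable U" "locally_integrable G"
  "locally_integrable (\<lambda>x. \<bar>U x\<bar> powr (r - 2) * U x / norm x powr \<eta>)"
proof -
  note [measurable] = U G
  have cb: "\<exists>M>0. K \<subseteq> cball 0 M" if "compact K" for K :: "'a set"
    using bounded_subset_ballD[OF compact_imp_bounded[OF that], of 0] by (meson ball_subset_cball order_trans)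
  have ib: "integrable lborel (\<lambda>x::'a. k * indicator (cball 0 M) x)" for k M :: real
    using emeasure_lborel_cball_finite[of "0::'a" M]
    by (intro integrable_mult_right integrable_real_indicator) simp_all
  show "locally_integrable U"
    unfolding locally_integrable_def set_integrable_def
  proof (intro conjI allI impI U)
    fix K :: "'a set" assume K: "compact K"
    then have [measurable]: "K \<in> sets borel" by (simp add: borel_compact)
    obtain M where M: "M > 0" "K \<subseteq> cball 0 M" using cb[OF K] by blast
    show "integrable lborel (\<lambda>x. indicat_real K x *\<^sub>R U x)"
    proof (rule Bochner_Integration.integrable_bound)
      show "integrable lborel (\<lambda>x. 1 * indicator (cball 0 M) x + M powr b * (\<bar>U x\<bar> powr q / norm x powr b))"
        by (intro Bochner_Integration.integrable_add ib integrable_mult_right intQ)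
      show "AE x in lborel. norm (indicat_real K x *\<^sub>R U x) \<le> norm (1 * indicator (cball 0 M) x + M powr b * (\<bar>U x\<bar> powr q / norm x powr b))"
        using AE_lborel_singleton[of "0::'a"]
      proof eventually_elim
        case (elim x)
        show ?case
        proof (cases "x \<in> K")
          case True
          then have xM: "norm x \<le> M" using M by auto
          have "norm x powr b \<le> M powr b" using xM b by (intro powr_mono2) auto
          then have "\<bar>U x\<bar> powr q * norm x powr b \<le> \<bar>U x\<bar> powr q * M powr b" by (intro mult_left_mono) auto
          then have "\<bar>U x\<bar> powr q \<le> M powr b * (\<bar>U x\<bar> powr q / norm x powr b)"
            using elim by (simp add: field_simps)
          moreover have "\<bar>U x\<bar> \<le> 1 + \<bar>U x\<bar> powr q" using abs_le_powr_interpolation[of 1 q "U x"] r by simp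
          ultimately show ?thesis using True xM by simp
        qed simp
      qed
    qed measurable
  qed
  show "locally_integrable G"
    unfolding locally_integrable_def set_integrable_def
  proof (intro conjI allI impI G)
    fix K :: "'a set" assume K: "compact K"
    then have [measurable]: "K \<in> sets borel" by (simp add: borel_compact)
    obtain M where M: "M > 0" "K \<subseteq> cball 0 M" using cb[OF K] by blast
    show "integrable lborel (\<lambda>x. indicat_real K x *\<^sub>R G x)"
    proof (rule Bochner_Integration.integrable_bound)
      show "integrable lborel (\<lambda>x. 1 * indicator (cball 0 M) x + (norm (G x))\<^sup>2)"
        by (intro Bochner_Integration.integrable_add ib intG)
      show "AE x in lborel. norm (indicat_real K x *\<^sub>R G x) \<le> norm (1 * indicator (cball 0 M) x + (norm (G x))\<^sup>2)"
      proof (intro AE_I2)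
        fix x
        have "2 * norm (G x) \<le> 1 + (norm (G x))\<^sup>2" using sum_squares_bound[of 1 "norm (G x)"] by simp
        then have "norm (G x) \<le> 1 + (norm (G x))\<^sup>2" using norm_ge_zero[of "G x"] by linarith
        then show "norm (indicat_real K x *\<^sub>R G x) \<le> norm (1 * indicator (cball 0 M) x + (norm (G x))\<^sup>2)"
          using M(2) by (auto simp: indicator_def subset_iff)
      qed
    qed measurable
  qed
  show "locally_integrable (\<lambda>x. \<bar>U x\<bar> powr (r - 2) * U x / norm x powr \<eta>)"
    unfolding locally_integrable_def set_integrable_def
  proof (intro conjI allI impI)
    show m[measurable]: "(\<lambda>x. \<bar>U x\<bar> powr (r - 2) * U x / norm x powr \<eta>) \<in> borel_measurable borel" by measurable
    fix K :: "'a set" assume K: "compact K"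
    then have [measurable]: "K \<in> sets borel" by (simp add: borel_compact)
    obtain M where M: "M > 0" "K \<subseteq> cball 0 M" using cb[OF K] by blast
    show "integrable lborel (\<lambda>x. indicat_real K x *\<^sub>R (\<bar>U x\<bar> powr (r - 2) * U x / norm x powr \<eta>))"
    proof (rule Bochner_Integration.integrable_bound)
      show "integrable lborel (\<lambda>x. indicator (cball 0 M) x * norm x powr (- \<eta>) + \<bar>U x\<bar> powr r / norm x powr \<eta>)"
        by (intro Bochner_Integration.integrable_add integrable_norm_powr_cball intB) (use b in auto)
      show "AE x in lborel. norm (indicat_real K x *\<^sub>R (\<bar>U x\<bar> powr (r - 2) * U x / norm x powr \<eta>))
        \<le> norm (indicator (cball 0 M) x * norm x powr (- \<eta>) + \<bar>U x\<bar> powr r / norm x powr \<eta>)"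
      proof (intro AE_I2)
        fix x
        have "\<bar>U x\<bar> powr (r - 2) * \<bar>U x\<bar> \<le> 1 + \<bar>U x\<bar> powr r"
        proof (cases "\<bar>U x\<bar> \<le> 1")
          case True
          have "\<bar>U x\<bar> powr (r - 2) * \<bar>U x\<bar> \<le> 1"
          proof (cases "U x = 0")
            case False
            then have "\<bar>U x\<bar> powr (r - 2) * \<bar>U x\<bar> = \<bar>U x\<bar> powr (r - 1)" using powr_add[of "\<bar>U x\<bar>" "r - 2" 1] by simp
            also have "\<dots> \<le> 1" using True r by (intro powr_le1) auto
            finally show ?thesis .
          qed simp
          then show ?thesis by (simp add: add_increasing2)
        next
          case False
          then have "\<bar>U x\<bar> powr (r - 2) * \<bar>U x\<bar> = \<bar>U x\<bar> powr (r - 1)" using powr_add[of "\<bar>U x\<bar>" "r - 2" 1] by simp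
          also have "\<dots> \<le> \<bar>U x\<bar> powr r" using False by (intro powr_mono) auto
          finally show ?thesis by simp
        qed
        then have "\<bar>U x\<bar> powr (r - 2) * \<bar>U x\<bar> / norm x powr \<eta> \<le> (1 + \<bar>U x\<bar> powr r) / norm x powr \<eta>"
          by (rule divide_right_mono) simp
        also have "\<dots> = norm x powr (- \<eta>) + \<bar>U x\<bar> powr r / norm x powr \<eta>"
          by (simp add: add_divide_distrib powr_minus_divide)
        finally show "norm (indicat_real K x *\<^sub>R (\<bar>U x\<bar> powr (r - 2) * U x / norm x powr \<eta>))
            \<le> norm (indicator (cball 0 M) x * norm x powr (- \<eta>) + \<bar>U x\<bar> powr r / norm x powr \<eta>)"
          using M(2) by (auto simp: indicator_def subset_iff abs_mult)
      qed
    qed measurable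
  qed
qed

text \<open>
  Integration by parts for the test functions \<open>w n\<close> passes to the limit on both sides by
  \<open>pairing_tendsto_0\<close>.
\<close>

lemma has_weak_gradient_limits: "has_weak_gradient U G"
  unfolding has_weak_gradient_def
proof (intro conjI allI impI ballI locally_integrable_limits(1,2))
  fix v :: "'a \<Rightarrow> real" and i :: 'a
  assume v: "test_function v" and i: "i \<in> Basis"
  note [measurable] = U G borel_measurable_test_function[OF v] borel_measurable_test_function[OF test_function_w]
  obtain M B where MB: "M > 0" "B > 0" "\<And>x. M < norm x \<Longrightarrow> v x = 0" "\<And>x. M < norm x \<Longrightarrow> gradient v x = 0"
    "\<And>x. \<bar>v x\<bar> \<le> B" "\<And>x. norm (gradient v x) \<le> B"
    using test_function_support[OF v] by metis
  have gi: "\<bar>y \<bullet> i\<bar> \<le> norm y" for y by (rule Basis_le_norm[OF i])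
  have form: "1 / norm (x::'a) powr \<tau> * y = y / norm x powr \<tau>" for x \<tau> y by simp
  have q1: "1 < q" using r by simp
  have psi: "(\<lambda>x. gradient v x \<bullet> i) \<in> borel_measurable borel" by measurable
  have b1: "\<bar>gradient v x \<bullet> i\<bar> \<le> B" for x using gi[of "gradient v x"] MB(6)[of x] by linarith
  have b2: "\<forall>x. M < norm x \<longrightarrow> gradient v x \<bullet> i = 0" using MB(4) by simp
  have b3: "\<forall>x. M < norm x \<longrightarrow> v x = 0" using MB(3) by simp
  have C1: "\<forall>x::'a. x \<noteq> 0 \<longrightarrow> norm x \<le> M \<longrightarrow> 1 \<le> M powr b * (1 / norm x powr b)"
    using b by (auto simp: powr_mono2)
  have mU: "(\<lambda>x. U x - w n x) \<in> borel_measurable borel" for n by measurable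
  note A = pairing_tendsto_0[where \<omega>="\<lambda>x. 1 / norm x powr b" and C="M powr b" and f="\<lambda>n x. U x - w n x"
      and \<psi>="\<lambda>x. gradient v x \<bullet> i", OF q1 mU psi b1 b2 weight_nonneg powr_ge_zero C1,
      unfolded form, OF dQ limQ[unfolded weighted_power_def]]
  have mG: "(\<lambda>x. (G x - gradient (w n) x) \<bullet> i) \<in> borel_measurable borel" for n by measurable
  have le2: "1 * \<bar>(G x - gradient (w n) x) \<bullet> i\<bar> powr 2 \<le> (norm (G x - gradient (w n) x))\<^sup>2" for n x
    using power_mono[OF gi[of "G x - gradient (w n) x"], of 2] by simp
  have iG2: "integrable lborel (\<lambda>x. 1 * \<bar>(G x - gradient (w n) x) \<bullet> i\<bar> powr 2)" for n
    by (rule Bochner_Integration.integrable_bound[OF dG[of n]]) (use le2[of _ n] in auto)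
  have lG2: "(\<lambda>n. \<integral>x. 1 * \<bar>(G x - gradient (w n) x) \<bullet> i\<bar> powr 2 \<partial>lborel) \<longlonglongrightarrow> 0"
  proof (rule tendsto_sandwich[OF _ _ tendsto_const limD])
    show "eventually (\<lambda>n. 0 \<le> (\<integral>x. 1 * \<bar>(G x - gradient (w n) x) \<bullet> i\<bar> powr 2 \<partial>lborel)) sequentially"
      by (intro always_eventually allI integral_nonneg_AE AE_I2) simp
    show "eventually (\<lambda>n. (\<integral>x. 1 * \<bar>(G x - gradient (w n) x) \<bullet> i\<bar> powr 2 \<partial>lborel) \<le> dirichlet (\<lambda>x. G x - gradient (w n) x)) sequentially"
      unfolding dirichlet_def by (intro always_eventually allI integral_mono iG2 dG le2)
  qed
  have two: "(1::real) < 2" by simp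
  have vm: "v \<in> borel_measurable borel" by measurable
  note Bp = pairing_tendsto_0[where \<omega>="\<lambda>x. 1" and C=1 and f="\<lambda>n x. (G x - gradient (w n) x) \<bullet> i" and M=M and B=B,
      OF two mG vm MB(5) b3 _ _ _ iG2 lG2, simplified]
  have iA: "integrable lborel (\<lambda>x. w n x * (gradient v x \<bullet> i))" for n
  proof -
    obtain B' where B': "\<And>x. \<bar>w n x\<bar> \<le> B'" using test_function_support[OF test_function_w[of n]] by metis
    show ?thesis
    proof (rule integrable_bounded_support[of _ M "B' * B"])
      show "norm (w n x * (gradient v x \<bullet> i)) \<le> B' * B" for x
        unfolding real_norm_def abs_mult using B'[of x] b1[of x] by (intro mult_mono) auto
    qed (use b2 in auto)
  qed
  have iB: "integrable lborel (\<lambda>x. (gradient (w n) x \<bullet> i) * v x)" for n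
  proof -
    obtain B' where B': "\<And>x. norm (gradient (w n) x) \<le> B'" using test_function_support[OF test_function_w[of n]] by metis
    show ?thesis
    proof (rule integrable_bounded_support[of _ M "B' * B"])
      show "norm ((gradient (w n) x \<bullet> i) * v x) \<le> B' * B" for x
        unfolding real_norm_def abs_mult using order_trans[OF gi B'[of x]] MB(5)[of x] by (intro mult_mono) auto
    qed (use MB in auto)
  qed
  have eA: "(\<integral>x. (U x - w n x) * (gradient v x \<bullet> i) \<partial>lborel)
      = (\<integral>x. U x * (gradient v x \<bullet> i) \<partial>lborel) - (\<integral>x. w n x * (gradient v x \<bullet> i) \<partial>lborel)" for n
  proof -
    have "integrable lborel (\<lambda>x. (U x - w n x) * (gradient v x \<bullet> i) + w n x * (gradient v x \<bullet> i))"
      by (intro Bochner_Integration.integrable_add A(1) iA)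
    then have "integrable lborel (\<lambda>x. U x * (gradient v x \<bullet> i))" by (simp add: algebra_simps)
    then show ?thesis unfolding left_diff_distrib by (rule Bochner_Integration.integral_diff[OF _ iA])
  qed
  have eB: "(\<integral>x. ((G x - gradient (w n) x) \<bullet> i) * v x \<partial>lborel)
      = (\<integral>x. (G x \<bullet> i) * v x \<partial>lborel) - (\<integral>x. (gradient (w n) x \<bullet> i) * v x \<partial>lborel)" for n
  proof -
    have "integrable lborel (\<lambda>x. ((G x - gradient (w n) x) \<bullet> i) * v x + (gradient (w n) x \<bullet> i) * v x)"
      by (intro Bochner_Integration.integrable_add Bp(1) iB)
    then have "integrable lborel (\<lambda>x. (G x \<bullet> i) * v x)" by (simp add: algebra_simps inner_diff_left)
    then show ?thesis unfolding inner_diff_left left_diff_distrib by (rule Bochner_Integration.integral_diff[OF _ iB])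
  qed
  have "(\<lambda>n. (\<integral>x. (U x - w n x) * (gradient v x \<bullet> i) \<partial>lborel) + (\<integral>x. ((G x - gradient (w n) x) \<bullet> i) * v x \<partial>lborel)) \<longlonglongrightarrow> 0 + 0"
    by (intro tendsto_add A(2) Bp(2))
  moreover have "(\<integral>x. (U x - w n x) * (gradient v x \<bullet> i) \<partial>lborel) + (\<integral>x. ((G x - gradient (w n) x) \<bullet> i) * v x \<partial>lborel)
      = (\<integral>x. U x * (gradient v x \<bullet> i) \<partial>lborel) + (\<integral>x. (G x \<bullet> i) * v x \<partial>lborel)" for n
    unfolding eA eB test_function_integration_by_parts[OF test_function_w v] by simp
  ultimately have "(\<integral>x. U x * (gradient v x \<bullet> i) \<partial>lborel) + (\<integral>x. (G x \<bullet> i) * v x \<partial>lborel) = 0"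
    by (simp add: LIMSEQ_const_iff)
  then show "(\<integral>x. U x * (gradient v x \<bullet> i) \<partial>lborel) = - (\<integral>x. (G x \<bullet> i) * v x \<partial>lborel)" by simp
qed

end

section \<open>Rotationally antisymmetric test functions\<close>

definition rot_class :: "'a::euclidean_space \<Rightarrow> 'a \<Rightarrow> real \<Rightarrow> ('a \<Rightarrow> real) set" where
  "rot_class i j \<theta> = {u. test_function u \<and> (\<forall>x. u (rot i j \<theta> x) = - u x)}"

text \<open>
  The sum runs over a full turn, so that a rotation by \<open>\<pi>/k\<close> shifts the summands cyclically; the number of
  summands is even, which makes the signs match.
\<close>

definition antisymmetrize :: "'a::euclidean_space \<Rightarrow> 'a \<Rightarrow> nat \<Rightarrow> ('a \<Rightarrow> real) \<Rightarrow> 'a \<Rightarrow> real" where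
  "antisymmetrize i j k v x = (\<Sum>m<2 * k. (- 1) ^ m * v (rot i j (real m * (pi / real k)) x))"

lemma rot_class_lin: "u \<in> rot_class i j \<theta> \<Longrightarrow> v \<in> rot_class i j \<theta> \<Longrightarrow> (\<lambda>x. s * u x + t * v x) \<in> rot_class i j \<theta>"
  by (auto simp: rot_class_def intro!: test_function_add test_function_cmult)

lemma zero_in_rot_class: "(\<lambda>x. 0) \<in> rot_class i j \<theta>"
  by (auto simp: rot_class_def test_function_iff C_k_const)

context plane
begin

lemma test_function_rot: "test_function v \<Longrightarrow> test_function (\<lambda>x. v (rot i j t x))"
  by (rule test_function_compose_linear[OF linear_rot, of 1]) (simp_all add: norm_rot)

lemma gradient_rot:
  assumes v: "test_function v"
  shows "gradient (\<lambda>x. v (rot i j t x)) x = rot i j (- t) (gradient v (rot i j t x))"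
proof (rule gradient_eqI)
  have "(rot i j t has_derivative rot i j t) (at x)"
    by (intro bounded_linear_imp_has_derivative linear_conv_bounded_linear[THEN iffD1] linear_rot)
  from has_derivative_compose[OF this test_function_has_derivative[OF v]]
  have "((\<lambda>x. v (rot i j t x)) has_derivative (\<lambda>h. gradient v (rot i j t x) \<bullet> rot i j t h)) (at x)" .
  moreover have "gradient v (rot i j t x) \<bullet> rot i j t h = rot i j (- t) (gradient v (rot i j t x)) \<bullet> h" for h
    using rot_inner[of t h "gradient v (rot i j t x)"] by (simp add: inner_commute)
  ultimately show "((\<lambda>x. v (rot i j t x)) has_derivative (\<bullet>) (rot i j (- t) (gradient v (rot i j t x)))) (at x)"
    by simp
qed

lemma gradient_rot_class:
  assumes u: "u \<in> rot_class i j \<theta>"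
  shows "gradient u (rot i j \<theta> x) = - rot i j \<theta> (gradient u x)"
proof -
  have tu: "test_function u" and eq: "(\<lambda>x. u (rot i j \<theta> x)) = (\<lambda>x. - 1 * u x + 0 * u x)"
    using u by (auto simp: rot_class_def)
  have "rot i j (- \<theta>) (gradient u (rot i j \<theta> x)) = - gradient u x"
    using gradient_rot[OF tu, of \<theta> x] gradient_lincomb[OF tu tu, of "- 1" 0 x] unfolding eq by simp
  then have "rot i j \<theta> (rot i j (- \<theta>) (gradient u (rot i j \<theta> x))) = rot i j \<theta> (- gradient u x)" by simp
  then show ?thesis by (simp add: rot_rot rot_0 linear_neg[OF linear_rot])
qed

lemma borel_measurable_rot[measurable]: "rot i j t \<in> borel_measurable borel"
  by (intro borel_measurable_continuous_onI linear_continuous_on linear_conv_bounded_linear[THEN iffD1] linear_rot)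

lemma integral_rot:
  fixes f :: "'a \<Rightarrow> real"
  assumes [measurable]: "f \<in> borel_measurable borel"
  shows "(\<integral>x. f (rot i j t x) \<partial>lborel) = (\<integral>x. f x \<partial>lborel)"
proof -
  have "(\<integral>x. f x \<partial>distr lborel borel (rot i j t)) = (\<integral>x. f (rot i j t x) \<partial>lborel)"
    by (rule integral_distr) auto
  then show ?thesis by (simp add: distr_lborel_orthogonal[OF orthogonal_transformation_rot])
qed

lemma antisymmetrize_in_rot_class:
  assumes k: "0 < k" and v: "test_function v"
  shows "antisymmetrize i j k v \<in> rot_class i j (pi / real k)"
  unfolding rot_class_def
proof (intro CollectI conjI allI)
  show "test_function (antisymmetrize i j k v)"
    unfolding antisymmetrize_def[abs_def] by (intro test_function_sum test_function_cmult test_function_rot v)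
  fix x
  define a where "a m = (- 1) ^ m * v (rot i j (real m * (pi / real k)) x)" for m :: nat
  have "antisymmetrize i j k v (rot i j (pi / real k) x) = (\<Sum>m<2 * k. - a (Suc m))"
  proof -
    have "real m * c + c = real (Suc m) * c" for m and c :: real by (simp add: distrib_right)
    note step = this[of _ "pi / real k"]
    show ?thesis unfolding antisymmetrize_def a_def rot_rot step by (intro sum.cong refl) (simp only: power_Suc mult_minus1 mult_minus_left minus_minus)
  qed
  also have "\<dots> = - (\<Sum>m<2 * k. a (Suc m))" by (rule sum_negf)
  also have "(\<Sum>m<2 * k. a (Suc m)) = (\<Sum>m<Suc (2 * k). a m) - a 0"
    by (subst sum.lessThan_Suc_shift) simp
  also have "\<dots> = (\<Sum>m<2 * k. a m) + a (2 * k) - a 0" by simp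
  also have "a (2 * k) = a 0" using k by (simp add: a_def rot_2pi rot_0)
  finally show "antisymmetrize i j k v (rot i j (pi / real k) x) = - antisymmetrize i j k v x"
    by (simp add: a_def antisymmetrize_def)
qed

lemma rot_class_hardy:
  assumes u: "u \<in> rot_class i j \<theta>" and \<theta>: "0 < \<theta>"
  shows "(\<integral>\<^sup>+x. ennreal ((u x)\<^sup>2 / (norm x)\<^sup>2) \<partial>lborel) \<le> ennreal (\<theta>\<^sup>2 / 4 * dirichlet (gradient u))"
proof -
  have "plane i j" by unfold_locales
  from antisymmetric_hardy[OF this _ \<theta>, of u] u
  have "(\<integral>\<^sup>+x. ennreal ((u x)\<^sup>2 / (norm x)\<^sup>2) \<partial>lborel) \<le> ennreal (\<theta>\<^sup>2 / 4) * ennreal (dirichlet (gradient u))"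
    by (simp add: rot_class_def integrable_test_dirichlet(2))
  also have "\<dots> = ennreal (\<theta>\<^sup>2 / 4 * dirichlet (gradient u))"
    by (rule ennreal_mult[symmetric]) (simp_all add: dirichlet_nonneg)
  finally show ?thesis .
qed

text \<open>
  On the ball of radius \<open>R\<close> the Hardy inequality bounds the integral of \<open>u\<^sup>2\<close> by \<open>R\<^sup>2 \<theta>\<^sup>2/4\<close> times the Dirichlet
  integral. With \<open>C\<close> and \<open>R\<close> fixed, a small angle absorbs this term too.
\<close>

lemma rot_class_absorption:
  assumes b: "0 \<le> b" "b < \<eta>" "\<eta> < real DIM('a)"
    and \<delta>: "q * \<delta> + b = 2 * \<delta> + 2" and r: "1 < r" "r < q" "2 < q"
    and up: "r * (real DIM('a) - 2) < 2 * (real DIM('a) - \<eta>)" and sub: "r * \<delta> + \<eta> < 2 * \<delta> + 2"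
    and low: "q * (real DIM('a) - \<eta>) < r * (real DIM('a) - b)"
    and \<epsilon>: "0 < \<epsilon>"
  shows "\<exists>\<theta>0>0. \<forall>\<theta>. 0 < \<theta> \<longrightarrow> \<theta> < \<theta>0 \<longrightarrow> (\<forall>u\<in>rot_class i j \<theta>.
    weighted_power \<eta> r u \<le> \<epsilon> * (dirichlet (gradient u) + weighted_power b q u) + \<epsilon>)"
proof -
  obtain C R where C: "0 \<le> C" and le: "\<And>(u :: 'a \<Rightarrow> real) H. test_function u \<Longrightarrow> 0 \<le> H \<Longrightarrow>
    (\<integral>\<^sup>+x. ennreal ((u x)\<^sup>2 / (norm x)\<^sup>2) \<partial>lborel) \<le> ennreal H \<Longrightarrow>
    weighted_power \<eta> r u \<le> \<epsilon> * (H + weighted_power b q u) + C * (\<integral>x. indicator (cball 0 R) x * (u x)\<^sup>2 \<partial>lborel) + \<epsilon>"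
    using weighted_power_absorption[OF b \<delta> r up sub low \<epsilon>] by blast
  \<comment> \<open>The total coefficient of the Hardy integral; the angle is chosen so that \<open>\<theta>\<^sup>2 A / 4 \<le> \<epsilon>\<close>.\<close>
  define A where "A = \<epsilon> + C * R\<^sup>2"
  have A: "A > 0" using \<epsilon> C by (simp add: A_def add_pos_nonneg)
  define \<theta>0 where "\<theta>0 = sqrt (4 * \<epsilon> / A)"
  have "weighted_power \<eta> r u \<le> \<epsilon> * (dirichlet (gradient u) + weighted_power b q u) + \<epsilon>"
    if \<theta>: "0 < \<theta>" "\<theta> < \<theta>0" and u: "u \<in> rot_class i j \<theta>" for \<theta> u
  proof -
    have t: "test_function u" using u by (simp add: rot_class_def)
    define H where "H = \<theta>\<^sup>2 / 4 * dirichlet (gradient u)"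
    have H: "0 \<le> H" by (simp add: H_def dirichlet_nonneg)
    have hardy: "(\<integral>\<^sup>+x. ennreal ((u x)\<^sup>2 / (norm x)\<^sup>2) \<partial>lborel) \<le> ennreal H"
      unfolding H_def by (rule rot_class_hardy[OF u \<theta>(1)])
    note h = integral_hardy_le[OF t H hardy]
    have "(\<integral>x. indicator (cball 0 R) x * (u x)\<^sup>2 \<partial>lborel) \<le> (\<integral>x. R\<^sup>2 * ((u x)\<^sup>2 / (norm x)\<^sup>2) \<partial>lborel)"
    proof (rule integral_mono_AE)
      show "integrable lborel (\<lambda>x. indicator (cball 0 R) x * (u x)\<^sup>2)"
        by (rule integrable_test_function(4)[OF t]) simp
      show "integrable lborel (\<lambda>x. R\<^sup>2 * ((u x)\<^sup>2 / (norm x)\<^sup>2))" by (rule integrable_mult_right[OF h(1)])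
      show "AE x in lborel. indicator (cball 0 R) x * (u x)\<^sup>2 \<le> R\<^sup>2 * ((u x)\<^sup>2 / (norm x)\<^sup>2)"
        using AE_lborel_singleton[of "0::'a"]
      proof eventually_elim
        case (elim x)
        show ?case
        proof (cases "x \<in> cball 0 R")
          case True
          have "(norm x)\<^sup>2 * ((u x)\<^sup>2 / (norm x)\<^sup>2) \<le> R\<^sup>2 * ((u x)\<^sup>2 / (norm x)\<^sup>2)"
            using True by (intro mult_right_mono power_mono) auto
          then show ?thesis using True elim by simp
        qed simp
      qed
    qed
    also have "\<dots> = R\<^sup>2 * (\<integral>x. (u x)\<^sup>2 / (norm x)\<^sup>2 \<partial>lborel)" by (rule integral_mult_right_zero)
    also have "\<dots> \<le> R\<^sup>2 * H" by (rule mult_left_mono[OF h(2)]) simp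
    finally have loc: "(\<integral>x. indicator (cball 0 R) x * (u x)\<^sup>2 \<partial>lborel) \<le> R\<^sup>2 * H" .
    have "\<theta>\<^sup>2 \<le> \<theta>0\<^sup>2" using \<theta> by (intro power_mono) auto
    also have "\<theta>0\<^sup>2 = 4 * \<epsilon> / A" using \<epsilon> A by (simp add: \<theta>0_def)
    finally have "\<theta>\<^sup>2 * A \<le> 4 * \<epsilon>" using A by (simp add: le_divide_eq)
    then have "\<theta>\<^sup>2 / 4 * A \<le> \<epsilon>" by simp
    then have "(\<theta>\<^sup>2 / 4 * A) * dirichlet (gradient u) \<le> \<epsilon> * dirichlet (gradient u)"
      by (rule mult_right_mono) (rule dirichlet_nonneg)
    moreover have "(\<theta>\<^sup>2 / 4 * A) * dirichlet (gradient u) = A * H" by (simp add: H_def)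
    ultimately have AH: "A * H \<le> \<epsilon> * dirichlet (gradient u)" by (simp only:)
    have "weighted_power \<eta> r u \<le> \<epsilon> * (H + weighted_power b q u) + C * (R\<^sup>2 * H) + \<epsilon>"
      using le[OF t H hardy] mult_left_mono[OF loc C] by linarith
    also have "\<dots> = A * H + \<epsilon> * weighted_power b q u + \<epsilon>" by (simp add: A_def algebra_simps)
    also have "\<dots> \<le> \<epsilon> * (dirichlet (gradient u) + weighted_power b q u) + \<epsilon>"
      using AH by (simp add: algebra_simps)
    finally show ?thesis .
  qed
  moreover have "\<theta>0 > 0" using \<epsilon> A by (simp add: \<theta>0_def)
  ultimately show ?thesis by blast
qed

lemma rot_basis_neq:
  assumes k: "0 < k" and m: "0 < m" "m < 2 * k"
  shows "rot i j (real m * (pi / real k)) i \<noteq> i"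
proof
  assume "rot i j (real m * (pi / real k)) i = i"
  then have "cos (real m * (pi / real k)) = 1"
    using rot_inner_ij(1)[of "real m * (pi / real k)" i] by (simp add: inner_ij)
  then obtain n :: nat where n: "real m * (pi / real k) = real n * 2 * pi \<or> real m * (pi / real k) = - (real n * 2 * pi)"
    using cos_one_2pi by blast
  have "0 < real m * (pi / real k)" using m k by simp
  moreover have "- (real n * 2 * pi) \<le> 0" by simp
  ultimately have "real m * (pi / real k) = real n * 2 * pi" using n by linarith
  then have "real m = 2 * real n * real k" using k by (simp add: field_simps)
  then have "m = 2 * n * k" by (metis of_nat_eq_iff of_nat_mult of_nat_numeral)
  then show False using m by (cases n) auto
qed

text \<open>
  The nontrivial rotations by multiples of \<open>\<pi>/k\<close> move the basis vector \<open>i\<close>. In the antisymmetrisation of a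
  bump concentrated near \<open>i\<close>, only the unrotated bump is nonzero at \<open>i\<close>.
\<close>

lemma exists_nonzero_rot_class:
  assumes k: "0 < k"
  obtains \<phi> where "\<phi> \<in> rot_class i j (pi / real k)" "\<phi> i > 0"
proof -
  define F where "F = (\<lambda>m. rot i j (real m * (pi / real k)) i) ` {m. 0 < m \<and> m < 2 * k}"
  have "finite F" by (simp add: F_def)
  then have "open (- F)" by (simp add: finite_imp_closed open_Compl)
  moreover have "i \<in> - F"
  proof
    assume "i \<in> F"
    then obtain m where "0 < m" "m < 2 * k" "i = rot i j (real m * (pi / real k)) i" unfolding F_def by blast
    then show False using rot_basis_neq[OF k, of m] by metis
  qed
  ultimately obtain e where e: "e > 0" "ball i e \<subseteq> - F" by (meson open_contains_ball)
  obtain l u where lu: "i \<in> box l u" "box l u \<subseteq> ball i e" using rational_boxes[OF e(1), of i] by metis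
  define \<phi> where "\<phi> = antisymmetrize i j k (box_bump l u 1)"
  have "\<phi> i = (\<Sum>m\<in>{0}. (- 1) ^ m * box_bump l u 1 (rot i j (real m * (pi / real k)) i))"
    unfolding \<phi>_def antisymmetrize_def
  proof (rule sum.mono_neutral_right)
    show "\<forall>m\<in>{..<2 * k} - {0}. (- 1) ^ m * box_bump l u 1 (rot i j (real m * (pi / real k)) i) = 0"
    proof
      fix m assume m: "m \<in> {..<2 * k} - {0}"
      then have "rot i j (real m * (pi / real k)) i \<in> F" by (auto simp: F_def)
      then have "rot i j (real m * (pi / real k)) i \<notin> box l u" using e lu by auto
      then show "(- 1) ^ m * box_bump l u 1 (rot i j (real m * (pi / real k)) i) = 0" by (simp add: box_bump_outside)
    qed
  qed (use k in auto)
  also have "\<dots> > 0" using box_bump_pos[OF zero_less_one lu(1)] by (simp add: rot_0)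
  finally have "\<phi> i > 0" .
  moreover have "\<phi> \<in> rot_class i j (pi / real k)"
    unfolding \<phi>_def by (intro antisymmetrize_in_rot_class k test_function_box_bump) simp
  ultimately show ?thesis using that by blast
qed

lemma dilation_in_rot_class:
  assumes u: "u \<in> rot_class i j \<theta>" and t: "0 < t"
  shows "(\<lambda>x. s * u (t *\<^sub>R x)) \<in> rot_class i j \<theta>"
proof -
  have tu: "test_function u" using u by (simp add: rot_class_def)
  have "test_function (\<lambda>x. u (t *\<^sub>R x))"
    by (rule test_function_compose_linear[of "\<lambda>x. t *\<^sub>R x" t])
      (use t tu in \<open>auto intro!: linearI simp: scaleR_right_distrib\<close>)
  then have "test_function (\<lambda>x. s * u (t *\<^sub>R x))" by (rule test_function_cmult)
  moreover have "u (t *\<^sub>R rot i j \<theta> x) = - u (t *\<^sub>R x)" for x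
    using u linear_cmul[OF linear_rot, of \<theta> t x] by (simp add: rot_class_def flip: linear_cmul[OF linear_rot])
  ultimately show ?thesis by (simp add: rot_class_def)
qed

end

text \<open>
  For \<open>p = q\<close>, \<open>\<tau> = b\<close> and \<open>q \<delta> + b = 2 \<delta> + 2\<close> the exponent equals the one in \<open>dirichlet_dilation\<close>.
\<close>

lemma weighted_power_dilation:
  fixes u :: "'a::euclidean_space \<Rightarrow> real"
  assumes u: "u \<in> borel_measurable borel" and t: "0 < t"
  shows "weighted_power \<tau> p (\<lambda>x. t powr \<delta> * u (t *\<^sub>R x)) = t powr (p * \<delta> + \<tau> - real DIM('a)) * weighted_power \<tau> p u"
proof -
  have "\<bar>t powr \<delta> * u (t *\<^sub>R x)\<bar> powr p / norm x powr \<tau>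
      = t powr (p * \<delta> + \<tau>) * (\<bar>u (t *\<^sub>R x)\<bar> powr p / norm (t *\<^sub>R x) powr \<tau>)" for x
    using t by (simp add: abs_mult powr_mult powr_powr powr_add mult.commute)
  then have "weighted_power \<tau> p (\<lambda>x. t powr \<delta> * u (t *\<^sub>R x))
      = t powr (p * \<delta> + \<tau>) * (\<integral>x. \<bar>u (t *\<^sub>R x)\<bar> powr p / norm (t *\<^sub>R x) powr \<tau> \<partial>lborel)"
    by (simp only: weighted_power_def integral_mult_right_zero)
  also have "(\<integral>x. \<bar>u (t *\<^sub>R x)\<bar> powr p / norm (t *\<^sub>R x) powr \<tau> \<partial>lborel)
      = t powr (- real DIM('a)) * weighted_power \<tau> p u"
    unfolding weighted_power_def by (rule integral_dilation[OF t borel_measurable_weighted_power[OF u]])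
  finally show ?thesis by (simp add: powr_add[symmetric] powr_diff powr_minus field_simps)
qed

lemma dirichlet_dilation:
  fixes u :: "'a::euclidean_space \<Rightarrow> real"
  assumes u: "test_function u" and t: "0 < t"
  shows "dirichlet (gradient (\<lambda>x. t powr \<delta> * u (t *\<^sub>R x))) = t powr (2 * \<delta> + 2 - real DIM('a)) * dirichlet (gradient u)"
proof -
  note [measurable] = borel_measurable_test_function[OF u]
  have g: "gradient (\<lambda>x. t powr \<delta> * u (t *\<^sub>R x)) x = (t powr \<delta> * t) *\<^sub>R gradient u (t *\<^sub>R x)" for x
  proof (rule gradient_eqI)
    have "((\<lambda>x. u (t *\<^sub>R x)) has_derivative (\<lambda>h. gradient u (t *\<^sub>R x) \<bullet> (t *\<^sub>R h))) (at x)"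
      by (rule has_derivative_compose[where f="\<lambda>x. t *\<^sub>R x", OF _ test_function_has_derivative[OF u]])
        (auto intro!: derivative_eq_intros)
    then have "((\<lambda>x. t powr \<delta> * u (t *\<^sub>R x)) has_derivative (\<lambda>h. t powr \<delta> * (gradient u (t *\<^sub>R x) \<bullet> (t *\<^sub>R h)))) (at x)"
      by (rule has_derivative_mult_right)
    moreover have "(\<lambda>h. t powr \<delta> * (gradient u (t *\<^sub>R x) \<bullet> (t *\<^sub>R h))) = (\<bullet>) ((t powr \<delta> * t) *\<^sub>R gradient u (t *\<^sub>R x))"
      by (auto simp: fun_eq_iff mult.assoc)
    ultimately show "((\<lambda>x. t powr \<delta> * u (t *\<^sub>R x)) has_derivative (\<bullet>) ((t powr \<delta> * t) *\<^sub>R gradient u (t *\<^sub>R x))) (at x)"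
      by simp
  qed
  have m: "(\<lambda>x. (norm (gradient u x))\<^sup>2) \<in> borel_measurable borel" by measurable
  have sq: "(t powr \<delta> * t)\<^sup>2 = t powr (2 * \<delta> + 2)"
  proof -
    have "t powr (\<delta> + 1) = t powr \<delta> * t" using t by (simp add: powr_add)
    moreover have "(\<delta> + 1) + (\<delta> + 1) = 2 * \<delta> + 2" by simp
    ultimately show ?thesis using powr_add[of t "\<delta> + 1" "\<delta> + 1"] by (simp only: power2_eq_square)
  qed
  have "dirichlet (gradient (\<lambda>x. t powr \<delta> * u (t *\<^sub>R x))) = (t powr \<delta> * t)\<^sup>2 * (\<integral>x. (norm (gradient u (t *\<^sub>R x)))\<^sup>2 \<partial>lborel)"
    unfolding dirichlet_def g norm_scaleR power_mult_distrib power2_abs by simp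
  also have "(\<integral>x. (norm (gradient u (t *\<^sub>R x)))\<^sup>2 \<partial>lborel) = t powr (- real DIM('a)) * dirichlet (gradient u)"
    unfolding dirichlet_def by (rule integral_dilation[OF t m])
  also have "(t powr \<delta> * t)\<^sup>2 * (t powr (- real DIM('a)) * dirichlet (gradient u))
    = (t powr (2 * \<delta> + 2) * t powr (- real DIM('a))) * dirichlet (gradient u)" unfolding sq by simp
  also have "t powr (2 * \<delta> + 2) * t powr (- real DIM('a)) = t powr (2 * \<delta> + 2 - real DIM('a))"
    by (simp add: powr_add[symmetric])
  finally show ?thesis .
qed

lemma weighted_power_pos:
  fixes u :: "'a::euclidean_space \<Rightarrow> real"
  assumes u: "test_function u" and \<tau>: "0 \<le> \<tau>" "\<tau> < real DIM('a)" and p: "0 < p" and x0: "u x0 > 0"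
  shows "0 < weighted_power \<tau> p u"
proof (rule ccontr)
  assume "\<not> 0 < weighted_power \<tau> p u"
  then have "weighted_power \<tau> p u = 0" using weighted_power_nonneg[of \<tau> p u] by simp
  then have "AE x in lborel. \<bar>u x\<bar> powr p / norm x powr \<tau> = 0"
    unfolding weighted_power_def
    by (subst (asm) integral_nonneg_eq_0_iff_AE[OF integrable_test_weighted_power[OF u \<tau> p]]) auto
  with AE_lborel_singleton[of "0::'a"] have ae: "AE x in lborel. u x = 0"
    by eventually_elim simp
  have "isCont u x0" using continuous_on_test_function[OF u] by (simp add: continuous_on_eq_continuous_at)
  then have "eventually (\<lambda>x. u x > 0) (nhds x0)"
    using x0 by (intro order_tendstoD(1)[of u "u x0"]) (auto simp: isCont_def tendsto_at_iff_tendsto_nhds)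
  then obtain e where e: "e > 0" "\<And>x. dist x x0 < e \<Longrightarrow> u x > 0" by (auto simp: eventually_nhds_metric)
  have "AE x in lborel. x \<notin> ball x0 e" using ae by eventually_elim (use e(2) in \<open>force simp: dist_commute\<close>)
  then have "ball x0 e \<in> null_sets lborel" by (subst AE_iff_null_sets) auto
  then have "emeasure lborel (ball x0 e) = 0" by (rule null_setsD1)
  then show False using content_ball_pos[OF e(1), of x0] by (simp add: measure_def)
qed

context plane
begin

text \<open>
  The action of the dilate \<open>t\<^sup>\<delta> \<phi>(t x)\<close> is a positive power of \<open>t\<close> times \<open>t\<^sup>\<rho> A - B\<close> with \<open>\<rho> > 0\<close>, which is negative
  for small \<open>t\<close>.
\<close>

lemma exists_negative_action:
  assumes b: "0 \<le> b" "b < \<eta>" "\<eta> < real DIM('a)"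
    and \<delta>: "q * \<delta> + b = 2 * \<delta> + 2" and r: "1 < r" "r < q" "2 < q"
    and sub: "r * \<delta> + \<eta> < 2 * \<delta> + 2" and k: "0 < k"
  shows "\<exists>u\<in>rot_class i j (pi / real k). action b q \<eta> r u (gradient u) < 0"
proof -
  obtain \<phi> where \<phi>: "\<phi> \<in> rot_class i j (pi / real k)" "\<phi> i > 0" using exists_nonzero_rot_class[OF k] by blast
  have t\<phi>: "test_function \<phi>" using \<phi> by (simp add: rot_class_def)
  define N where "N = real DIM('a)"
  define A where "A = dirichlet (gradient \<phi>) / 2 + weighted_power b q \<phi> / q"
  define B where "B = weighted_power \<eta> r \<phi> / r"
  have A: "A \<ge> 0" using r by (simp add: A_def dirichlet_nonneg weighted_power_nonneg)
  have B: "B > 0" using weighted_power_pos[OF t\<phi>, of \<eta> r i] b r \<phi> by (simp add: B_def)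
  define \<rho> where "\<rho> = 2 * \<delta> + 2 - (r * \<delta> + \<eta>)"
  have \<rho>: "\<rho> > 0" using sub by (simp add: \<rho>_def)
  \<comment> \<open>This value of t gives t powr \<rho> A < B; adding 1 to A covers the case A = 0.\<close>
  define t where "t = (B / (A + 1)) powr (1 / \<rho>)"
  have t: "t > 0" using A B by (simp add: t_def)
  have t\<rho>: "t powr \<rho> = B / (A + 1)" using A B \<rho> by (simp add: t_def powr_powr)
  define u where "u x = t powr \<delta> * \<phi> (t *\<^sub>R x)" for x
  have "action b q \<eta> r u (gradient u) = t powr (2 * \<delta> + 2 - N) * dirichlet (gradient \<phi>) / 2
      + t powr (q * \<delta> + b - N) * weighted_power b q \<phi> / q - t powr (r * \<delta> + \<eta> - N) * weighted_power \<eta> r \<phi> / r"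
    unfolding action_def u_def[abs_def] N_def dirichlet_dilation[OF t\<phi> t]
      weighted_power_dilation[OF borel_measurable_test_function(1)[OF t\<phi>] t] ..
  also have "\<dots> = t powr (2 * \<delta> + 2 - N) * A - t powr (r * \<delta> + \<eta> - N) * B"
  proof -
    have "q * \<delta> + b - N = 2 * \<delta> + 2 - N" using \<delta> by simp
    then show ?thesis unfolding A_def B_def by (simp only: distrib_left times_divide_eq_right)
  qed
  also have "t powr (2 * \<delta> + 2 - N) = t powr (r * \<delta> + \<eta> - N) * t powr \<rho>"
  proof -
    have "r * \<delta> + \<eta> - N + \<rho> = 2 * \<delta> + 2 - N" by (simp add: \<rho>_def)
    then show ?thesis by (simp only: powr_add[symmetric])
  qed
  also have "t powr (r * \<delta> + \<eta> - N) * t powr \<rho> * A - t powr (r * \<delta> + \<eta> - N) * B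
    = t powr (r * \<delta> + \<eta> - N) * (B / (A + 1) * A - B)" unfolding t\<rho> by (simp add: algebra_simps)
  also have "B / (A + 1) * A - B = - (B / (A + 1))" using A by (simp add: field_simps)
  also have "t powr (r * \<delta> + \<eta> - N) * - (B / (A + 1)) < 0" using t A B by (simp add: mult_less_0_iff)
  finally have "action b q \<eta> r u (gradient u) < 0" .
  moreover have "u \<in> rot_class i j (pi / real k)" unfolding u_def[abs_def] by (rule dilation_in_rot_class[OF \<phi>(1) t])
  ultimately show ?thesis by blast
qed

text \<open>
  The principle of symmetric criticality. The antisymmetry of \<open>U\<close> and \<open>G\<close> is inherited from the
  approximating sequence, and the invariance of Lebesgue measure moves the rotation from \<open>v\<close> to \<open>U\<close>. So
  each of the \<open>2k\<close> summands of the antisymmetrisation of \<open>v\<close> contributes the same amount.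
\<close>

lemma rot_minimizer_pairing:
  assumes k: "0 < k" and mini: "minimizer b q \<eta> r \<delta> c (rot_class i j (pi / real k)) U G w" and v: "test_function v"
  shows "(\<integral>x. G x \<bullet> gradient v x \<partial>lborel) + (\<integral>x. \<bar>U x\<bar> powr (q - 2) * U x * v x / norm x powr b \<partial>lborel)
    = (\<integral>x. \<bar>U x\<bar> powr (r - 2) * U x * v x / norm x powr \<eta> \<partial>lborel)"
proof -
  interpret minimizer b q \<eta> r \<delta> c "rot_class i j (pi / real k)" U G w by (rule mini)
  note [measurable] = U G
  define \<theta> where "\<theta> = pi / real k"
  have Urot: "AE x in lborel. U (rot i j \<theta> x) = - U x"
  proof -
    have 1: "AE x in lborel. (\<lambda>n. w n (rot i j \<theta> x)) \<longlonglongrightarrow> U (rot i j \<theta> x)"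
    proof -
      have "AE x in distr lborel borel (rot i j \<theta>). (\<lambda>n. w n x) \<longlonglongrightarrow> U x"
        unfolding distr_lborel_orthogonal[OF orthogonal_transformation_rot] by (rule limU)
      then show ?thesis by (rule AE_distrD[rotated]) simp
    qed
    show ?thesis using limU 1
    proof eventually_elim
      case (elim x)
      have "w n (rot i j \<theta> x) = - w n x" for n using w[of n] by (simp add: rot_class_def \<theta>_def)
      then have "(\<lambda>n. - w n x) \<longlonglongrightarrow> U (rot i j \<theta> x)" using elim(2) by simp
      then show ?case using tendsto_minus[OF elim(1)] LIMSEQ_unique by blast
    qed
  qed
  have Grot: "AE x in lborel. G (rot i j \<theta> x) = - rot i j \<theta> (G x)"
  proof -
    have 1: "AE x in lborel. (\<lambda>n. gradient (w n) (rot i j \<theta> x)) \<longlonglongrightarrow> G (rot i j \<theta> x)"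
    proof -
      have "AE x in distr lborel borel (rot i j \<theta>). (\<lambda>n. gradient (w n) x) \<longlonglongrightarrow> G x"
        unfolding distr_lborel_orthogonal[OF orthogonal_transformation_rot] by (rule limG)
      then show ?thesis by (rule AE_distrD[rotated]) simp
    qed
    show ?thesis using limG 1
    proof eventually_elim
      case (elim x)
      have "(\<lambda>n. rot i j \<theta> (gradient (w n) x)) \<longlonglongrightarrow> rot i j \<theta> (G x)"
        unfolding rot_def by (intro tendsto_intros elim(1))
      then have "(\<lambda>n. - rot i j \<theta> (gradient (w n) x)) \<longlonglongrightarrow> - rot i j \<theta> (G x)" by (rule tendsto_minus)
      then have "(\<lambda>n. gradient (w n) (rot i j \<theta> x)) \<longlonglongrightarrow> - rot i j \<theta> (G x)"
        using gradient_rot_class[OF w] by (simp add: \<theta>_def)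
      then show ?case using elim(2) LIMSEQ_unique by blast
    qed
  qed
  have anti: "pairing (\<lambda>x. v (rot i j \<theta> x)) = - pairing v" if v: "test_function v" for v
  proof -
    note [measurable] = borel_measurable_test_function[OF v]
    have g: "(\<integral>x. G x \<bullet> gradient (\<lambda>x. v (rot i j \<theta> x)) x \<partial>lborel) = - (\<integral>x. G x \<bullet> gradient v x \<partial>lborel)"
    proof -
      have "(\<integral>x. G x \<bullet> gradient (\<lambda>x. v (rot i j \<theta> x)) x \<partial>lborel) = (\<integral>x. - (G (rot i j \<theta> x) \<bullet> gradient v (rot i j \<theta> x)) \<partial>lborel)"
      proof (rule integral_cong_AE)
        show "(\<lambda>x. G x \<bullet> gradient (\<lambda>x. v (rot i j \<theta> x)) x) \<in> borel_measurable lborel"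
          unfolding gradient_rot[OF v] by measurable
        show "AE x in lborel. G x \<bullet> gradient (\<lambda>x. v (rot i j \<theta> x)) x = - (G (rot i j \<theta> x) \<bullet> gradient v (rot i j \<theta> x))"
          using Grot
        proof eventually_elim
          case (elim x)
          have "G x \<bullet> gradient (\<lambda>x. v (rot i j \<theta> x)) x = rot i j \<theta> (G x) \<bullet> gradient v (rot i j \<theta> x)"
            unfolding gradient_rot[OF v] by (rule rot_inner[symmetric])
          then show ?case using elim by simp
        qed
      qed measurable
      also have "\<dots> = - (\<integral>x. G (rot i j \<theta> x) \<bullet> gradient v (rot i j \<theta> x) \<partial>lborel)" by simp
      also have "(\<integral>x. G (rot i j \<theta> x) \<bullet> gradient v (rot i j \<theta> x) \<partial>lborel) = (\<integral>x. G x \<bullet> gradient v x \<partial>lborel)"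
        by (rule integral_rot[where f="\<lambda>x. G x \<bullet> gradient v x"]) measurable
      finally show ?thesis .
    qed
    have h: "(\<integral>x. \<bar>U x\<bar> powr (p - 2) * U x * v (rot i j \<theta> x) / norm x powr \<tau> \<partial>lborel)
      = - (\<integral>x. \<bar>U x\<bar> powr (p - 2) * U x * v x / norm x powr \<tau> \<partial>lborel)" for p \<tau> :: real
    proof -
      define f where "f x = \<bar>U x\<bar> powr (p - 2) * U x * v x / norm x powr \<tau>" for x
      have fm[measurable]: "f \<in> borel_measurable borel" unfolding f_def[abs_def] by measurable
      have "(\<integral>x. \<bar>U x\<bar> powr (p - 2) * U x * v (rot i j \<theta> x) / norm x powr \<tau> \<partial>lborel) = (\<integral>x. - f (rot i j \<theta> x) \<partial>lborel)"
      proof (rule integral_cong_AE)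
        show "AE x in lborel. \<bar>U x\<bar> powr (p - 2) * U x * v (rot i j \<theta> x) / norm x powr \<tau> = - f (rot i j \<theta> x)"
          using Urot by eventually_elim (simp add: f_def norm_rot)
      qed measurable
      also have "\<dots> = - (\<integral>x. f x \<partial>lborel)" by (simp add: integral_rot[OF fm])
      finally show ?thesis by (simp add: f_def)
    qed
    show ?thesis unfolding pairing_def g h by simp
  qed
  have power: "pairing (\<lambda>x. v (rot i j (real m * \<theta>) x)) = (- 1) ^ m * pairing v" for m
  proof (induction m)
    case (Suc m)
    have step: "real (Suc m) * \<theta> = real m * \<theta> + \<theta>" by (simp add: distrib_right)
    have "pairing (\<lambda>x. v (rot i j (real (Suc m) * \<theta>) x)) = - pairing (\<lambda>x. v (rot i j (real m * \<theta>) x))"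
      using anti[OF test_function_rot[OF v], of "real m * \<theta>"] unfolding rot_rot step .
    then show ?case unfolding Suc by simp
  qed (simp add: rot_0)
  have "0 = pairing (antisymmetrize i j k v)"
    by (rule pairing_eq_0[OF antisymmetrize_in_rot_class[OF k v], symmetric])
  also have "\<dots> = (\<Sum>m<2 * k. (- 1) ^ m * pairing (\<lambda>x. v (rot i j (real m * \<theta>) x)))"
    unfolding antisymmetrize_def[abs_def] \<theta>_def[symmetric] by (intro pairing_sum test_function_rot v)
  also have "\<dots> = (\<Sum>m<2 * k. pairing v)"
  proof -
    have sq: "(- 1 :: real) ^ m * (- 1) ^ m = 1" for m :: nat by (cases "even m") auto
    show ?thesis unfolding power mult.assoc[symmetric] sq by simp
  qed
  also have "\<dots> = real (2 * k) * pairing v" by simp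
  finally have "pairing v = 0" using k by simp
  then show ?thesis by (simp add: pairing_def)
qed

end

section \<open>Solutions at negative levels\<close>

lemma continuous_on_signed_power:
  fixes r :: real
  assumes r: "1 < r"
  shows "continuous_on A (\<lambda>s::real. \<bar>s\<bar> powr (r - 2) * s)"
proof -
  have "isCont (\<lambda>s::real. \<bar>s\<bar> powr (r - 2) * s) s" for s
  proof (cases "s = 0")
    case False
    then show ?thesis by (intro continuous_intros) auto
  next
    case True
    have "((\<lambda>h. \<bar>h\<bar> powr (r - 1)) \<longlongrightarrow> \<bar>0::real\<bar> powr (r - 1)) (at 0)"
      using r by (intro tendsto_powr' tendsto_intros) auto
    then have "((\<lambda>h::real. \<bar>h\<bar> powr (r - 1)) \<longlongrightarrow> 0) (at 0)" by simp
    moreover have "norm (\<bar>h\<bar> powr (r - 2) * h) \<le> \<bar>h\<bar> powr (r - 1)" for h :: real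
      using powr_add[of "\<bar>h\<bar>" "r - 2" 1] by (cases "h = 0") (simp_all add: abs_mult)
    ultimately have "((\<lambda>h::real. \<bar>h\<bar> powr (r - 2) * h) \<longlongrightarrow> 0) (at 0)"
      by (rule Lim_null_comparison[OF always_eventually, rotated 1, OF _ allI])
    then show ?thesis by (simp add: True isCont_def)
  qed
  then show ?thesis by (intro continuous_at_imp_continuous_on) simp
qed

text \<open>
  The fundamental theorem of calculus; as the interval integral is oriented, no case distinction on the
  sign of \<open>s\<close> occurs.
\<close>

lemma primitive_power_nonlinearity:
  fixes x :: "'a::euclidean_space"
  assumes r: "1 < r"
  shows "primitive (power_nonlinearity \<eta> r) x s = \<bar>s\<bar> powr r / norm x powr \<eta> / r"
proof -
  define F where "F t = \<bar>t\<bar> powr r / r / norm x powr \<eta>" for t :: real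
  have cont: "continuous_on A (power_nonlinearity \<eta> r x)" for A
  proof -
    have "continuous_on A (\<lambda>s::real. (\<bar>s\<bar> powr (r - 2) * s) * inverse (norm x powr \<eta>))"
      by (rule continuous_on_mult_right[OF continuous_on_signed_power[OF r]])
    then show ?thesis by (simp only: power_nonlinearity_def[abs_def] divide_inverse)
  qed
  have deriv: "(F has_vector_derivative power_nonlinearity \<eta> r x t) (at t within A)" for t A
  proof -
    have "((\<lambda>t. inverse (r * norm x powr \<eta>) * \<bar>t\<bar> powr r) has_real_derivative
        inverse (r * norm x powr \<eta>) * (r * (\<bar>t\<bar> powr (r - 2) * t))) (at t)"
      by (rule DERIV_cmult[OF DERIV_abs_powr[OF r]])
    moreover have "(\<lambda>t. inverse (r * norm x powr \<eta>) * \<bar>t\<bar> powr r) = F"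
      by (rule ext) (simp add: F_def divide_inverse mult_ac)
    moreover have "inverse (r * norm x powr \<eta>) * (r * (\<bar>t\<bar> powr (r - 2) * t)) = power_nonlinearity \<eta> r x t"
      using r by (simp add: power_nonlinearity_def divide_inverse mult_ac)
    ultimately have "(F has_real_derivative power_nonlinearity \<eta> r x t) (at t)" by (simp only:)
    then show ?thesis
      unfolding has_real_derivative_iff_has_vector_derivative by (rule has_vector_derivative_at_within)
  qed
  have "(LBINT t=ereal 0..ereal s. power_nonlinearity \<eta> r x t) = F s - F 0"
    by (rule interval_integral_FTC_finite[OF cont deriv])
  then show ?thesis by (simp add: primitive_def F_def)
qed

text \<open>
  The weak gradient in the definitions of solution and energy agrees with the limit \<open>G\<close> of the gradients
  almost everywhere, hence under every integral.
\<close>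

lemma (in plane) rot_minimizer_solution:
  assumes k: "0 < k" and mini: "minimizer b q \<eta> r \<delta> c (rot_class i j (pi / real k)) U G w"
  shows "weak_solution b q (power_nonlinearity \<eta> r) U"
    and "energy b q (power_nonlinearity \<eta> r) U = minimization.level b q \<eta> r (rot_class i j (pi / real k))"
proof -
  interpret minimizer b q \<eta> r \<delta> c "rot_class i j (pi / real k)" U G w by (rule mini)
  note [measurable] = U G
  note wg = weak_gradient_AE[OF has_weak_gradient_limits]
  note [measurable] = wg(2)
  have sq: "AE x in lborel. (norm (weak_gradient U x))\<^sup>2 = (norm (G x))\<^sup>2"
    using wg(1) by eventually_elim simp
  have iwg: "integrable lborel (\<lambda>x. (norm (weak_gradient U x))\<^sup>2)"
    by (subst integrable_cong_AE[OF _ _ sq]) (use intG in \<open>auto intro!: borel_measurable_power borel_measurable_norm\<close>)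
  have E: "U \<in> E_space b q"
    unfolding E_space_def weighted_Lp_def using U intQ has_weak_gradient_limits iwg by auto
  have fU: "power_nonlinearity \<eta> r x (U x) = \<bar>U x\<bar> powr (r - 2) * U x / norm x powr \<eta>" for x
    by (simp add: power_nonlinearity_def)
  show "weak_solution b q (power_nonlinearity \<eta> r) U"
    unfolding weak_solution_def
  proof (intro conjI allI impI E caratheodory_power_nonlinearity r(1))
    show "locally_integrable (\<lambda>x. power_nonlinearity \<eta> r x (U x))"
      unfolding fU by (rule locally_integrable_limits(3))
    fix v :: "'a \<Rightarrow> real" assume v: "test_function v"
    note [measurable] = borel_measurable_test_function[OF v]
    have "(\<integral>x. weak_gradient U x \<bullet> gradient v x \<partial>lborel) = (\<integral>x. G x \<bullet> gradient v x \<partial>lborel)"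
    proof (rule integral_cong_AE)
      show "AE x in lborel. weak_gradient U x \<bullet> gradient v x = G x \<bullet> gradient v x"
        using wg(1) by eventually_elim simp
    qed measurable
    then show "(\<integral>x. weak_gradient U x \<bullet> gradient v x \<partial>lborel)
        + (\<integral>x. \<bar>U x\<bar> powr (q - 2) * U x * v x / norm x powr b \<partial>lborel)
        = (\<integral>x. power_nonlinearity \<eta> r x (U x) * v x \<partial>lborel)"
      using rot_minimizer_pairing[OF k mini v] by (simp add: fU)
  qed
  have "(\<integral>x. (norm (weak_gradient U x))\<^sup>2 \<partial>lborel) = dirichlet G"
    unfolding dirichlet_def by (rule integral_cong_AE[OF _ _ sq]) measurable
  then have "energy b q (power_nonlinearity \<eta> r) U = action b q \<eta> r U G"
    unfolding energy_def action_def weighted_power_def primitive_power_nonlinearity[OF r(1)]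
    by (simp del: divide_divide_eq_left)
  then show "energy b q (power_nonlinearity \<eta> r) U = minimization.level b q \<eta> r (rot_class i j (pi / real k))"
    by (simp add: action_eq_level)
qed

text \<open>
  A monotone subsequence exists in any case, and a nonincreasing one would have its negative first
  term as an upper bound for the limit zero.
\<close>

lemma negative_null_sequence_incseq_subseq:
  fixes e :: "nat \<Rightarrow> real"
  assumes neg: "\<And>n. e n < 0" and lim: "e \<longlonglongrightarrow> 0"
  shows "\<exists>f. strict_mono f \<and> incseq (\<lambda>n. e (f n))"
proof -
  obtain f where f: "strict_mono (f :: nat \<Rightarrow> nat)" "monoseq (\<lambda>n. e (f n))" using seq_monosub[of e] by auto
  have lf: "(\<lambda>n. e (f n)) \<longlonglongrightarrow> 0" using LIMSEQ_subseq_LIMSEQ[OF lim f(1)] by (simp add: comp_def)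
  have "\<not> decseq (\<lambda>n. e (f n))"
  proof
    assume "decseq (\<lambda>n. e (f n))"
    then have "0 \<le> e (f 0)" using decseq_ge[OF _ lf] by blast
    then show False using neg[of "f 0"] by simp
  qed
  then show ?thesis using f by (auto simp: monoseq_iff)
qed

text \<open>
  Two uses of the absorption on the classes \<open>X\<^sub>k\<close>: with a fixed \<open>\<epsilon>\<close> it provides the coercivity needed to minimise
  for all large \<open>k\<close>; with \<open>\<epsilon> \<rightarrow> 0\<close> it gives \<open>J \<ge> - \<epsilon>/r\<close> on \<open>X\<^sub>k\<close> for all large \<open>k\<close>, so that the negative levels tend to zero.
\<close>

lemma (in plane) exists_solution_sequence:
  assumes b: "0 \<le> b" "b < \<eta>" "\<eta> < real DIM('a)"
    and \<delta>: "q * \<delta> + b = 2 * \<delta> + 2" and r: "1 < r" "r < q" "2 < q"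
    and up: "r * (real DIM('a) - 2) < 2 * (real DIM('a) - \<eta>)" and sub: "r * \<delta> + \<eta> < 2 * \<delta> + 2"
    and low: "q * (real DIM('a) - \<eta>) < r * (real DIM('a) - b)"
  shows "\<exists>u :: nat \<Rightarrow> 'a \<Rightarrow> real. (\<forall>k. weak_solution b q (power_nonlinearity \<eta> r) (u k) \<and>
      energy b q (power_nonlinearity \<eta> r) (u k) < 0) \<and>
    (\<lambda>k. energy b q (power_nonlinearity \<eta> r) (u k)) \<longlonglongrightarrow> 0"
proof -
  \<comment> \<open>Up to this \<epsilon> the quotient \<epsilon> / r is at most 1 / 4 and at most 1 / (2 q), half of the coefficients in the action.\<close>
  define \<epsilon>1 where "\<epsilon>1 = r / (2 * q)"
  have e1: "0 < \<epsilon>1" "\<epsilon>1 \<le> r / 4" using r by (auto simp: \<epsilon>1_def field_simps)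
  let ?X = "\<lambda>k::nat. rot_class i j (pi / real k)"
  have lower: "weighted_power \<eta> r u / r \<le> dirichlet (gradient u) / 4 + weighted_power b q u / (2 * q) + \<epsilon> / r"
    if \<epsilon>: "0 < \<epsilon>" "\<epsilon> \<le> \<epsilon>1"
      and le: "weighted_power \<eta> r u \<le> \<epsilon> * (dirichlet (gradient u) + weighted_power b q u) + \<epsilon>" for \<epsilon> and u :: "'a \<Rightarrow> real"
  proof -
    have "\<epsilon> \<le> r / 4" using \<epsilon>(2) e1(2) by (rule order_trans)
    then have "\<epsilon> / r \<le> 1 / 4" "\<epsilon> / r \<le> 1 / (2 * q)" using \<epsilon>(2) r by (auto simp: \<epsilon>1_def field_simps)
    then have "\<epsilon> / r * dirichlet (gradient u) \<le> 1 / 4 * dirichlet (gradient u)"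
      "\<epsilon> / r * weighted_power b q u \<le> 1 / (2 * q) * weighted_power b q u"
      by (auto intro!: mult_right_mono dirichlet_nonneg weighted_power_nonneg simp del: times_divide_eq_left)
    moreover have "weighted_power \<eta> r u / r \<le> (\<epsilon> * (dirichlet (gradient u) + weighted_power b q u) + \<epsilon>) / r"
      using le r by (intro divide_right_mono) auto
    moreover have "(\<epsilon> * (dirichlet (gradient u) + weighted_power b q u) + \<epsilon>) / r
      = \<epsilon> / r * dirichlet (gradient u) + \<epsilon> / r * weighted_power b q u + \<epsilon> / r"
      by (simp add: add_divide_distrib distrib_left)
    ultimately show ?thesis by simp
  qed
  have claim: "\<exists>K>0. \<forall>k\<ge>K. \<forall>u\<in>?X k. weighted_power \<eta> r u \<le> \<epsilon> * (dirichlet (gradient u) + weighted_power b q u) + \<epsilon>"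
    if \<epsilon>: "0 < \<epsilon>" for \<epsilon>
  proof -
    obtain \<theta>0 where \<theta>0: "\<theta>0 > 0" "\<And>\<theta> u. 0 < \<theta> \<Longrightarrow> \<theta> < \<theta>0 \<Longrightarrow> u \<in> rot_class i j \<theta> \<Longrightarrow>
        weighted_power \<eta> r u \<le> \<epsilon> * (dirichlet (gradient u) + weighted_power b q u) + \<epsilon>"
      using rot_class_absorption[OF b \<delta> r up sub low \<epsilon>] by blast
    obtain K :: nat where K: "pi / \<theta>0 < real K" using reals_Archimedean2 by blast
    have K0: "0 < real K" using K \<theta>0 by (smt (verit) divide_pos_pos pi_gt_zero)
    have "weighted_power \<eta> r u \<le> \<epsilon> * (dirichlet (gradient u) + weighted_power b q u) + \<epsilon>" if k: "k \<ge> K" and u: "u \<in> ?X k" for k u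
    proof (rule \<theta>0(2)[OF _ _ u])
      have "pi < \<theta>0 * real K" using K \<theta>0 by (simp add: divide_less_eq mult.commute)
      also have "\<dots> \<le> \<theta>0 * real k" using k \<theta>0 by simp
      finally show "pi / real k < \<theta>0" using k K0 by (simp add: divide_less_eq)
      show "0 < pi / real k" using k K0 by simp
    qed
    then show ?thesis using K0 by (intro exI[of _ K]) auto
  qed
  obtain K1 where K1: "K1 > 0" "\<And>k u. k \<ge> K1 \<Longrightarrow> u \<in> ?X k \<Longrightarrow>
      weighted_power \<eta> r u \<le> \<epsilon>1 * (dirichlet (gradient u) + weighted_power b q u) + \<epsilon>1"
    using claim[OF e1(1)] by blast
  have mini: "minimization b q \<eta> r \<delta> ((pi / real k)\<^sup>2 / 4) (?X k)" if k: "k \<ge> K1" for k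
  proof
    have k0: "0 < pi / real k" using k K1 by simp
    show "test_function u" if "u \<in> ?X k" for u using that by (simp add: rot_class_def)
    show "(\<lambda>x. s * u x + t * v x) \<in> ?X k" if "u \<in> ?X k" "v \<in> ?X k" for u v s t
      by (rule rot_class_lin[OF that])
    show "?X k \<noteq> {}" using zero_in_rot_class by blast
    show "(\<integral>\<^sup>+x. ennreal ((u x)\<^sup>2 / (norm x)\<^sup>2) \<partial>lborel)
      \<le> ennreal ((pi / real k)\<^sup>2 / 4) * (\<integral>\<^sup>+x. ennreal ((norm (gradient u x))\<^sup>2) \<partial>lborel)" if "u \<in> ?X k" for u
    proof -
      have "plane i j" by unfold_locales
      from antisymmetric_hardy[OF this _ k0, of u] that show ?thesis by (simp add: rot_class_def)
    qed
    show "weighted_power \<eta> r u / r \<le> dirichlet (gradient u) / 4 + weighted_power b q u / (2 * q) + 1" if "u \<in> ?X k" for u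
    proof -
      have "\<epsilon>1 / r \<le> 1" using e1 r by (simp add: divide_le_eq)
      then show ?thesis using lower[OF e1(1) order_refl K1(2)[OF k that]] by linarith
    qed
  qed (use b \<delta> r up sub low in auto)
  have "\<exists>U G w. minimizer b q \<eta> r \<delta> ((pi / real (K1 + n))\<^sup>2 / 4) (?X (K1 + n)) U G w" for n
    by (rule minimization.minimizer_exists[OF mini]) simp
  then obtain U G w where m: "\<And>n. minimizer b q \<eta> r \<delta> ((pi / real (K1 + n))\<^sup>2 / 4) (?X (K1 + n)) (U n) (G n) (w n)"
    by metis
  have pos: "0 < K1 + n" for n using K1 by simp
  note sol = rot_minimizer_solution[OF pos m]
  define e where "e n = energy b q (power_nonlinearity \<eta> r) (U n)" for n
  have e_eq: "e n = minimization.level b q \<eta> r (?X (K1 + n))" for n unfolding e_def by (rule sol(2))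
  have neg: "e n < 0" for n
  proof -
    have "K1 \<le> K1 + n" by simp
    then interpret minimization b q \<eta> r \<delta> "(pi / real (K1 + n))\<^sup>2 / 4" "?X (K1 + n)" by (rule mini)
    obtain u where "u \<in> ?X (K1 + n)" "action b q \<eta> r u (gradient u) < 0"
      using exists_negative_action[OF assms(1,2,3,4,5,6,7) sub pos] by blast
    then show ?thesis using level_le unfolding e_eq by fastforce
  qed
  have ge: "\<exists>n0. \<forall>n\<ge>n0. - \<epsilon> / r \<le> e n" if \<epsilon>: "0 < \<epsilon>" "\<epsilon> \<le> \<epsilon>1" for \<epsilon>
  proof -
    obtain K where K: "\<And>k u. k \<ge> K \<Longrightarrow> u \<in> ?X k \<Longrightarrow>
      weighted_power \<eta> r u \<le> \<epsilon> * (dirichlet (gradient u) + weighted_power b q u) + \<epsilon>" using claim[OF \<epsilon>(1)] by blast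
    have "- \<epsilon> / r \<le> e n" if n: "n \<ge> K" for n
    proof -
      have "K1 \<le> K1 + n" by simp
      then interpret minimization b q \<eta> r \<delta> "(pi / real (K1 + n))\<^sup>2 / 4" "?X (K1 + n)" by (rule mini)
      show ?thesis unfolding e_eq level_def
      proof (rule cInf_greatest)
        show "(\<lambda>u. action b q \<eta> r u (gradient u)) ` ?X (K1 + n) \<noteq> {}" using D_ne by simp
        fix y assume "y \<in> (\<lambda>u. action b q \<eta> r u (gradient u)) ` ?X (K1 + n)"
        then obtain u where u: "u \<in> ?X (K1 + n)" and y: "y = action b q \<eta> r u (gradient u)" by blast
        have "weighted_power \<eta> r u / r \<le> dirichlet (gradient u) / 4 + weighted_power b q u / (2 * q) + \<epsilon> / r"
          using n by (intro lower[OF \<epsilon> K[OF _ u]]) simp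
        moreover have "dirichlet (gradient u) / 4 \<le> dirichlet (gradient u) / 2" using dirichlet_nonneg[of "gradient u"] by simp
        moreover have "weighted_power b q u / (2 * q) \<le> weighted_power b q u / q"
          using weighted_power_nonneg[of b q u] r by (intro divide_left_mono) auto
        ultimately show "- \<epsilon> / r \<le> y" unfolding y action_def by simp
      qed
    qed
    then show ?thesis by blast
  qed
  have "e \<longlonglongrightarrow> 0"
  proof (rule tendstoI)
    fix d :: real assume d: "0 < d"
    define \<epsilon> where "\<epsilon> = min \<epsilon>1 (d * r / 2)"
    have \<epsilon>: "0 < \<epsilon>" "\<epsilon> \<le> \<epsilon>1" using e1 d r by (auto simp: \<epsilon>_def)
    have "\<epsilon> / r \<le> (d * r / 2) / r" using r by (intro divide_right_mono) (auto simp: \<epsilon>_def)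
    also have "\<dots> < d" using d r by simp
    finally have \<epsilon>d: "\<epsilon> / r < d" .
    obtain n0 where "\<And>n. n \<ge> n0 \<Longrightarrow> - \<epsilon> / r \<le> e n" using ge[OF \<epsilon>] by blast
    then have "dist (e n) 0 < d" if "n \<ge> n0" for n
      using that neg[of n] \<epsilon>d by (force simp: dist_real_def)
    then show "eventually (\<lambda>n. dist (e n) 0 < d) sequentially" by (auto simp: eventually_sequentially)
  qed
  then show ?thesis using sol(1) neg by (intro exI[of _ U]) (auto simp: e_def[abs_def])
qed

theorem theorem1p6:
  fixes b p q \<delta> a \<eta> r :: real
  assumes "2 \<le> CARD('n::finite)"
    and "0 \<le> b" and "b < 2" and "2 < p" and "p < q" and "ereal q < crit_exp CARD('n) b"
    and "\<delta> = (2 - b) / (q - 2)" and "a = 2 - \<delta> * (p - 2)"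
    and "subscaled CARD('n) b q \<delta> \<eta> r"
  shows "\<exists>u :: nat \<Rightarrow> real ^ 'n \<Rightarrow> real.
    (\<forall>k. weak_solution b q (power_nonlinearity \<eta> r) (u k) \<and>
         energy b q (power_nonlinearity \<eta> r) (u k) < 0) \<and>
    incseq (\<lambda>k. energy b q (power_nonlinearity \<eta> r) (u k)) \<and>
    (\<lambda>k. energy b q (power_nonlinearity \<eta> r) (u k)) \<longlonglongrightarrow> 0"
proof -
  have q: "2 < q" using assms by simp
  note ex = subscaled_exponents[OF assms(1,2,3) q assms(6,7,9)]
  have dim: "DIM(real ^ 'n) = CARD('n)" by simp
  have "\<not> card (Basis :: (real ^ 'n) set) \<le> Suc 0" using assms(1) dim by simp
  then obtain i j :: "real ^ 'n" where ij: "i \<in> Basis" "j \<in> Basis" "i \<noteq> j"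
    unfolding card_le_Suc0_iff_eq[OF finite_Basis] by blast
  interpret plane i j by (unfold_locales) (rule ij)+
  obtain u :: "nat \<Rightarrow> real ^ 'n \<Rightarrow> real" where
    u: "\<And>k. weak_solution b q (power_nonlinearity \<eta> r) (u k)" "\<And>k. energy b q (power_nonlinearity \<eta> r) (u k) < 0"
    and lim: "(\<lambda>k. energy b q (power_nonlinearity \<eta> r) (u k)) \<longlonglongrightarrow> 0"
    using exists_solution_sequence[of b \<eta> q \<delta> r] ex assms(2) q unfolding dim by blast
  obtain f where f: "strict_mono f" "incseq (\<lambda>n. energy b q (power_nonlinearity \<eta> r) (u (f n)))"
    using negative_null_sequence_incseq_subseq[OF u(2) lim] by blast
  have "(\<lambda>n. energy b q (power_nonlinearity \<eta> r) (u (f n))) \<longlonglongrightarrow> 0"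
    using LIMSEQ_subseq_LIMSEQ[OF lim f(1)] by (simp add: comp_def)
  then show ?thesis using u f(2) by (intro exI[of _ "\<lambda>n. u (f n)"]) auto
qed

end
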